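(* Let $f$ denote the second-order correlation function of the characteristic polynomial of an unrescaled real sample covariance matrix, and let $b^*:=b-3$. For any $\alpha\in\mathbb{N}$, $\xi\in(0,4)$, $\mu,\nu\in\mathbb{R}$, put $n:=N$, $m:=N-\alpha$, and $$ Z_N(\xi,\mu,\nu):=\left(N^2\xi^2+N\xi(\mu+\nu)+\mu\nu\right)^{\alpha/2}\exp\left(-N\xi-\tfrac12(\mu+\nu)\right). $$ Then $$ \lim_{N\to\infty}\left(N^{-1}\,\xi^{-1}\,\big(g(\xi)\big)^{-3}\,Z_N\big(\xi,\mu/g(\xi),\nu/g(\xi)\big)\cdot\frac{f\big(n,m;N\xi+\mu/g(\xi),N\xi+\nu/g(\xi)\big)}{n!\,m!}\right)=\exp(b^* )\,\widetilde{\mathbb{S}}(\mu,\nu). $$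
   Context: Here $\mathbb{N}=\{0,1,2,\dots\}$ and $\alpha$ is fixed as $N\to\infty$ ($N\ge\alpha$). Let $Q$ be a probability distribution on the real line with expectation $0$, variance $1$ and finite fourth moment $b$ (i.e. $b=\int x^4\,dQ(x)<\infty$). For $n\ge m$, let $X=X(n,m)$ be the $n\times m$ random matrix whose entries are i.i.d. real random variables with distribution $Q$, and let $X^T$ be its transpose. The $m\times m$ matrix $X(n,m)^TX(n,m)$ is the unrescaled real sample covariance matrix. For $\mu,\nu\in\mathbb{C}$, $$ f(n,m;\mu,\nu):=\mathbb{E}\big(\det(X(n,m)^TX(n,m)-\mu)\,\det(X(n,m)^TX(n,m)-\nu)\big), $$ where $\mu,\nu$ inside the determinants stand for $\mu I_m,\nu I_m$. The Marčenko–Pastur density is $$ g(\xi)=\frac{1}{2\pi\xi}\sqrt{\xi(4-\xi)}\qquad(\xi\in(0,4)). $$ The ``differentiated'' sine kernel is $$ \widetilde{\mathbb{S}}(x,y):=\frac{2\sin\pi(x-y)}{\pi(x-y)^3}-\frac{2\cos\pi(x-y)}{(x-y)^2}, $$ understood for $x=y$ as its continuous extension. The base of the power $\alpha/2$ in $Z_N$ is positive for all sufficiently large $N$. *)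

theory Defs
  imports "HOL-Probability.Probability" "HOL-Real_Asymp.Real_Asymp" "Jordan_Normal_Form.Determinant"
begin

text \<open>Both HOL-Analysis and Jordan_Normal_Form provide \<open>det\<close>, \<open>mat\<close> and \<open>transpose\<close>;
  the dimension-as-a-number versions of the latter are used throughout.\<close>

text \<open>The i.i.d. random matrix with entry distribution \<open>Q\<close> in its canonical model: the sample space
  consists of the families of entries, indexed by \<open>{..<n} \<times> {..<m}\<close> and carrying the
  product measure.\<close>

definition entry_space :: "real measure \<Rightarrow> nat \<Rightarrow> nat \<Rightarrow> (nat \<times> nat \<Rightarrow> real) measure" where
  "entry_space Q n m = PiM ({..<n} \<times> {..<m}) (\<lambda>_. Q)"

definition data_matrix :: "nat \<Rightarrow> nat \<Rightarrow> (nat \<times> nat \<Rightarrow> real) \<Rightarrow> real Matrix.mat" where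
  "data_matrix n m \<omega> = Matrix.mat n m \<omega>"

definition sample_cov :: "nat \<Rightarrow> nat \<Rightarrow> (nat \<times> nat \<Rightarrow> real) \<Rightarrow> real Matrix.mat" where
  "sample_cov n m \<omega> = transpose_mat (data_matrix n m \<omega>) * data_matrix n m \<omega>"

definition det_shift :: "nat \<Rightarrow> real Matrix.mat \<Rightarrow> complex \<Rightarrow> complex" where
  "det_shift m A \<mu> = Determinant.det (map_mat complex_of_real A - \<mu> \<cdot>\<^sub>m 1\<^sub>m m)"

definition corr_fun :: "real measure \<Rightarrow> nat \<Rightarrow> nat \<Rightarrow> complex \<Rightarrow> complex \<Rightarrow> complex" where
  "corr_fun Q n m \<mu> \<nu> =
     (\<integral>\<omega>. det_shift m (sample_cov n m \<omega>) \<mu> * det_shift m (sample_cov n m \<omega>) \<nu> \<partial>(entry_space Q n m))"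

definition mp_density :: "real \<Rightarrow> real" where
  "mp_density \<xi> = 1 / (2 * pi * \<xi>) * sqrt (\<xi> * (4 - \<xi>))"

text \<open>The value on the diagonal is the continuous extension, see the lemma below.\<close>

definition diff_sine_kernel :: "real \<Rightarrow> real \<Rightarrow> real" where
  "diff_sine_kernel x y =
     (if x = y then 2 * pi\<^sup>2 / 3
      else 2 * sin (pi * (x - y)) / (pi * (x - y) ^ 3) - 2 * cos (pi * (x - y)) / (x - y)\<^sup>2)"

lemma continuous_diff_sine_kernel:
  "continuous_on UNIV (\<lambda>(x, y). diff_sine_kernel x y)"
proof -
  define h :: "real \<Rightarrow> real" where "h = (\<lambda>d. diff_sine_kernel d 0)"
  have h0: "isCont h 0"
  proof -
    have "((\<lambda>d::real. 2 * sin (pi * d) / (pi * d ^ 3) - 2 * cos (pi * d) / d\<^sup>2) \<longlongrightarrow> 2 * pi\<^sup>2 / 3) (at 0)"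
      by real_asymp (simp_all add: field_simps power2_eq_square)
    moreover have "\<forall>\<^sub>F d in at 0. 2 * sin (pi * d) / (pi * d ^ 3) - 2 * cos (pi * d) / d\<^sup>2 = h d"
      unfolding eventually_at_filter by (simp add: h_def diff_sine_kernel_def)
    ultimately have "(h \<longlongrightarrow> 2 * pi\<^sup>2 / 3) (at 0)"
      by (rule Lim_transform_eventually)
    then show ?thesis
      by (simp add: isCont_def h_def diff_sine_kernel_def)
  qed
  have "isCont h d" if "d \<noteq> 0" for d
  proof -
    have "isCont (\<lambda>d::real. 2 * sin (pi * d) / (pi * d ^ 3) - 2 * cos (pi * d) / d\<^sup>2) d"
      using that by (intro continuous_intros) auto
    moreover have "\<forall>\<^sub>F e in nhds d. 2 * sin (pi * e) / (pi * e ^ 3) - 2 * cos (pi * e) / e\<^sup>2 = h e"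
      using t1_space_nhds[OF that] by eventually_elim (simp add: h_def diff_sine_kernel_def)
    ultimately show ?thesis
      by (rule isCont_cong[THEN iffD1, rotated])
  qed
  with h0 have "continuous_on UNIV h"
    by (metis continuous_at_imp_continuous_on)
  then have "continuous_on UNIV (\<lambda>p. h (fst p - snd p))"
    by (rule continuous_on_compose2) (auto intro!: continuous_intros)
  moreover have "(\<lambda>p. h (fst p - snd p)) = (\<lambda>(x, y). diff_sine_kernel x y)"
    by (auto simp: fun_eq_iff h_def diff_sine_kernel_def)
  ultimately show ?thesis
    by (simp only:)
qed

definition Z_factor :: "nat \<Rightarrow> nat \<Rightarrow> real \<Rightarrow> real \<Rightarrow> real \<Rightarrow> real" where
  "Z_factor \<alpha> N \<xi> \<mu> \<nu> =
     ((real N)\<^sup>2 * \<xi>\<^sup>2 + real N * \<xi> * (\<mu> + \<nu>) + \<mu> * \<nu>) powr (real \<alpha> / 2)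
       * exp (- real N * \<xi> - (\<mu> + \<nu>) / 2)"

end

theory Submission
  imports Defs "HOL-Complex_Analysis.Complex_Analysis"
begin

text \<open>Adding a row \<open>r\<close> to the data matrix turns \<open>S = X\<^sup>T X\<close> into \<open>S + r r\<^sup>T\<close>. By the matrix determinant
  lemma the two shifted determinants become quadratic forms in \<open>r\<close>, and the adjugates in the expectation
  of their product are eliminated by differentiation in \<open>\<mu>, \<nu>\<close> and by the resolvent identity
  \<open>(\<mu> - \<nu>) adj(S - \<mu>) adj(S - \<nu>) = det(S - \<nu>) adj(S - \<mu>) - det(S - \<mu>) adj(S - \<nu>)\<close>.
  This is a linear recursion in \<open>n\<close> for \<open>f(n, m)\<close>, which is solved explicitly in the variables \<open>s = \<mu> + \<nu>\<close>
  and \<open>p = \<mu>\<nu>\<close>: for \<open>n = m + \<alpha>\<close>, \<open>f(n, m) / (n! m!)\<close> is the \<open>m\<close>-th Taylor coefficient of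
  \<open>exp((b - 3) z) exp(- s z / (1 - z)) (1 - z)\<^bsup>- \<alpha> - 3\<^esup> \<Sum>\<^sub>k (p z / (1 - z)\<^sup>2)\<^bsup>k\<^esup> / (k! (k + \<alpha>)!)\<close>.

  Cauchy's formula on the circle of radius \<open>exp(- 1 / N)\<close>, together with Bessel's integral for the last
  factor, gives a double integral over two angles. In the scale \<open>1 / N\<close> of both angles the exponents
  converge, and the singularity of order three at \<open>z = 1\<close> provides an integrable majorant. The limit is
  \<open>\<integral>\<integral> exp(a p - (D + \<xi> v\<^sup>2) / p) p\<^bsup>-3\<^esup> dv du\<close> with \<open>p = 1 - i u\<close> and \<open>a = 1 - \<xi> / 4\<close>. Replacing the Gaussian
  in \<open>v\<close> by the dual Gaussian in \<open>k\<close> leaves the inverse Laplace transform of \<open>p\<^bsup>-2\<^esup>\<close>, the positive part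
  of \<open>a - k\<^sup>2 / (4 \<xi>)\<close>, and the Fourier transform of this truncated parabola is the differentiated
  sine kernel.\<close>

subsection \<open>Determinants\<close>

text \<open>Four moments suffice because each determinant has degree at most two in every single
  entry: a product of two of them has degree at most four. Compared with Gaussian entries, the
  fourth cumulant \<open>b - 3\<close> only adds a term with one column deleted. In the generating
  function this becomes the entire factor exp((b - 3) z), which tends to the constant exp(b - 3)
  near z = 1. The obstacle in the asymptotics is cancellation. At distance 1 / N from z = 1, and
  with both arguments of f of order N, the exponential factor and the Bessel factor each have
  exponents of order N^2. They are merged before anything is estimated: with q = sqrt(\<mu> \<nu>)
  and \<mu> + \<nu> = d + 2 q, Bessel's integral leaves a term in d, which is only of order 1 / N,
  and two terms in q, each carrying a small factor. All three have nonpositive real part on the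
  contour. The radius exp(- 1 / N) keeps the power of 1 / z bounded and yet resolves the singularity
  in its natural scale.\<close>

definition fdet :: "nat \<Rightarrow> (nat \<Rightarrow> nat \<Rightarrow> 'a) \<Rightarrow> 'a::comm_ring_1" where
  "fdet m a = Determinant.det (Matrix.mat m m (\<lambda>(i, j). a i j))"

definition fcof :: "nat \<Rightarrow> (nat \<Rightarrow> nat \<Rightarrow> 'a) \<Rightarrow> nat \<Rightarrow> nat \<Rightarrow> 'a::comm_ring_1" where
  "fcof m a i j = cofactor (Matrix.mat m m (\<lambda>(i, j). a i j)) i j"

lemma fdet_leibniz:
  "fdet m a = (\<Sum>p | p permutes {0..<m}. signof p * (\<Prod>i = 0..<m. a i (p i)))"
proof -
  have "(\<Prod>i = 0..<m. Matrix.mat m m (\<lambda>(i, j). a i j) $$ (i, p i)) = (\<Prod>i = 0..<m. a i (p i))"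
    if "p permutes {0..<m}" for p
    using permutes_in_image[OF that] by (intro prod.cong) auto
  then show ?thesis
    unfolding fdet_def by (subst det_def'[of _ m]) auto
qed

lemma fdet_cong:
  assumes "\<And>i j. i < m \<Longrightarrow> j < m \<Longrightarrow> a i j = b i j"
  shows "fdet m a = fdet m b"
  unfolding fdet_def by (rule arg_cong[where f = Determinant.det]) (auto intro!: Matrix.eq_matI assms)

text \<open>Multilinearity in the rows: in each Leibniz term the product of sums is expanded over
  the set \<open>T\<close> of factors taken from \<open>b\<close>, and the two sums are
  exchanged.\<close>

lemma fdet_add_expand:
  "fdet m (\<lambda>i j. a i j + b i j) = (\<Sum>T\<in>Pow {0..<m}. fdet m (\<lambda>i j. if i \<in> T then b i j else a i j))"
proof -
  have "fdet m (\<lambda>i j. a i j + b i j)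
      = (\<Sum>p | p permutes {0..<m}. signof p *
          (\<Sum>T\<in>Pow {0..<m}. (\<Prod>i\<in>T. b i (p i)) * (\<Prod>i\<in>{0..<m} - T. a i (p i))))"
    unfolding fdet_leibniz by (subst prod_add[symmetric]) (auto simp: add.commute)
  also have "\<dots> = (\<Sum>p | p permutes {0..<m}. \<Sum>T\<in>Pow {0..<m}.
      signof p * (\<Prod>i = 0..<m. if i \<in> T then b i (p i) else a i (p i)))"
  proof (intro sum.cong refl, subst sum_distrib_left, intro sum.cong refl arg_cong2[where f = "(*)"])
    fix p T assume "T \<in> Pow {0..<m}"
    then show "(\<Prod>i\<in>T. b i (p i)) * (\<Prod>i\<in>{0..<m} - T. a i (p i))
        = (\<Prod>i = 0..<m. if i \<in> T then b i (p i) else a i (p i))"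
      by (subst prod.If_cases) (auto simp: Int_absorb1 Int_absorb2 Diff_eq)
  qed
  also have "\<dots> = (\<Sum>T\<in>Pow {0..<m}. fdet m (\<lambda>i j. if i \<in> T then b i j else a i j))"
    unfolding fdet_leibniz by (rule sum.swap)
  finally show ?thesis .
qed

text \<open>Laplace expansion along row \<open>i\<close>; the cofactors of that row do not see its
  entries, so they are those of \<open>a\<close>.\<close>

lemma fdet_replace_row:
  assumes "i < m"
  shows "fdet m (\<lambda>i' j. if i' = i then v j else a i' j) = (\<Sum>j<m. v j * fcof m a i j)"
proof -
  let ?B = "Matrix.mat m m (\<lambda>(i', j). if i' = i then v j else a i' j)"
  let ?A = "Matrix.mat m m (\<lambda>(i, j). a i j)"
  have "mat_delete ?B i j = mat_delete ?A i j" if "j < m" for j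
    using assms that unfolding mat_delete_def by (intro Matrix.eq_matI) auto
  then have "cofactor ?B i j = cofactor ?A i j" if "j < m" for j
    using that unfolding cofactor_def by simp
  then show ?thesis
    unfolding fdet_def fcof_def using assms by (subst laplace_expansion_row[of _ m i]) auto
qed

lemma fdet_scaled_rows:
  assumes "T \<subseteq> {0..<m}"
  shows "fdet m (\<lambda>i j. if i \<in> T then u i * b i j else a i j)
       = (\<Prod>i\<in>T. u i) * fdet m (\<lambda>i j. if i \<in> T then b i j else a i j)"
proof -
  have "(\<Prod>i = 0..<m. if i \<in> T then u i * b i (p i) else a i (p i))
      = (\<Prod>i\<in>T. u i) * (\<Prod>i = 0..<m. if i \<in> T then b i (p i) else a i (p i))" for p
    using assms by (simp add: prod.If_cases prod.distrib Int_absorb1 Int_absorb2 algebra_simps)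
  then show ?thesis
    unfolding fdet_leibniz by (simp add: sum_distrib_left algebra_simps)
qed

text \<open>Serves two expansions over sets of rows: in a rank one update two replaced rows are
  parallel, and in a derivative at 0 all powers beyond the first vanish.\<close>

lemma sum_Pow_card_le_1:
  fixes g :: "'b set \<Rightarrow> 'a::comm_monoid_add"
  assumes "finite A" "\<And>T. T \<subseteq> A \<Longrightarrow> card T \<ge> 2 \<Longrightarrow> g T = 0"
  shows "(\<Sum>T\<in>Pow A. g T) = g {} + (\<Sum>i\<in>A. g {i})"
proof -
  have *: "(\<Sum>T\<in>Pow A. g T) = (\<Sum>T\<in>insert {} ((\<lambda>i. {i}) ` A). g T)"
  proof (rule sum.mono_neutral_right)
    show "\<forall>T\<in>Pow A - insert {} ((\<lambda>i. {i}) ` A). g T = 0"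
    proof
      fix T assume T: "T \<in> Pow A - insert {} ((\<lambda>i. {i}) ` A)"
      then have "finite T" "card T \<noteq> 0" "card T \<noteq> 1"
        using assms(1) by (auto dest: finite_subset simp: card_1_singleton_iff)
      then have "card T \<ge> 2" by linarith
    then show "g T = 0" using T by (intro assms(2)) auto
    qed
  qed (use assms in auto)
  show ?thesis
    unfolding * using assms(1) by (subst sum.insert) (auto simp: sum.reindex inj_on_def)
qed

text \<open>Matrix determinant lemma in adjugate form. Two replaced rows are both multiples of
  \<open>v\<close>, so only sets of at most one replaced row survive, and a single one gives
  cofactors. No inverse occurs, so singular matrices are included.\<close>

lemma fdet_rank_one_update:
  fixes a :: "nat \<Rightarrow> nat \<Rightarrow> 'a::comm_ring_1"
  shows "fdet m (\<lambda>i j. a i j + u i * v j) = fdet m a + (\<Sum>i<m. \<Sum>j<m. u i * v j * fcof m a i j)"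
proof -
  have zero: "fdet m (\<lambda>i j. if i \<in> T then u i * v j else a i j) = 0"
    if T: "T \<subseteq> {0..<m}" "card T \<ge> 2" for T
  proof -
    obtain i j where ij: "i \<in> T" "j \<in> T" "i \<noteq> j"
      using T(2) by (metis card_le_Suc0_iff_eq card.infinite not_less_eq_eq numeral_2_eq_2 not_numeral_le_zero)
    then have "fdet m (\<lambda>i j. if i \<in> T then v j else a i j) = 0"
      unfolding fdet_def using T(1) subsetD[OF T(1) ij(1)] subsetD[OF T(1) ij(2)]
      by (intro det_identical_rows[of _ m i j]) (auto intro!: eq_vecI)
    then show ?thesis using fdet_scaled_rows[OF T(1), of u "\<lambda>_. v" a] by simp
  qed
  have "fdet m (\<lambda>i j. a i j + u i * v j)
      = fdet m a + (\<Sum>i\<in>{0..<m}. fdet m (\<lambda>i' j. if i' \<in> {i} then u i' * v j else a i' j))"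
    unfolding fdet_add_expand by (subst sum_Pow_card_le_1) (auto simp: zero)
  also have "(\<Sum>i\<in>{0..<m}. fdet m (\<lambda>i' j. if i' \<in> {i} then u i' * v j else a i' j))
      = (\<Sum>i\<in>{0..<m}. \<Sum>j<m. u i * v j * fcof m a i j)"
  proof (intro sum.cong refl)
    fix i assume "i \<in> {0..<m}"
    then show "fdet m (\<lambda>i' j. if i' \<in> {i} then u i' * v j else a i' j) = (\<Sum>j<m. u i * v j * fcof m a i j)"
      using fdet_replace_row[of i m "\<lambda>j. u i * v j" a] by (simp cong: if_cong)
  qed
  finally show ?thesis by (simp add: lessThan_atLeast0)
qed

text \<open>The characteristic polynomial in terms of principal minors: replacing the rows in
  \<open>T\<close> by unit vectors leaves the minor on the complement of \<open>T\<close>.\<close>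

lemma fdet_add_scalar:
  "fdet m (\<lambda>i j. a i j + (if i = j then t else 0))
     = (\<Sum>T\<in>Pow {0..<m}. t ^ card T * fdet m (\<lambda>i j. if i \<in> T then of_bool (i = j) else a i j))"
proof -
  have "fdet m (\<lambda>i j. a i j + (if i = j then t else 0))
     = (\<Sum>T\<in>Pow {0..<m}. fdet m (\<lambda>i j. if i \<in> T then t * of_bool (i = j) else a i j))"
    by (simp add: fdet_add_expand if_distrib[of "(*) t"] of_bool_def cong: if_cong)
  then show ?thesis by (simp add: fdet_scaled_rows)
qed

text \<open>Jacobi's formula for the derivative of a determinant. The determinant of
  \<open>a\<close> with \<open>t - \<mu>\<close> added on the diagonal is expanded once around
  \<open>a\<close> and once around the shifted matrix; the derivatives at t = 0 are compared, where
  the second expansion retains only singletons, that is, diagonal cofactors.\<close>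

lemma trace_fcof_shift:
  fixes a :: "nat \<Rightarrow> nat \<Rightarrow> real"
  shows "(\<Sum>i<m. fcof m (\<lambda>i j. a i j - (if i = j then \<mu> else 0)) i i)
     = (\<Sum>T\<in>Pow {0..<m}. real (card T) * (- \<mu>) ^ (card T - 1) *
          fdet m (\<lambda>i j. if i \<in> T then of_bool (i = j) else a i j))"
proof -
  let ?c = "\<lambda>i j. a i j - (if i = j then \<mu> else 0)"
  let ?D = "\<lambda>a T. fdet m (\<lambda>i j. if i \<in> T then of_bool (i = j) else a i j)"
  have *: "(\<Sum>T\<in>Pow {0..<m}. (t - \<mu>) ^ card T * ?D a T) = (\<Sum>T\<in>Pow {0..<m}. t ^ card T * ?D ?c T)" for t
  proof -
    have "(\<Sum>T\<in>Pow {0..<m}. (t - \<mu>) ^ card T * ?D a T) = fdet m (\<lambda>i j. ?c i j + (if i = j then t else 0))"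
      unfolding fdet_add_scalar[symmetric] by (rule fdet_cong) auto
    then show ?thesis by (simp only: fdet_add_scalar)
  qed
  have "((\<lambda>t. \<Sum>T\<in>Pow {0..<m}. (t - \<mu>) ^ card T * ?D a T) has_real_derivative
      (\<Sum>T\<in>Pow {0..<m}. real (card T) * (0 - \<mu>) ^ (card T - 1) * ?D a T)) (at 0)"
    by (auto intro!: derivative_eq_intros sum.cong)
  moreover have "((\<lambda>t. \<Sum>T\<in>Pow {0..<m}. t ^ card T * ?D ?c T) has_real_derivative
      (\<Sum>T\<in>Pow {0..<m}. real (card T) * 0 ^ (card T - 1) * ?D ?c T)) (at 0)"
    by (auto intro!: derivative_eq_intros sum.cong)
  ultimately have "(\<Sum>T\<in>Pow {0..<m}. real (card T) * (0 - \<mu>) ^ (card T - 1) * ?D a T)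
      = (\<Sum>T\<in>Pow {0..<m}. real (card T) * 0 ^ (card T - 1) * ?D ?c T)"
    unfolding * by (rule DERIV_unique)
  also have "\<dots> = (\<Sum>i\<in>{0..<m}. ?D ?c {i})"
    by (subst sum_Pow_card_le_1) (auto simp: power_0_left)
  also have "\<dots> = (\<Sum>i\<in>{0..<m}. fcof m ?c i i)"
  proof (intro sum.cong refl)
    fix i assume i: "i \<in> {0..<m}"
    have "?D ?c {i} = (\<Sum>j<m. of_bool (i = j) * fcof m ?c i j)"
      using i fdet_replace_row[of i m "\<lambda>j. of_bool (i = j)" ?c] by (simp cong: if_cong)
    also have "\<dots> = (\<Sum>j<m. if j = i then fcof m ?c i j else 0)"
      by (rule sum.cong) auto
    also have "\<dots> = fcof m ?c i i" using i by simp
    finally show "?D ?c {i} = fcof m ?c i i" .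
  qed
  finally show ?thesis by (simp add: lessThan_atLeast0)
qed

text \<open>The relation A(\<nu>) = A(\<mu>) + (\<mu> - \<nu>) I is multiplied by adj A(\<mu>) from
  the left and by adj A(\<nu>) from the right, and the trace is taken. Adjugates instead of inverses
  keep it valid at eigenvalues.\<close>

lemma fcof_resolvent_identity:
  fixes a :: "nat \<Rightarrow> nat \<Rightarrow> 'a::comm_ring_1"
  shows "(\<mu> - \<nu>) * (\<Sum>i<m. \<Sum>j<m. fcof m (\<lambda>i j. a i j - (if i = j then \<mu> else 0)) i j *
             fcof m (\<lambda>i j. a i j - (if i = j then \<nu> else 0)) j i)
    = fdet m (\<lambda>i j. a i j - (if i = j then \<nu> else 0)) *
        (\<Sum>i<m. fcof m (\<lambda>i j. a i j - (if i = j then \<mu> else 0)) i i)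
    - fdet m (\<lambda>i j. a i j - (if i = j then \<mu> else 0)) *
        (\<Sum>i<m. fcof m (\<lambda>i j. a i j - (if i = j then \<nu> else 0)) i i)"
proof -
  define A where "A \<mu> = Matrix.mat m m (\<lambda>(i, j). a i j - (if i = j then \<mu> else 0))" for \<mu>
  have A: "A \<mu> \<in> carrier_mat m m" "adj_mat (A \<mu>) \<in> carrier_mat m m" for \<mu>
    using adj_mat(1)[of "A \<mu>" m] by (auto simp: A_def)
  have AB: "A \<nu> = A \<mu> + (\<mu> - \<nu>) \<cdot>\<^sub>m 1\<^sub>m m"
    by (rule Matrix.eq_matI) (auto simp: A_def)
  let ?P = "adj_mat (A \<mu>)" and ?R = "adj_mat (A \<nu>)"
  have "Determinant.det (A \<nu>) \<cdot>\<^sub>m ?P = ?P * (A \<nu> * ?R)"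
    by (metis A adj_mat(2) mult_smult_distrib one_carrier_mat right_mult_one_mat)
  also have "\<dots> = ?P * (A \<mu> * ?R + (\<mu> - \<nu>) \<cdot>\<^sub>m ?R)"
  proof -
    have "A \<nu> * ?R = A \<mu> * ?R + ((\<mu> - \<nu>) \<cdot>\<^sub>m 1\<^sub>m m) * ?R"
      by (subst (1) AB) (rule add_mult_distrib_mat[of _ m m _ _ m], use A in auto)
    also have "((\<mu> - \<nu>) \<cdot>\<^sub>m 1\<^sub>m m) * ?R = (\<mu> - \<nu>) \<cdot>\<^sub>m ?R"
      using A by (metis left_mult_one_mat mult_smult_assoc_mat one_carrier_mat)
    finally show ?thesis by simp
  qed
  also have "\<dots> = ?P * (A \<mu> * ?R) + ?P * ((\<mu> - \<nu>) \<cdot>\<^sub>m ?R)"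
    by (rule mult_add_distrib_mat[of _ m m _ m]) (use A in \<open>auto intro!: mult_carrier_mat[of _ m m]\<close>)
  also have "?P * (A \<mu> * ?R) = Determinant.det (A \<mu>) \<cdot>\<^sub>m ?R"
  proof -
    have "?P * (A \<mu> * ?R) = ?P * A \<mu> * ?R"
      by (rule assoc_mult_mat[symmetric, of _ m m _ m _ m]) (use A in auto)
    also have "\<dots> = (Determinant.det (A \<mu>) \<cdot>\<^sub>m 1\<^sub>m m) * ?R"
      using adj_mat(3)[OF A(1)] by simp
    also have "\<dots> = Determinant.det (A \<mu>) \<cdot>\<^sub>m (1\<^sub>m m * ?R)"
      by (rule mult_smult_assoc_mat[of _ m m _ m]) (use A in auto)
    also have "1\<^sub>m m * ?R = ?R" by (rule left_mult_one_mat) (rule A)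
    finally show ?thesis .
  qed
  also have "?P * ((\<mu> - \<nu>) \<cdot>\<^sub>m ?R) = (\<mu> - \<nu>) \<cdot>\<^sub>m (?P * ?R)"
    by (rule mult_smult_distrib[of _ m m _ m]) (use A in auto)
  finally have M: "Determinant.det (A \<nu>) \<cdot>\<^sub>m ?P = Determinant.det (A \<mu>) \<cdot>\<^sub>m ?R + (\<mu> - \<nu>) \<cdot>\<^sub>m (?P * ?R)" .
  have E: "Determinant.det (A \<nu>) * cofactor (A \<mu>) i i = Determinant.det (A \<mu>) * cofactor (A \<nu>) i i +
     (\<mu> - \<nu>) * (\<Sum>j<m. cofactor (A \<mu>) j i * cofactor (A \<nu>) i j)" if "i < m" for i
  proof -
    have "(Determinant.det (A \<nu>) \<cdot>\<^sub>m ?P) $$ (i, i) = Determinant.det (A \<nu>) * cofactor (A \<mu>) i i"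
      using that A by (auto simp: adj_mat_def A_def)
    moreover have "(Determinant.det (A \<mu>) \<cdot>\<^sub>m ?R + (\<mu> - \<nu>) \<cdot>\<^sub>m (?P * ?R)) $$ (i, i)
       = Determinant.det (A \<mu>) * cofactor (A \<nu>) i i +
         (\<mu> - \<nu>) * (\<Sum>j<m. cofactor (A \<mu>) j i * cofactor (A \<nu>) i j)"
      using that A by (auto simp: adj_mat_def A_def scalar_prod_def lessThan_atLeast0)
    ultimately show ?thesis using M by simp
  qed
  have "Determinant.det (A \<nu>) * (\<Sum>i<m. cofactor (A \<mu>) i i)
     = Determinant.det (A \<mu>) * (\<Sum>i<m. cofactor (A \<nu>) i i) +
       (\<mu> - \<nu>) * (\<Sum>i<m. \<Sum>j<m. cofactor (A \<mu>) j i * cofactor (A \<nu>) i j)"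
    by (simp add: sum_distrib_left E sum.distrib)
  moreover have "(\<Sum>i<m. \<Sum>j<m. cofactor (A \<mu>) j i * cofactor (A \<nu>) i j)
     = (\<Sum>i<m. \<Sum>j<m. cofactor (A \<mu>) i j * cofactor (A \<nu>) j i)"
    by (rule sum.swap)
  ultimately show ?thesis
    unfolding fdet_def fcof_def A_def by (simp add: algebra_simps)
qed

text \<open>Makes the two contractions of cofactor matrices in the fourth-moment formula
  coincide.\<close>

lemma fcof_symmetric:
  assumes "\<And>i j. i < m \<Longrightarrow> j < m \<Longrightarrow> a i j = a j i" "i < m" "j < m"
  shows "fcof m a i j = fcof m a j i"
proof -
  let ?A = "Matrix.mat m m (\<lambda>(i, j). a i j)"
  have "mat_delete ?A j i = transpose_mat (mat_delete ?A i j)"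
    using assms unfolding mat_delete_def by (intro Matrix.eq_matI) auto
  moreover have "mat_delete ?A i j \<in> carrier_mat (m - 1) (m - 1)"
    by (intro mat_delete_carrier) auto
  ultimately show ?thesis
    unfolding fcof_def cofactor_def by (simp add: det_transpose[of _ "m - 1"] add.commute)
qed

lemma fcof_minor:
  assumes "i < m" "j < m"
  shows "fcof m a i j = (- 1) ^ (i + j) * fdet (m - 1) (\<lambda>i' j'. a (insert_index i i') (insert_index j j'))"
proof -
  have "mat_delete (Matrix.mat m m (\<lambda>(i, j). a i j)) i j
      = Matrix.mat (m - 1) (m - 1) (\<lambda>(i', j'). a (insert_index i i') (insert_index j j'))"
    using assms unfolding mat_delete_def insert_index_def by (intro Matrix.eq_matI) auto
  then show ?thesis
    unfolding fcof_def cofactor_def fdet_def by simp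
qed

text \<open>The bound on the entries factors into a row weight and a column weight, so each
  permutation gives the same product of weights.\<close>

lemma abs_fdet_le:
  fixes a :: "nat \<Rightarrow> nat \<Rightarrow> real"
  assumes "\<And>i j. i < m \<Longrightarrow> j < m \<Longrightarrow> \<bar>a i j\<bar> \<le> C * w i * w' j"
    and "C \<ge> 0" "\<And>i. i < m \<Longrightarrow> w i \<ge> 0" "\<And>i. i < m \<Longrightarrow> w' i \<ge> 0"
  shows "\<bar>fdet m a\<bar> \<le> fact m * C ^ m * (\<Prod>i<m. w i) * (\<Prod>i<m. w' i)"
proof -
  have "\<bar>fdet m a\<bar> \<le> (\<Sum>p | p permutes {0..<m}. \<bar>signof p * (\<Prod>i = 0..<m. a i (p i))\<bar>)"
    unfolding fdet_leibniz by (rule sum_abs)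
  also have "\<dots> \<le> (\<Sum>p | p permutes {0..<m}. C ^ m * (\<Prod>i<m. w i) * (\<Prod>i<m. w' i))"
  proof (rule sum_mono)
    fix p assume "p \<in> {p. p permutes {0..<m}}"
    then have p: "p permutes {0..<m}" by simp
    have "\<bar>signof p * (\<Prod>i = 0..<m. a i (p i))\<bar> = (\<Prod>i = 0..<m. \<bar>a i (p i)\<bar>)"
      by (simp add: abs_mult abs_prod sign_def)
    also have "\<dots> \<le> (\<Prod>i = 0..<m. C * w i * w' (p i))"
      using permutes_in_image[OF p] by (intro prod_mono) (auto intro!: assms)
    also have "\<dots> = C ^ m * (\<Prod>i<m. w i) * (\<Prod>i = 0..<m. w' (p i))"
      by (simp add: prod.distrib lessThan_atLeast0)
    also have "(\<Prod>i = 0..<m. w' (p i)) = (\<Prod>i<m. w' i)"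
      using prod.permute[OF p, of w'] by (simp add: lessThan_atLeast0)
    finally show "\<bar>signof p * (\<Prod>i = 0..<m. a i (p i))\<bar> \<le> C ^ m * (\<Prod>i<m. w i) * (\<Prod>i<m. w' i)" .
  qed
  also have "\<dots> = fact m * C ^ m * (\<Prod>i<m. w i) * (\<Prod>i<m. w' i)"
    by (simp add: card_permutations)
  finally show ?thesis .
qed

subsection \<open>Moments of the entries\<close>

locale fourth_moment_law = prob_space Q for Q :: "real measure" +
  fixes b :: real
  assumes sets_eq: "sets Q = sets borel"
    and integrable_4: "integrable Q (\<lambda>x. x ^ 4)"
    and mean_0: "expectation (\<lambda>x. x) = 0"
    and second_moment: "expectation (\<lambda>x. x ^ 2) = 1"
    and fourth_moment: "expectation (\<lambda>x. x ^ 4) = b"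
begin

sublocale product_sigma_finite "\<lambda>_. Q"
  by standard

lemma integrable_power:
  assumes "k \<le> 4"
  shows "integrable Q (\<lambda>x. x ^ k)"
proof (rule Bochner_Integration.integrable_bound)
  show "integrable Q (\<lambda>x. 1 + x ^ 4)" using integrable_4 by simp
  show "(\<lambda>x. x ^ k) \<in> borel_measurable Q"
    by (simp add: measurable_cong_sets[OF sets_eq refl])
  have "\<bar>x\<bar> ^ k \<le> 1 + x ^ 4" for x :: real
  proof (cases "\<bar>x\<bar> \<le> 1")
    case True
    then show ?thesis using power_le_one[of "\<bar>x\<bar>" k] zero_le_even_power[of 4 x] by (simp add: add_increasing2)
  next
    case False
    then have "\<bar>x\<bar> ^ k \<le> \<bar>x\<bar> ^ 4" using assms by (intro power_increasing) auto
    then show ?thesis by simp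
  qed
  then show "AE x in Q. norm (x ^ k) \<le> norm (1 + x ^ 4)"
    by (intro AE_I2) (simp add: power_abs)
qed

lemma has_bochner_integral_monomial:
  assumes "finite I" "\<And>e. e \<in> I \<Longrightarrow> d e \<le> 4"
  shows "has_bochner_integral (PiM I (\<lambda>_. Q)) (\<lambda>y. \<Prod>e\<in>I. y e ^ d e) (\<Prod>e\<in>I. expectation (\<lambda>x. x ^ d e))"
  using product_integrable_prod[OF assms(1), of "\<lambda>e x. x ^ d e"]
    product_integral_prod[OF assms(1), of "\<lambda>e x. x ^ d e"] integrable_power assms(2)
  by (simp add: has_bochner_integral_iff)

lemma has_bochner_integral_product2:
  assumes "finite I" "e1 \<in> I" "e2 \<in> I"
  shows "has_bochner_integral (PiM I (\<lambda>_. Q)) (\<lambda>y. y e1 * y e2) (of_bool (e1 = e2))"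
proof -
  define d where "d e = of_bool (e = e1) + (of_bool (e = e2) :: nat)" for e
  have "(\<Prod>e\<in>I. y e ^ d e) = y e1 * y e2" for y :: "_ \<Rightarrow> real"
  proof -
    have "(\<Prod>e\<in>I. y e ^ d e) = (\<Prod>e\<in>I. if e = e1 then y e else 1) * (\<Prod>e\<in>I. if e = e2 then y e else 1)"
      unfolding d_def prod.distrib[symmetric] by (intro prod.cong) (auto simp: power2_eq_square)
    then show ?thesis using assms by simp
  qed
  moreover have "(\<Prod>e\<in>I. expectation (\<lambda>x. x ^ d e)) = (of_bool (e1 = e2) :: real)"
  proof -
    have "(\<Prod>e\<in>I. expectation (\<lambda>x. x ^ d e)) = (\<Prod>e\<in>{e1, e2}. expectation (\<lambda>x. x ^ d e))"
      using assms by (intro prod.mono_neutral_right) (auto simp: d_def prob_space)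
    then show ?thesis
      by (cases "e1 = e2") (auto simp: d_def mean_0 second_moment numeral_2_eq_2[symmetric])
  qed
  ultimately show ?thesis
    using has_bochner_integral_monomial[OF assms(1), of d] by (simp add: d_def)
qed

text \<open>Isserlis' formula plus the fourth cumulant: if all four entries coincide the three
  pairings give 3, and \<open>b - 3\<close> corrects this to \<open>b\<close>. An entry occurring
  three times leaves another one occurring once, whose mean is 0; hence no third moment.\<close>

lemma has_bochner_integral_product4:
  assumes "finite I" "e1 \<in> I" "e2 \<in> I" "e3 \<in> I" "e4 \<in> I"
  shows "has_bochner_integral (PiM I (\<lambda>_. Q)) (\<lambda>y. y e1 * y e2 * y e3 * y e4)
    (of_bool (e1 = e2 \<and> e3 = e4) + of_bool (e1 = e3 \<and> e2 = e4) + of_bool (e1 = e4 \<and> e2 = e3)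
      + (b - 3) * of_bool (e1 = e2 \<and> e1 = e3 \<and> e1 = e4))"
    (is "has_bochner_integral _ _ ?v")
proof -
  \<comment> \<open>The multiplicity of the entry \<open>e\<close> in the product, so that
    independence reduces the claim to moments of order \<open>d e\<close>.\<close>
  define d where "d e = of_bool (e = e1) + of_bool (e = e2) + of_bool (e = e3) + (of_bool (e = e4) :: nat)" for e
  have "(\<Prod>e\<in>I. y e ^ d e) = y e1 * y e2 * y e3 * y e4" for y :: "_ \<Rightarrow> real"
  proof -
    have "(\<Prod>e\<in>I. y e ^ d e) = (\<Prod>e\<in>I. if e = e1 then y e else 1) * (\<Prod>e\<in>I. if e = e2 then y e else 1)
         * (\<Prod>e\<in>I. if e = e3 then y e else 1) * (\<Prod>e\<in>I. if e = e4 then y e else 1)"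
      unfolding d_def prod.distrib[symmetric] by (intro prod.cong) (auto simp: power_add)
    then show ?thesis using assms by simp
  qed
  moreover have "(\<Prod>e\<in>I. expectation (\<lambda>x. x ^ d e)) = ?v"
  proof -
    have *: "expectation (\<lambda>x. x ^ 0) = 1" "expectation (\<lambda>x. x ^ Suc 0) = 0"
      "expectation (\<lambda>x. x ^ Suc (Suc 0)) = 1" "expectation (\<lambda>x. x ^ Suc (Suc (Suc (Suc 0)))) = b"
      using mean_0 second_moment fourth_moment by (simp_all add: prob_space eval_nat_numeral)
    define M where "M k = expectation (\<lambda>x. x ^ k)" for k
    have M: "M 0 = 1" "M (Suc 0) = 0" "M (Suc (Suc 0)) = 1" "M (Suc (Suc (Suc (Suc 0)))) = b"
      unfolding M_def by (rule *)+
    have "(\<Prod>e\<in>I. M (d e)) = (\<Prod>e\<in>{e1, e2, e3, e4}. M (d e))"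
      using assms by (intro prod.mono_neutral_right) (auto simp: d_def M)
    also have "\<dots> = ?v"
      by (cases "e1 = e2"; cases "e1 = e3"; cases "e1 = e4"; cases "e2 = e3"; cases "e2 = e4"; cases "e3 = e4")
        (simp_all add: d_def M prod.insert_if insert_commute)
    finally show ?thesis by (simp add: M_def)
  qed
  moreover have "d e \<le> 4" for e by (simp add: d_def)
  ultimately show ?thesis
    using has_bochner_integral_monomial[OF assms(1), of d] by simp
qed

text \<open>The three pairings give the product of the traces and the two contractions of
  \<open>U\<close> with \<open>V\<close>; the cumulant sees only the diagonals. The injection
  \<open>c\<close> locates the variables of the forms inside a possibly larger family of
  entries.\<close>

lemma has_bochner_integral_quadratic_forms:
  fixes U V :: "nat \<Rightarrow> nat \<Rightarrow> real" and c :: "nat \<Rightarrow> 'i"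
  assumes I: "finite I" "c ` {..<m} \<subseteq> I" and c: "inj_on c {..<m}"
  shows "has_bochner_integral (PiM I (\<lambda>_. Q))
     (\<lambda>y. (x + (\<Sum>i<m. \<Sum>j<m. y (c i) * y (c j) * U i j)) * (z + (\<Sum>k<m. \<Sum>l<m. y (c k) * y (c l) * V k l)))
     (x * z + x * (\<Sum>i<m. V i i) + (\<Sum>i<m. U i i) * z + (\<Sum>i<m. U i i) * (\<Sum>i<m. V i i)
       + (\<Sum>i<m. \<Sum>j<m. U i j * V i j) + (\<Sum>i<m. \<Sum>j<m. U i j * V j i) + (b - 3) * (\<Sum>i<m. U i i * V i i))"
proof -
  let ?P = "PiM I (\<lambda>_. Q)"
  let ?d = "\<lambda>i j k l. of_bool (i = j \<and> k = l) + of_bool (i = k \<and> j = l) + of_bool (i = l \<and> j = k)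
      + (b - 3) * of_bool (i = j \<and> i = k \<and> i = (l::nat))"
  interpret P: prob_space ?P
    by (rule prob_space_PiM) unfold_locales
  have ceq: "c i = c j \<longleftrightarrow> i = j" if "i < m" "j < m" for i j
    using c that by (auto simp: inj_on_def)
  have h2: "has_bochner_integral ?P (\<lambda>y. y (c i) * y (c j)) (of_bool (i = j))" if "i < m" "j < m" for i j
    using has_bochner_integral_product2[OF I(1), of "c i" "c j"] that I(2) by (simp add: ceq image_subset_iff)
  have h4: "has_bochner_integral ?P (\<lambda>y. y (c i) * y (c j) * y (c k) * y (c l)) (?d i j k l)"
    if "i < m" "j < m" "k < m" "l < m" for i j k l
    using has_bochner_integral_product4[OF I(1), of "c i" "c j" "c k" "c l"] that I(2) by (simp add: ceq image_subset_iff)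
  have "has_bochner_integral ?P
     (\<lambda>y. x * z + x * (\<Sum>k<m. \<Sum>l<m. V k l * (y (c k) * y (c l))) + z * (\<Sum>i<m. \<Sum>j<m. U i j * (y (c i) * y (c j)))
        + (\<Sum>i<m. \<Sum>j<m. \<Sum>k<m. \<Sum>l<m. U i j * V k l * (y (c i) * y (c j) * y (c k) * y (c l))))
     (x * z + x * (\<Sum>k<m. \<Sum>l<m. V k l * of_bool (k = l)) + z * (\<Sum>i<m. \<Sum>j<m. U i j * of_bool (i = j))
        + (\<Sum>i<m. \<Sum>j<m. \<Sum>k<m. \<Sum>l<m. U i j * V k l * ?d i j k l))"
    by (intro has_bochner_integral_add has_bochner_integral_mult_right has_bochner_integral_sum h2 h4)
      (auto simp: has_bochner_integral_iff P.prob_space)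
  also have "(\<lambda>y. x * z + x * (\<Sum>k<m. \<Sum>l<m. V k l * (y (c k) * y (c l))) + z * (\<Sum>i<m. \<Sum>j<m. U i j * (y (c i) * y (c j)))
        + (\<Sum>i<m. \<Sum>j<m. \<Sum>k<m. \<Sum>l<m. U i j * V k l * (y (c i) * y (c j) * y (c k) * y (c l))))
     = (\<lambda>y. (x + (\<Sum>i<m. \<Sum>j<m. y (c i) * y (c j) * U i j)) * (z + (\<Sum>k<m. \<Sum>l<m. y (c k) * y (c l) * V k l)))"
  proof
    fix y :: "'i \<Rightarrow> real"
    have "(\<Sum>i<m. \<Sum>j<m. \<Sum>k<m. \<Sum>l<m. U i j * V k l * (y (c i) * y (c j) * y (c k) * y (c l)))
        = (\<Sum>i<m. \<Sum>j<m. y (c i) * y (c j) * U i j) * (\<Sum>k<m. \<Sum>l<m. y (c k) * y (c l) * V k l)"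
    proof -
      define S where "S = (\<Sum>k<m. \<Sum>l<m. y (c k) * y (c l) * V k l)"
      have "(\<Sum>i<m. \<Sum>j<m. y (c i) * y (c j) * U i j) * S = (\<Sum>i<m. \<Sum>j<m. y (c i) * y (c j) * U i j * S)"
        by (simp only: sum_distrib_right)
      then show ?thesis
        unfolding S_def by (simp add: sum_distrib_left mult_ac)
    qed
    then show "x * z + x * (\<Sum>k<m. \<Sum>l<m. V k l * (y (c k) * y (c l))) + z * (\<Sum>i<m. \<Sum>j<m. U i j * (y (c i) * y (c j)))
        + (\<Sum>i<m. \<Sum>j<m. \<Sum>k<m. \<Sum>l<m. U i j * V k l * (y (c i) * y (c j) * y (c k) * y (c l)))
      = (x + (\<Sum>i<m. \<Sum>j<m. y (c i) * y (c j) * U i j)) * (z + (\<Sum>k<m. \<Sum>l<m. y (c k) * y (c l) * V k l))"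
      by (simp add: algebra_simps)
  qed
  also have "x * z + x * (\<Sum>k<m. \<Sum>l<m. V k l * of_bool (k = l)) + z * (\<Sum>i<m. \<Sum>j<m. U i j * of_bool (i = j))
        + (\<Sum>i<m. \<Sum>j<m. \<Sum>k<m. \<Sum>l<m. U i j * V k l * ?d i j k l)
     = x * z + x * (\<Sum>i<m. V i i) + (\<Sum>i<m. U i i) * z + (\<Sum>i<m. U i i) * (\<Sum>i<m. V i i)
       + (\<Sum>i<m. \<Sum>j<m. U i j * V i j) + (\<Sum>i<m. \<Sum>j<m. U i j * V j i) + (b - 3) * (\<Sum>i<m. U i i * V i i)"
  proof -
    have e1: "(\<Sum>k<m. f k * of_bool (i = k)) = f i" "(\<Sum>k<m. f k * of_bool (k = i)) = f i" if "i < m" for f :: "nat \<Rightarrow> real" and i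
      using that by (simp_all add: of_bool_def if_distrib cong: if_cong)
    have c1: "of_bool (P \<and> R) = of_bool P * (of_bool R :: real)" for P R by simp
    have s1: "(\<Sum>i<m. \<Sum>j<m. \<Sum>k<m. \<Sum>l<m. U i j * V k l * of_bool (i = j \<and> k = l)) = (\<Sum>i<m. U i i) * (\<Sum>i<m. V i i)"
    proof -
      have "(\<Sum>i<m. \<Sum>j<m. \<Sum>k<m. \<Sum>l<m. U i j * V k l * of_bool (i = j \<and> k = l))
        = (\<Sum>i<m. \<Sum>j<m. (U i j * (\<Sum>k<m. \<Sum>l<m. V k l * of_bool (k = l))) * of_bool (i = j))"
        unfolding sum_distrib_left sum_distrib_right c1 by (intro sum.cong refl) (simp add: algebra_simps)
      then show ?thesis by (simp add: e1 sum_distrib_right)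
    qed
    have s2: "(\<Sum>i<m. \<Sum>j<m. \<Sum>k<m. \<Sum>l<m. U i j * V k l * of_bool (i = k \<and> j = l)) = (\<Sum>i<m. \<Sum>j<m. U i j * V i j)"
    proof -
      have "(\<Sum>i<m. \<Sum>j<m. \<Sum>k<m. \<Sum>l<m. U i j * V k l * of_bool (i = k \<and> j = l))
        = (\<Sum>i<m. \<Sum>j<m. \<Sum>k<m. (\<Sum>l<m. U i j * V k l * of_bool (j = l)) * of_bool (i = k))"
        unfolding sum_distrib_left sum_distrib_right c1 by (intro sum.cong refl) (simp add: algebra_simps)
      then show ?thesis by (simp add: e1)
    qed
    have s3: "(\<Sum>i<m. \<Sum>j<m. \<Sum>k<m. \<Sum>l<m. U i j * V k l * of_bool (i = l \<and> j = k)) = (\<Sum>i<m. \<Sum>j<m. U i j * V j i)"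
    proof -
      have "(\<Sum>i<m. \<Sum>j<m. \<Sum>k<m. \<Sum>l<m. U i j * V k l * of_bool (i = l \<and> j = k))
        = (\<Sum>i<m. \<Sum>j<m. \<Sum>k<m. (\<Sum>l<m. U i j * V k l * of_bool (i = l)) * of_bool (j = k))"
        unfolding sum_distrib_left sum_distrib_right c1 by (intro sum.cong refl) (simp add: algebra_simps)
      then show ?thesis by (simp add: e1)
    qed
    have s4: "(\<Sum>i<m. \<Sum>j<m. \<Sum>k<m. \<Sum>l<m. U i j * V k l * of_bool (i = j \<and> i = k \<and> i = l)) = (\<Sum>i<m. U i i * V i i)"
    proof -
      have "(\<Sum>i<m. \<Sum>j<m. \<Sum>k<m. \<Sum>l<m. U i j * V k l * of_bool (i = j \<and> i = k \<and> i = l))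
        = (\<Sum>i<m. \<Sum>j<m. (\<Sum>k<m. (\<Sum>l<m. U i j * V k l * of_bool (i = l)) * of_bool (i = k)) * of_bool (i = j))"
        unfolding sum_distrib_left sum_distrib_right c1 by (intro sum.cong refl) (simp add: algebra_simps)
      then show ?thesis by (simp add: e1)
    qed
    have "(\<Sum>i<m. \<Sum>j<m. \<Sum>k<m. \<Sum>l<m. U i j * V k l * ?d i j k l)
      = (\<Sum>i<m. \<Sum>j<m. \<Sum>k<m. \<Sum>l<m. U i j * V k l * of_bool (i = j \<and> k = l))
      + (\<Sum>i<m. \<Sum>j<m. \<Sum>k<m. \<Sum>l<m. U i j * V k l * of_bool (i = k \<and> j = l))
      + (\<Sum>i<m. \<Sum>j<m. \<Sum>k<m. \<Sum>l<m. U i j * V k l * of_bool (i = l \<and> j = k))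
      + (b - 3) * (\<Sum>i<m. \<Sum>j<m. \<Sum>k<m. \<Sum>l<m. U i j * V k l * of_bool (i = j \<and> i = k \<and> i = l))"
      unfolding sum_distrib_left sum.distrib[symmetric] by (intro sum.cong refl) (simp only: algebra_simps)
    then show ?thesis unfolding s1 s2 s3 s4 by (simp add: e1)
  qed
  finally show ?thesis .
qed

end

subsection \<open>The recursion over the rows\<close>

text \<open>The columns are selected by an injection \<open>c\<close>, so that a principal minor is again of this form
  on the same probability space and no relabelling of the entries is needed.\<close>

definition gram :: "nat \<Rightarrow> (nat \<Rightarrow> nat) \<Rightarrow> (nat \<times> nat \<Rightarrow> real) \<Rightarrow> nat \<Rightarrow> nat \<Rightarrow> real" where
  "gram n c \<omega> j k = (\<Sum>i<n. \<omega> (i, c j) * \<omega> (i, c k))"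

definition shift :: "(nat \<Rightarrow> nat \<Rightarrow> real) \<Rightarrow> real \<Rightarrow> nat \<Rightarrow> nat \<Rightarrow> real" where
  "shift a \<mu> i j = a i j - (if i = j then \<mu> else 0)"

text \<open>Expanding over the set \<open>T\<close> of rows replaced by unit vectors makes the shifted determinant an explicit
  polynomial in \<open>\<mu>\<close>, so that differentiation under the expectation only concerns finite sums.\<close>

definition fdet_ones :: "nat \<Rightarrow> (nat \<Rightarrow> nat \<Rightarrow> real) \<Rightarrow> nat set \<Rightarrow> real" where
  "fdet_ones m a T = fdet m (\<lambda>i j. if i \<in> T then of_bool (i = j) else a i j)"

text \<open>The product of these weights over all columns is the product of
  \<open>1 + \<bar>\<omega> e\<bar>\<close> over all entries. A Leibniz term uses every column at
  most once as a row index and once as a column index, which yields degree two in each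
  entry.\<close>

definition col_weight :: "nat \<Rightarrow> (nat \<times> nat \<Rightarrow> real) \<Rightarrow> nat \<Rightarrow> real" where
  "col_weight n \<omega> x = (\<Prod>i<n. 1 + \<bar>\<omega> (i, x)\<bar>)"

lemma col_weight_ge_1: "1 \<le> col_weight n \<omega> x"
  unfolding col_weight_def by (rule prod_ge_1) simp

text \<open>The additional 1 shows that the weights also dominate the shift by a constant and the
  entries of unit rows.\<close>

lemma abs_gram_le: "\<bar>gram n c \<omega> j k\<bar> + 1 \<le> col_weight n \<omega> (c j) * col_weight n \<omega> (c k)"
proof (induction n)
  case 0
  then show ?case by (simp add: gram_def col_weight_def)
next
  case (Suc n)
  let ?x = "\<bar>\<omega> (n, c j)\<bar>" and ?y = "\<bar>\<omega> (n, c k)\<bar>"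
  let ?W = "col_weight n \<omega> (c j) * col_weight n \<omega> (c k)"
  have "1 \<le> ?W" using mult_mono[OF col_weight_ge_1[of n \<omega> "c j"] col_weight_ge_1[of n \<omega> "c k"]]
    using col_weight_ge_1[of n \<omega> "c j"] by simp
  then have "?x * ?y \<le> ?W * (?x * ?y)" "0 \<le> ?W * (?x + ?y)"
    using mult_right_mono[of 1 ?W "?x * ?y"] by auto
  moreover have "\<bar>gram (Suc n) c \<omega> j k\<bar> \<le> \<bar>gram n c \<omega> j k\<bar> + ?x * ?y"
    unfolding gram_def by (simp add: abs_mult[symmetric] abs_triangle_ineq)
  moreover have "col_weight (Suc n) \<omega> (c j) * col_weight (Suc n) \<omega> (c k) = ?W + ?W * (?x + ?y) + ?W * (?x * ?y)"
    by (simp add: col_weight_def algebra_simps)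
  ultimately show ?case using Suc by linarith
qed

lemma shift_eq: "shift a \<mu> = (\<lambda>i j. a i j - (if i = j then \<mu> else 0))"
  by (intro ext) (simp add: shift_def)

lemma inj_on_comp_insert_index:
  assumes "inj_on c {..<m}"
  shows "inj_on (c \<circ> insert_index l) {..<m - 1}" "(c \<circ> insert_index l) ` {..<m - 1} \<subseteq> c ` {..<m}"
proof -
  have "inj_on (insert_index l) {..<m - 1}" "insert_index l ` {..<m - 1} \<subseteq> {..<m}"
    by (auto simp: inj_on_def insert_index_def split: if_splits)
  then show "inj_on (c \<circ> insert_index l) {..<m - 1}" "(c \<circ> insert_index l) ` {..<m - 1} \<subseteq> c ` {..<m}"
    using assms by (auto intro!: comp_inj_on intro: inj_on_subset simp flip: image_image simp: image_comp[symmetric])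
qed

lemma fdet_shift_expand:
  "fdet m (shift a \<mu>) = (\<Sum>T\<in>Pow {0..<m}. (- \<mu>) ^ card T * fdet_ones m a T)"
  unfolding fdet_ones_def fdet_add_scalar[symmetric] by (rule fdet_cong) (simp add: shift_def)

lemma trace_fcof_shift_expand:
  "(\<Sum>i<m. fcof m (shift a \<mu>) i i) = (\<Sum>T\<in>Pow {0..<m}. real (card T) * (- \<mu>) ^ (card T - 1) * fdet_ones m a T)"
  unfolding fdet_ones_def trace_fcof_shift[symmetric] shift_def ..

lemma gram_sym: "gram n c \<omega> j k = gram n c \<omega> k j"
  by (simp add: gram_def mult.commute)

text \<open>Deleting row and column \<open>i\<close> of a Gram matrix leaves the Gram matrix of the
  other columns. This is how \<open>m - 1\<close> columns enter the recursion.\<close>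

lemma fcof_shift_gram_diag:
  assumes "i < m"
  shows "fcof m (shift (gram n c \<omega>) \<mu>) i i = fdet (m - 1) (shift (gram n (c \<circ> insert_index i) \<omega>) \<mu>)"
  unfolding fcof_minor[OF assms assms]
  by (auto intro!: fdet_cong simp: shift_def gram_def insert_index_def simp flip: power_add power_mult mult_2)

section \<open>Integrability of products of two determinants and the step from n to n + 1
  rows\<close>

context fourth_moment_law
begin

text \<open>Growth of degree at most two in every entry separately; this is the class in which
  products of two functions are integrable under a finite fourth moment.\<close>

definition quad_bounded :: "(nat \<times> nat) set \<Rightarrow> ((nat \<times> nat \<Rightarrow> real) \<Rightarrow> real) \<Rightarrow> bool" where
  "quad_bounded I g \<longleftrightarrow> g \<in> borel_measurable (PiM I (\<lambda>_. Q)) \<and>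
     (\<exists>C. \<forall>\<omega>. \<bar>g \<omega>\<bar> \<le> C * (\<Prod>e\<in>I. (1 + \<bar>\<omega> e\<bar>)\<^sup>2))"

lemma quad_bounded_sum:
  assumes "\<And>i. i \<in> A \<Longrightarrow> quad_bounded I (g i)"
  shows "quad_bounded I (\<lambda>\<omega>. \<Sum>i\<in>A. g i \<omega>)"
proof -
  from assms have "\<forall>i\<in>A. \<exists>C. \<forall>\<omega>. \<bar>g i \<omega>\<bar> \<le> C * (\<Prod>e\<in>I. (1 + \<bar>\<omega> e\<bar>)\<^sup>2)"
    by (auto simp: quad_bounded_def)
  then obtain C where C: "\<And>i \<omega>. i \<in> A \<Longrightarrow> \<bar>g i \<omega>\<bar> \<le> C i * (\<Prod>e\<in>I. (1 + \<bar>\<omega> e\<bar>)\<^sup>2)"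
    by metis
  have "\<bar>\<Sum>i\<in>A. g i \<omega>\<bar> \<le> (\<Sum>i\<in>A. C i) * (\<Prod>e\<in>I. (1 + \<bar>\<omega> e\<bar>)\<^sup>2)" for \<omega>
    unfolding sum_distrib_right by (rule order_trans[OF sum_abs sum_mono[OF C]])
  then show ?thesis using assms unfolding quad_bounded_def by (auto intro!: borel_measurable_sum)
qed

lemma quad_bounded_cmult:
  assumes "quad_bounded I g"
  shows "quad_bounded I (\<lambda>\<omega>. k * g \<omega>)"
proof -
  obtain C where C: "\<And>\<omega>. \<bar>g \<omega>\<bar> \<le> C * (\<Prod>e\<in>I. (1 + \<bar>\<omega> e\<bar>)\<^sup>2)"
    using assms by (auto simp: quad_bounded_def)
  have "\<bar>k * g \<omega>\<bar> \<le> (\<bar>k\<bar> * C) * (\<Prod>e\<in>I. (1 + \<bar>\<omega> e\<bar>)\<^sup>2)" for \<omega>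
    using mult_left_mono[OF C, of "\<bar>k\<bar>" \<omega>] by (simp add: abs_mult mult_ac)
  then show ?thesis using assms unfolding quad_bounded_def by auto
qed

lemma integrable_quad_bounded:
  assumes "finite I" "quad_bounded I g" "quad_bounded I h"
  shows "integrable (PiM I (\<lambda>_. Q)) (\<lambda>\<omega>. g \<omega> * h \<omega>)"
proof -
  obtain C D where C: "\<And>\<omega>. \<bar>g \<omega>\<bar> \<le> C * (\<Prod>e\<in>I. (1 + \<bar>\<omega> e\<bar>)\<^sup>2)"
    and D: "\<And>\<omega>. \<bar>h \<omega>\<bar> \<le> D * (\<Prod>e\<in>I. (1 + \<bar>\<omega> e\<bar>)\<^sup>2)"
    using assms by (auto simp: quad_bounded_def)
  have "integrable Q (\<lambda>x. (1 + \<bar>x\<bar>) ^ 4)"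
  proof -
    have *: "(1 + \<bar>x\<bar>) ^ 4 = 1 + 4 * \<bar>x ^ 1\<bar> + 6 * \<bar>x ^ 2\<bar> + 4 * \<bar>x ^ 3\<bar> + \<bar>x ^ 4\<bar>" for x :: real
    proof -
      have "(1 + t) ^ 4 = 1 + 4 * t ^ 1 + 6 * t ^ 2 + 4 * t ^ 3 + t ^ 4" for t :: real
        by (simp add: eval_nat_numeral algebra_simps)
      from this[of "\<bar>x\<bar>"] show ?thesis by (simp only: power_abs)
    qed
    show ?thesis unfolding *
      by (intro Bochner_Integration.integrable_add integrable_mult_right integrable_abs integrable_power) auto
  qed
  then have "integrable (PiM I (\<lambda>_. Q)) (\<lambda>\<omega>. (C * D) * (\<Prod>e\<in>I. (1 + \<bar>\<omega> e\<bar>) ^ 4))"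
    by (intro integrable_mult_right product_integrable_prod assms)
  then show ?thesis
  proof (rule Bochner_Integration.integrable_bound)
    show "(\<lambda>\<omega>. g \<omega> * h \<omega>) \<in> borel_measurable (PiM I (\<lambda>_. Q))"
      using assms by (auto simp: quad_bounded_def)
    have "norm (g \<omega> * h \<omega>) \<le> norm ((C * D) * (\<Prod>e\<in>I. (1 + \<bar>\<omega> e\<bar>) ^ 4))" for \<omega>
    proof -
      have "\<bar>g \<omega>\<bar> * \<bar>h \<omega>\<bar> \<le> (C * (\<Prod>e\<in>I. (1 + \<bar>\<omega> e\<bar>)\<^sup>2)) * (D * (\<Prod>e\<in>I. (1 + \<bar>\<omega> e\<bar>)\<^sup>2))"
        using C[of \<omega>] by (intro mult_mono C D) (auto intro: order_trans[OF abs_ge_zero])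
      also have "\<dots> = (C * D) * (\<Prod>e\<in>I. (1 + \<bar>\<omega> e\<bar>) ^ 4)"
        by (simp flip: prod_power_distrib power_add)
      finally have "\<bar>g \<omega> * h \<omega>\<bar> \<le> (C * D) * (\<Prod>e\<in>I. (1 + \<bar>\<omega> e\<bar>) ^ 4)"
        by (simp only: abs_mult)
      then show ?thesis unfolding real_norm_def by (rule order_trans[OF _ abs_ge_self])
    qed
    then show "AE \<omega> in PiM I (\<lambda>_. Q). norm (g \<omega> * h \<omega>) \<le> norm ((C * D) * (\<Prod>e\<in>I. (1 + \<bar>\<omega> e\<bar>) ^ 4))"
      by (intro AE_I2)
  qed
qed

lemma measurable_entry:
  assumes "e \<in> I"
  shows "(\<lambda>\<omega>. \<omega> e) \<in> borel_measurable (PiM I (\<lambda>_. Q))"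
  using measurable_component_singleton[OF assms, of "\<lambda>_. Q"] measurable_cong_sets[OF refl sets_eq] by blast

text \<open>By injectivity every column weight occurs at most once through \<open>\<sigma>\<close>
  and once through \<open>\<tau>\<close>, and the weights of the remaining columns in
  \<open>J\<close> are at least 1. There are two injections because an off-diagonal cofactor deletes
  different rows and columns.\<close>

lemma quad_bounded_fdet:
  assumes J: "finite J" and \<sigma>: "inj_on \<sigma> {..<m}" "\<sigma> ` {..<m} \<subseteq> J" and \<tau>: "inj_on \<tau> {..<m}" "\<tau> ` {..<m} \<subseteq> J"
    and meas: "\<And>i j. i < m \<Longrightarrow> j < m \<Longrightarrow> (\<lambda>\<omega>. a \<omega> i j) \<in> borel_measurable (PiM ({..<n} \<times> J) (\<lambda>_. Q))"
    and bound: "\<And>\<omega> i j. i < m \<Longrightarrow> j < m \<Longrightarrow> \<bar>a \<omega> i j\<bar> \<le> C * col_weight n \<omega> (\<sigma> i) * col_weight n \<omega> (\<tau> j)"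
    and C: "C \<ge> 0"
  shows "quad_bounded ({..<n} \<times> J) (\<lambda>\<omega>. fdet m (a \<omega>))"
  unfolding quad_bounded_def
proof (intro conjI exI[of _ "fact m * C ^ m"] allI)
  show "(\<lambda>\<omega>. fdet m (a \<omega>)) \<in> borel_measurable (PiM ({..<n} \<times> J) (\<lambda>_. Q))"
    unfolding fdet_leibniz
    by (intro borel_measurable_sum borel_measurable_times borel_measurable_prod meas)
      (auto dest: permutes_in_image)
  fix \<omega> :: "nat \<times> nat \<Rightarrow> real"
  have W: "(\<Prod>i<m. col_weight n \<omega> (\<sigma> i)) \<le> (\<Prod>e\<in>{..<n} \<times> J. 1 + \<bar>\<omega> e\<bar>)"
    if \<sigma>: "inj_on \<sigma> {..<m}" "\<sigma> ` {..<m} \<subseteq> J" for \<sigma>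
  proof -
    have "(\<Prod>i<m. col_weight n \<omega> (\<sigma> i)) = (\<Prod>x\<in>\<sigma> ` {..<m}. col_weight n \<omega> x)"
      by (simp add: prod.reindex[OF \<sigma>(1)])
    also have "\<dots> \<le> (\<Prod>x\<in>J. col_weight n \<omega> x)"
      using J \<sigma>(2) col_weight_ge_1[of n \<omega>] by (intro prod_mono2) (auto intro: order_trans[OF zero_le_one])
    also have "\<dots> = (\<Prod>e\<in>{..<n} \<times> J. 1 + \<bar>\<omega> e\<bar>)"
      unfolding col_weight_def by (subst prod.swap) (simp add: prod.cartesian_product)
    finally show ?thesis .
  qed
  have "\<bar>fdet m (a \<omega>)\<bar> \<le> fact m * C ^ m * (\<Prod>i<m. col_weight n \<omega> (\<sigma> i)) * (\<Prod>i<m. col_weight n \<omega> (\<tau> i))"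
    by (intro abs_fdet_le bound C) (auto intro: order_trans[OF zero_le_one col_weight_ge_1])
  also have "\<dots> \<le> fact m * C ^ m * (\<Prod>e\<in>{..<n} \<times> J. 1 + \<bar>\<omega> e\<bar>) * (\<Prod>e\<in>{..<n} \<times> J. 1 + \<bar>\<omega> e\<bar>)"
    using C by (intro mult_mono W \<sigma> \<tau> order_refl mult_nonneg_nonneg prod_nonneg)
      (auto intro: order_trans[OF zero_le_one col_weight_ge_1])
  also have "\<dots> = fact m * C ^ m * (\<Prod>e\<in>{..<n} \<times> J. (1 + \<bar>\<omega> e\<bar>)\<^sup>2)"
    by (simp add: prod.distrib power2_eq_square mult_ac)
  finally show "\<bar>fdet m (a \<omega>)\<bar> \<le> fact m * C ^ m * (\<Prod>e\<in>{..<n} \<times> J. (1 + \<bar>\<omega> e\<bar>)\<^sup>2)" .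
qed

lemma measurable_gram:
  assumes "c ` {..<m} \<subseteq> J" "j < m" "k < m"
  shows "(\<lambda>\<omega>. gram n c \<omega> j k) \<in> borel_measurable (PiM ({..<n} \<times> J) (\<lambda>_. Q))"
  unfolding gram_def using assms
  by (intro borel_measurable_sum borel_measurable_times measurable_entry) auto

lemma abs_shift_gram_le:
  "\<bar>shift (gram n c \<omega>) \<mu> i j\<bar> \<le> (1 + \<bar>\<mu>\<bar>) * col_weight n \<omega> (c i) * col_weight n \<omega> (c j)"
proof -
  let ?W = "col_weight n \<omega> (c i) * col_weight n \<omega> (c j)"
  have "1 \<le> ?W" using abs_gram_le[of n c \<omega> i j] by linarith
  then have "\<bar>\<mu>\<bar> \<le> \<bar>\<mu>\<bar> * ?W" using mult_left_mono[of 1 ?W "\<bar>\<mu>\<bar>"] by simp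
  moreover have "\<bar>shift (gram n c \<omega>) \<mu> i j\<bar> \<le> \<bar>gram n c \<omega> i j\<bar> + \<bar>\<mu>\<bar>"
    by (auto simp: shift_def)
  ultimately have "\<bar>shift (gram n c \<omega>) \<mu> i j\<bar> \<le> ?W + \<bar>\<mu>\<bar> * ?W"
    using abs_gram_le[of n c \<omega> i j] by linarith
  then show ?thesis by (simp add: algebra_simps)
qed

lemma quad_bounded_fdet_ones:
  assumes "finite J" "inj_on c {..<m}" "c ` {..<m} \<subseteq> J"
  shows "quad_bounded ({..<n} \<times> J) (\<lambda>\<omega>. fdet_ones m (gram n c \<omega>) T)"
  unfolding fdet_ones_def
proof (rule quad_bounded_fdet[of J c m c _ n 1])
  fix \<omega> i j
  show "\<bar>if i \<in> T then of_bool (i = j) else gram n c \<omega> i j\<bar> \<le> 1 * col_weight n \<omega> (c i) * col_weight n \<omega> (c j)"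
    using abs_gram_le[of n c \<omega> i j] by auto
next
  fix i j assume "i < m" "j < m"
  then show "(\<lambda>\<omega>. if i \<in> T then of_bool (i = j) else gram n c \<omega> i j) \<in> borel_measurable (PiM ({..<n} \<times> J) (\<lambda>_. Q))"
    using measurable_gram[OF assms(3), of i j n] by (cases "i \<in> T") simp_all
qed (use assms in auto)

lemma quad_bounded_fdet_shift:
  assumes "finite J" "inj_on c {..<m}" "c ` {..<m} \<subseteq> J"
  shows "quad_bounded ({..<n} \<times> J) (\<lambda>\<omega>. fdet m (shift (gram n c \<omega>) \<mu>))"
  unfolding fdet_shift_expand by (intro quad_bounded_sum quad_bounded_cmult quad_bounded_fdet_ones assms)

lemma quad_bounded_fcof:
  assumes "finite J" "inj_on c {..<m}" "c ` {..<m} \<subseteq> J" "j < m" "k < m"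
  shows "quad_bounded ({..<n} \<times> J) (\<lambda>\<omega>. fcof m (shift (gram n c \<omega>) \<mu>) j k)"
proof -
  note inj = inj_on_comp_insert_index(1)[OF assms(2)] order_trans[OF inj_on_comp_insert_index(2)[OF assms(2)] assms(3)]
  show ?thesis unfolding fcof_minor[OF assms(4,5)]
  proof (intro quad_bounded_cmult, rule quad_bounded_fdet[of J "c \<circ> insert_index j" _ "c \<circ> insert_index k" _ n "1 + \<bar>\<mu>\<bar>"])
    fix \<omega> i' j'
    show "\<bar>shift (gram n c \<omega>) \<mu> (insert_index j i') (insert_index k j')\<bar>
      \<le> (1 + \<bar>\<mu>\<bar>) * col_weight n \<omega> ((c \<circ> insert_index j) i') * col_weight n \<omega> ((c \<circ> insert_index k) j')"
      using abs_shift_gram_le[of n c \<omega> \<mu>] by simp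
  next
    fix i' j' assume "i' < m - 1" "j' < m - 1"
    then show "(\<lambda>\<omega>. shift (gram n c \<omega>) \<mu> (insert_index j i') (insert_index k j')) \<in> borel_measurable (PiM ({..<n} \<times> J) (\<lambda>_. Q))"
      unfolding shift_def by (intro borel_measurable_diff measurable_gram[OF assms(3)]) (auto simp: insert_index_def)
  qed (rule assms inj | simp)+
qed

text \<open>In \<open>corr1\<close> and \<open>corr11\<close> one or both determinants are replaced
  by traces of adjugates, which makes them, up to sign, the first and the mixed derivative of
  \<open>corr\<close>. In \<open>corr_trace\<close> the adjugates are multiplied before the trace is
  taken. The sample space has all columns in \<open>J\<close>, also those that \<open>c\<close> does
  not select.\<close>

definition corr :: "nat set \<Rightarrow> nat \<Rightarrow> nat \<Rightarrow> (nat \<Rightarrow> nat) \<Rightarrow> real \<Rightarrow> real \<Rightarrow> real" where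
  "corr J n m c \<mu> \<nu> = (\<integral>\<omega>. fdet m (shift (gram n c \<omega>) \<mu>) * fdet m (shift (gram n c \<omega>) \<nu>) \<partial>PiM ({..<n} \<times> J) (\<lambda>_. Q))"

definition corr1 :: "nat set \<Rightarrow> nat \<Rightarrow> nat \<Rightarrow> (nat \<Rightarrow> nat) \<Rightarrow> real \<Rightarrow> real \<Rightarrow> real" where
  "corr1 J n m c \<mu> \<nu> = (\<integral>\<omega>. (\<Sum>i<m. fcof m (shift (gram n c \<omega>) \<mu>) i i) * fdet m (shift (gram n c \<omega>) \<nu>) \<partial>PiM ({..<n} \<times> J) (\<lambda>_. Q))"

definition corr11 :: "nat set \<Rightarrow> nat \<Rightarrow> nat \<Rightarrow> (nat \<Rightarrow> nat) \<Rightarrow> real \<Rightarrow> real \<Rightarrow> real" where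
  "corr11 J n m c \<mu> \<nu> = (\<integral>\<omega>. (\<Sum>i<m. fcof m (shift (gram n c \<omega>) \<mu>) i i) *
      (\<Sum>i<m. fcof m (shift (gram n c \<omega>) \<nu>) i i) \<partial>PiM ({..<n} \<times> J) (\<lambda>_. Q))"

definition corr_trace :: "nat set \<Rightarrow> nat \<Rightarrow> nat \<Rightarrow> (nat \<Rightarrow> nat) \<Rightarrow> real \<Rightarrow> real \<Rightarrow> real" where
  "corr_trace J n m c \<mu> \<nu> = (\<integral>\<omega>. (\<Sum>i<m. \<Sum>j<m. fcof m (shift (gram n c \<omega>) \<mu>) i j *
      fcof m (shift (gram n c \<omega>) \<nu>) j i) \<partial>PiM ({..<n} \<times> J) (\<lambda>_. Q))"

definition corr_ones :: "nat set \<Rightarrow> nat \<Rightarrow> nat \<Rightarrow> (nat \<Rightarrow> nat) \<Rightarrow> nat set \<Rightarrow> nat set \<Rightarrow> real" where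
  "corr_ones J n m c T T' = (\<integral>\<omega>. fdet_ones m (gram n c \<omega>) T * fdet_ones m (gram n c \<omega>) T' \<partial>PiM ({..<n} \<times> J) (\<lambda>_. Q))"

lemma integral_ones_combination:
  assumes "finite J" "inj_on c {..<m}" "c ` {..<m} \<subseteq> J"
  shows "(\<integral>\<omega>. (\<Sum>T\<in>A. x T * fdet_ones m (gram n c \<omega>) T) * (\<Sum>T\<in>B. y T * fdet_ones m (gram n c \<omega>) T) \<partial>PiM ({..<n} \<times> J) (\<lambda>_. Q))
    = (\<Sum>T\<in>A. \<Sum>T'\<in>B. x T * y T' * corr_ones J n m c T T')"
proof -
  have I: "integrable (PiM ({..<n} \<times> J) (\<lambda>_. Q)) (\<lambda>\<omega>. fdet_ones m (gram n c \<omega>) T * fdet_ones m (gram n c \<omega>) T')" for T T'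
    by (intro integrable_quad_bounded quad_bounded_fdet_ones assms) (use assms in auto)
  have "(\<Sum>T\<in>A. x T * fdet_ones m (gram n c \<omega>) T) * (\<Sum>T\<in>B. y T * fdet_ones m (gram n c \<omega>) T)
    = (\<Sum>T\<in>A. \<Sum>T'\<in>B. x T * y T' * (fdet_ones m (gram n c \<omega>) T * fdet_ones m (gram n c \<omega>) T'))" for \<omega>
    unfolding sum_product by (simp add: mult_ac)
  then show ?thesis unfolding corr_ones_def by (simp add: Bochner_Integration.integral_sum Bochner_Integration.integrable_sum I)
qed

context
  fixes J :: "nat set" and m :: nat and c :: "nat \<Rightarrow> nat"
  assumes J: "finite J" "inj_on c {..<m}" "c ` {..<m} \<subseteq> J"
begin

lemma corr_expand:
  "corr J n m c \<mu> \<nu> = (\<Sum>T\<in>Pow {0..<m}. \<Sum>T'\<in>Pow {0..<m}. (- \<mu>) ^ card T * (- \<nu>) ^ card T' * corr_ones J n m c T T')"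
  unfolding corr_def fdet_shift_expand by (rule integral_ones_combination[OF J])

lemma corr1_expand:
  "corr1 J n m c \<mu> \<nu> = (\<Sum>T\<in>Pow {0..<m}. \<Sum>T'\<in>Pow {0..<m}.
     (real (card T) * (- \<mu>) ^ (card T - 1)) * (- \<nu>) ^ card T' * corr_ones J n m c T T')"
  unfolding corr1_def fdet_shift_expand trace_fcof_shift_expand by (rule integral_ones_combination[OF J])

lemma corr11_expand:
  "corr11 J n m c \<mu> \<nu> = (\<Sum>T\<in>Pow {0..<m}. \<Sum>T'\<in>Pow {0..<m}.
     (real (card T) * (- \<mu>) ^ (card T - 1)) * (real (card T') * (- \<nu>) ^ (card T' - 1)) * corr_ones J n m c T T')"
  unfolding corr11_def trace_fcof_shift_expand by (rule integral_ones_combination[OF J])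

lemma has_derivative_corr:
  "((\<lambda>\<mu>. corr J n m c \<mu> \<nu>) has_real_derivative - corr1 J n m c \<mu> \<nu>) (at \<mu>)"
  unfolding corr_expand corr1_expand sum_negf[symmetric]
  by (auto intro!: derivative_eq_intros sum.cong)

lemma has_derivative_corr1:
  "((\<lambda>\<nu>. corr1 J n m c \<mu> \<nu>) has_real_derivative - corr11 J n m c \<mu> \<nu>) (at \<nu>)"
  unfolding corr1_expand corr11_expand sum_negf[symmetric]
  by (auto intro!: derivative_eq_intros sum.cong)

lemma corr_trace_resolvent:
  "(\<mu> - \<nu>) * corr_trace J n m c \<mu> \<nu> = corr1 J n m c \<mu> \<nu> - corr1 J n m c \<nu> \<mu>"
proof -
  let ?P = "PiM ({..<n} \<times> J) (\<lambda>_. Q)"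
  have I: "integrable ?P (\<lambda>\<omega>. (\<Sum>i<m. fcof m (shift (gram n c \<omega>) \<mu>) i i) * fdet m (shift (gram n c \<omega>) \<nu>))" for \<mu> \<nu>
    by (intro integrable_quad_bounded quad_bounded_sum quad_bounded_fcof quad_bounded_fdet_shift J) (use J in auto)
  have "(\<mu> - \<nu>) * corr_trace J n m c \<mu> \<nu> = (\<integral>\<omega>. (\<Sum>i<m. fcof m (shift (gram n c \<omega>) \<mu>) i i) * fdet m (shift (gram n c \<omega>) \<nu>)
     - (\<Sum>i<m. fcof m (shift (gram n c \<omega>) \<nu>) i i) * fdet m (shift (gram n c \<omega>) \<mu>) \<partial>?P)"
    unfolding corr_trace_def integral_mult_right_zero[symmetric]
    by (intro Bochner_Integration.integral_cong refl)
      (use fcof_resolvent_identity[of \<mu> \<nu> m] in \<open>simp add: shift_eq mult.commute\<close>)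
  also have "\<dots> = corr1 J n m c \<mu> \<nu> - corr1 J n m c \<nu> \<mu>"
    unfolding corr1_def by (intro Bochner_Integration.integral_diff I)
  finally show ?thesis .
qed

text \<open>Fubini isolates the last row. Given the other rows, both determinants are quadratic
  forms in it whose coefficients are cofactors, so the second and fourth moments determine the inner
  integral. The factor 2 collects the two contractions, equal by symmetry; the diagonal products are
  determinants with one column removed.\<close>

lemma corr_Suc:
  "corr J (Suc n) m c \<mu> \<nu> = corr J n m c \<mu> \<nu> + corr1 J n m c \<mu> \<nu> + corr1 J n m c \<nu> \<mu> + corr11 J n m c \<mu> \<nu>
     + 2 * corr_trace J n m c \<mu> \<nu> + (b - 3) * (\<Sum>i<m. corr J n (m - 1) (c \<circ> insert_index i) \<mu> \<nu>)"
proof -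
  let ?I = "{..<n} \<times> J" and ?R = "{n} \<times> J"
  let ?P = "PiM ?I (\<lambda>_. Q)"
  let ?A = "\<lambda>\<mu> \<omega>. shift (gram n c \<omega>) \<mu>"
  let ?tr = "\<lambda>\<mu> \<omega>. \<Sum>i<m. fcof m (?A \<mu> \<omega>) i i"
  have IR: "{..<Suc n} \<times> J = ?I \<union> ?R" by auto
  have cov: "fdet m (shift (gram (Suc n) c (merge ?I ?R (x, y))) \<mu>)
     = fdet m (?A \<mu> x) + (\<Sum>i<m. \<Sum>j<m. y (n, c i) * y (n, c j) * fcof m (?A \<mu> x) i j)" for x y \<mu>
  proof -
    have "fdet m (shift (gram (Suc n) c (merge ?I ?R (x, y))) \<mu>)
       = fdet m (\<lambda>i j. ?A \<mu> x i j + y (n, c i) * y (n, c j))"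
    proof (rule fdet_cong)
      fix i j assume "i < m" "j < m"
      then have "c i \<in> J" "c j \<in> J" using J by auto
      then show "shift (gram (Suc n) c (merge ?I ?R (x, y))) \<mu> i j = ?A \<mu> x i j + y (n, c i) * y (n, c j)"
        by (simp add: shift_def gram_def merge_def)
    qed
    then show ?thesis by (simp add: fdet_rank_one_update)
  qed
  have "corr J (Suc n) m c \<mu> \<nu> = (\<integral>x. (\<integral>y. fdet m (shift (gram (Suc n) c (merge ?I ?R (x, y))) \<mu>) *
      fdet m (shift (gram (Suc n) c (merge ?I ?R (x, y))) \<nu>) \<partial>PiM ?R (\<lambda>_. Q)) \<partial>?P)"
    unfolding corr_def IR
  proof (rule product_integral_fold)
    have "integrable (PiM ({..<Suc n} \<times> J) (\<lambda>_. Q)) (\<lambda>\<omega>. fdet m (shift (gram (Suc n) c \<omega>) \<mu>) * fdet m (shift (gram (Suc n) c \<omega>) \<nu>))"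
      by (intro integrable_quad_bounded quad_bounded_fdet_shift J) (use J in auto)
    then show "integrable (PiM (?I \<union> ?R) (\<lambda>_. Q)) (\<lambda>\<omega>. fdet m (shift (gram (Suc n) c \<omega>) \<mu>) * fdet m (shift (gram (Suc n) c \<omega>) \<nu>))"
      by (simp only: IR)
  qed (use J in auto)
  also have "\<dots> = (\<integral>x. fdet m (?A \<mu> x) * fdet m (?A \<nu> x) + fdet m (?A \<mu> x) * ?tr \<nu> x + ?tr \<mu> x * fdet m (?A \<nu> x)
       + ?tr \<mu> x * ?tr \<nu> x + (\<Sum>i<m. \<Sum>j<m. fcof m (?A \<mu> x) i j * fcof m (?A \<nu> x) i j)
       + (\<Sum>i<m. \<Sum>j<m. fcof m (?A \<mu> x) i j * fcof m (?A \<nu> x) j i)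
       + (b - 3) * (\<Sum>i<m. fcof m (?A \<mu> x) i i * fcof m (?A \<nu> x) i i) \<partial>?P)"
  proof (intro Bochner_Integration.integral_cong refl)
    fix x
    have "inj_on (\<lambda>i. (n, c i)) {..<m}" using J by (auto simp: inj_on_def)
    then show "(\<integral>y. fdet m (shift (gram (Suc n) c (merge ?I ?R (x, y))) \<mu>) *
      fdet m (shift (gram (Suc n) c (merge ?I ?R (x, y))) \<nu>) \<partial>PiM ?R (\<lambda>_. Q)) =
      fdet m (?A \<mu> x) * fdet m (?A \<nu> x) + fdet m (?A \<mu> x) * ?tr \<nu> x + ?tr \<mu> x * fdet m (?A \<nu> x)
       + ?tr \<mu> x * ?tr \<nu> x + (\<Sum>i<m. \<Sum>j<m. fcof m (?A \<mu> x) i j * fcof m (?A \<nu> x) i j)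
       + (\<Sum>i<m. \<Sum>j<m. fcof m (?A \<mu> x) i j * fcof m (?A \<nu> x) j i)
       + (b - 3) * (\<Sum>i<m. fcof m (?A \<mu> x) i i * fcof m (?A \<nu> x) i i)"
      unfolding cov
      by (intro has_bochner_integral_integral_eq has_bochner_integral_quadratic_forms) (use J in auto)
  qed
  also have "\<dots> = (\<integral>x. fdet m (?A \<mu> x) * fdet m (?A \<nu> x) + ?tr \<mu> x * fdet m (?A \<nu> x) + ?tr \<nu> x * fdet m (?A \<mu> x)
       + ?tr \<mu> x * ?tr \<nu> x + 2 * (\<Sum>i<m. \<Sum>j<m. fcof m (?A \<mu> x) i j * fcof m (?A \<nu> x) j i)
       + (b - 3) * (\<Sum>i<m. fdet (m - 1) (shift (gram n (c \<circ> insert_index i) x) \<mu>) *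
           fdet (m - 1) (shift (gram n (c \<circ> insert_index i) x) \<nu>)) \<partial>?P)"
  proof (intro Bochner_Integration.integral_cong refl)
    fix x
    have "(\<Sum>i<m. \<Sum>j<m. fcof m (?A \<mu> x) i j * fcof m (?A \<nu> x) i j)
        = (\<Sum>i<m. \<Sum>j<m. fcof m (?A \<mu> x) i j * fcof m (?A \<nu> x) j i)"
      by (intro sum.cong refl arg_cong2[where f = "(*)"] fcof_symmetric) (auto simp: shift_def gram_sym)
    then show "fdet m (?A \<mu> x) * fdet m (?A \<nu> x) + fdet m (?A \<mu> x) * ?tr \<nu> x + ?tr \<mu> x * fdet m (?A \<nu> x)
       + ?tr \<mu> x * ?tr \<nu> x + (\<Sum>i<m. \<Sum>j<m. fcof m (?A \<mu> x) i j * fcof m (?A \<nu> x) i j)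
       + (\<Sum>i<m. \<Sum>j<m. fcof m (?A \<mu> x) i j * fcof m (?A \<nu> x) j i)
       + (b - 3) * (\<Sum>i<m. fcof m (?A \<mu> x) i i * fcof m (?A \<nu> x) i i)
     = fdet m (?A \<mu> x) * fdet m (?A \<nu> x) + ?tr \<mu> x * fdet m (?A \<nu> x) + ?tr \<nu> x * fdet m (?A \<mu> x)
       + ?tr \<mu> x * ?tr \<nu> x + 2 * (\<Sum>i<m. \<Sum>j<m. fcof m (?A \<mu> x) i j * fcof m (?A \<nu> x) j i)
       + (b - 3) * (\<Sum>i<m. fdet (m - 1) (shift (gram n (c \<circ> insert_index i) x) \<mu>) *
           fdet (m - 1) (shift (gram n (c \<circ> insert_index i) x) \<nu>))"
      by (simp add: fcof_shift_gram_diag algebra_simps)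
  qed
  also have "\<dots> = corr J n m c \<mu> \<nu> + corr1 J n m c \<mu> \<nu> + corr1 J n m c \<nu> \<mu> + corr11 J n m c \<mu> \<nu>
     + 2 * corr_trace J n m c \<mu> \<nu> + (b - 3) * (\<Sum>i<m. corr J n (m - 1) (c \<circ> insert_index i) \<mu> \<nu>)"
  proof -
    note q = quad_bounded_sum quad_bounded_fcof quad_bounded_fdet_shift J
    have ins: "inj_on (c \<circ> insert_index i) {..<m - 1}" "(c \<circ> insert_index i) ` {..<m - 1} \<subseteq> J" for i
      using inj_on_comp_insert_index[OF J(2)] J(3) by blast+
    have fin: "finite ?I" using J by auto
    have i1: "integrable ?P (\<lambda>x. fdet m (?A \<mu> x) * fdet m (?A \<nu> x))"
      by (intro integrable_quad_bounded fin q)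
    have i2: "integrable ?P (\<lambda>x. ?tr \<mu> x * fdet m (?A \<nu> x))" for \<mu> \<nu>
      by (intro integrable_quad_bounded fin q) auto
    have i3: "integrable ?P (\<lambda>x. ?tr \<mu> x * ?tr \<nu> x)"
      by (intro integrable_quad_bounded fin q) auto
    have i4: "integrable ?P (\<lambda>x. \<Sum>i<m. \<Sum>j<m. fcof m (?A \<mu> x) i j * fcof m (?A \<nu> x) j i)"
      by (intro Bochner_Integration.integrable_sum integrable_quad_bounded fin q) auto
    have i5: "integrable ?P (\<lambda>x. fdet (m - 1) (shift (gram n (c \<circ> insert_index i) x) \<mu>) *
           fdet (m - 1) (shift (gram n (c \<circ> insert_index i) x) \<nu>))" for i
      by (intro integrable_quad_bounded fin quad_bounded_fdet_shift J ins)
    note hb = has_bochner_integral_integrable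
    show ?thesis
      unfolding corr_def corr1_def corr11_def corr_trace_def
      by (rule has_bochner_integral_integral_eq[OF has_bochner_integral_add[OF has_bochner_integral_add[OF
            has_bochner_integral_add[OF has_bochner_integral_add[OF has_bochner_integral_add[OF
            hb[OF i1] hb[OF i2]] hb[OF i2]] hb[OF i3]] has_bochner_integral_mult_right[OF hb[OF i4]]]
            has_bochner_integral_mult_right[OF has_bochner_integral_sum[OF hb[OF i5]]]]])
  qed
  finally show ?thesis .
qed

end
end

text \<open>The coefficient of \<open>(\<mu> + \<nu>)\<^bsup>r\<^esup> (\<mu> \<nu>)\<^bsup>k\<^esup>\<close> in \<open>f(n, m; \<mu>, \<nu>)\<close>, where \<open>\<beta> = b - 3\<close>.\<close>

primrec corr_coeff :: "real \<Rightarrow> nat \<Rightarrow> nat \<Rightarrow> nat \<Rightarrow> nat \<Rightarrow> real" where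
  "corr_coeff \<beta> 0 m k r = of_bool (k = m \<and> r = 0)"
| "corr_coeff \<beta> (Suc n) m k r = corr_coeff \<beta> n m k r
     - 2 * real (Suc r) * corr_coeff \<beta> n m k (Suc r)
     + real (Suc (Suc r)) * real (Suc r) * corr_coeff \<beta> n m k (Suc (Suc r))
     - real (Suc k) * (if r = 0 then 0 else corr_coeff \<beta> n m (Suc k) (r - 1))
     + real (Suc k) * (real r + real k + 3) * corr_coeff \<beta> n m (Suc k) r
     + \<beta> * real m * corr_coeff \<beta> n (m - 1) k r"

lemma corr_coeff_eq_0: "m < k + r \<Longrightarrow> corr_coeff \<beta> n m k r = 0"
  by (induction n arbitrary: m k r) auto

definition corr_poly :: "real \<Rightarrow> nat \<Rightarrow> nat \<Rightarrow> real \<Rightarrow> real \<Rightarrow> real" where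
  "corr_poly \<beta> n m s p = (\<Sum>k\<le>m. \<Sum>r\<le>m. corr_coeff \<beta> n m k r * s ^ r * p ^ k)"

lemma sum_atMost_shift:
  fixes f :: "nat \<Rightarrow> real"
  assumes "f 0 = 0" "f (Suc m) = 0"
  shows "(\<Sum>k\<le>m. f k) = (\<Sum>k\<le>m. f (Suc k))"
  using sum.atMost_Suc_shift[of f m] assms by simp

text \<open>In the variables s and p one row acts as the operator 1 - 2 D_s + D_s^2 - s D_p + (s D_s
  + p D_p + 3) D_p, D_s and D_p being the partial derivatives, plus the term with
  \<open>m - 1\<close>. The right-hand side is this operator on monomials; index shifts carry it
  back to the coefficients, and the vanishing of coefficients beyond total degree \<open>m\<close>
  removes the boundary terms.\<close>

lemma corr_poly_Suc:
  "corr_poly \<beta> (Suc n) m s p =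
    (\<Sum>k\<le>m. \<Sum>r\<le>m. corr_coeff \<beta> n m k r * (s ^ r * p ^ k - 2 * (real r * s ^ (r - 1)) * p ^ k
       + real r * (real (r - 1) * s ^ (r - 2)) * p ^ k - s ^ Suc r * (real k * p ^ (k - 1))
       + (real r + real k + 2) * s ^ r * (real k * p ^ (k - 1))))
    + \<beta> * real m * corr_poly \<beta> n (m - 1) s p"
proof -
  define C where "C = corr_coeff \<beta> n m"
  have C0: "C k r = 0" if "m < k + r" for k r
    using that unfolding C_def by (rule corr_coeff_eq_0)
  have t1: "(\<Sum>k\<le>m. \<Sum>r\<le>m. C k r * (2 * (real r * s ^ (r - 1)) * p ^ k))
      = (\<Sum>k\<le>m. \<Sum>r\<le>m. 2 * real (Suc r) * C k (Suc r) * s ^ r * p ^ k)"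
    by (rule sum.cong[OF refl], subst sum_atMost_shift) (auto simp: C0 algebra_simps intro!: sum.cong)
  have t2: "(\<Sum>k\<le>m. \<Sum>r\<le>m. C k r * (real r * (real (r - 1) * s ^ (r - 2)) * p ^ k))
      = (\<Sum>k\<le>m. \<Sum>r\<le>m. real (Suc (Suc r)) * real (Suc r) * C k (Suc (Suc r)) * s ^ r * p ^ k)"
    by (rule sum.cong[OF refl], subst sum_atMost_shift, simp, simp add: C0, subst sum_atMost_shift) (auto simp: C0 mult_ac)
  have t3: "(\<Sum>k\<le>m. \<Sum>r\<le>m. C k r * (s ^ Suc r * (real k * p ^ (k - 1))))
      = (\<Sum>k\<le>m. \<Sum>r\<le>m. real (Suc k) * (if r = 0 then 0 else C (Suc k) (r - 1)) * s ^ r * p ^ k)"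
  proof -
    have "(\<Sum>k\<le>m. \<Sum>r\<le>m. C k r * (s ^ Suc r * (real k * p ^ (k - 1))))
        = (\<Sum>k\<le>m. \<Sum>r\<le>m. C (Suc k) r * (s ^ Suc r * (real (Suc k) * p ^ k)))"
      by (subst sum_atMost_shift) (auto simp: C0)
    also have "\<dots> = (\<Sum>k\<le>m. \<Sum>r\<le>m. real (Suc k) * (if r = 0 then 0 else C (Suc k) (r - 1)) * s ^ r * p ^ k)"
    proof (rule sum.cong[OF refl])
      fix k
      show "(\<Sum>r\<le>m. C (Suc k) r * (s ^ Suc r * (real (Suc k) * p ^ k)))
         = (\<Sum>r\<le>m. real (Suc k) * (if r = 0 then 0 else C (Suc k) (r - 1)) * s ^ r * p ^ k)"
        by (subst (2) sum_atMost_shift) (auto simp: C0 mult_ac)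
    qed
    finally show ?thesis .
  qed
  have t4: "(\<Sum>k\<le>m. \<Sum>r\<le>m. C k r * ((real r + real k + 2) * s ^ r * (real k * p ^ (k - 1))))
      = (\<Sum>k\<le>m. \<Sum>r\<le>m. real (Suc k) * (real r + real k + 3) * C (Suc k) r * s ^ r * p ^ k)"
    by (subst sum_atMost_shift) (auto simp: C0 algebra_simps)
  have t5: "\<beta> * real m * corr_poly \<beta> n (m - 1) s p
      = (\<Sum>k\<le>m. \<Sum>r\<le>m. \<beta> * real m * corr_coeff \<beta> n (m - 1) k r * s ^ r * p ^ k)"
  proof (cases m)
    case (Suc m')
    have "(\<Sum>k\<le>Suc m'. \<Sum>r\<le>Suc m'. \<beta> * real m * corr_coeff \<beta> n m' k r * s ^ r * p ^ k)
        = (\<Sum>k\<le>m'. \<Sum>r\<le>m'. \<beta> * real m * corr_coeff \<beta> n m' k r * s ^ r * p ^ k)"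
      by (simp add: corr_coeff_eq_0)
    then show ?thesis
      unfolding corr_poly_def by (simp add: Suc sum_distrib_left mult_ac)
  qed auto
  have split: "(\<Sum>k\<le>m. \<Sum>r\<le>m. C k r * (a k r - u k r + d k r - e k r + f k r))
     = (\<Sum>k\<le>m. \<Sum>r\<le>m. C k r * a k r) - (\<Sum>k\<le>m. \<Sum>r\<le>m. C k r * u k r) + (\<Sum>k\<le>m. \<Sum>r\<le>m. C k r * d k r)
       - (\<Sum>k\<le>m. \<Sum>r\<le>m. C k r * e k r) + (\<Sum>k\<le>m. \<Sum>r\<le>m. C k r * f k r)" for a u d e f :: "nat \<Rightarrow> nat \<Rightarrow> real"
    by (simp add: algebra_simps sum.distrib sum_subtractf)
  have join: "(\<Sum>k\<le>m. \<Sum>r\<le>m. (a k r - u k r + d k r - e k r + f k r + g k r) * s ^ r * p ^ k)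
     = (\<Sum>k\<le>m. \<Sum>r\<le>m. a k r * (s ^ r * p ^ k)) - (\<Sum>k\<le>m. \<Sum>r\<le>m. u k r * s ^ r * p ^ k) + (\<Sum>k\<le>m. \<Sum>r\<le>m. d k r * s ^ r * p ^ k)
       - (\<Sum>k\<le>m. \<Sum>r\<le>m. e k r * s ^ r * p ^ k) + (\<Sum>k\<le>m. \<Sum>r\<le>m. f k r * s ^ r * p ^ k)
       + (\<Sum>k\<le>m. \<Sum>r\<le>m. g k r * s ^ r * p ^ k)" for a u d e f g :: "nat \<Rightarrow> nat \<Rightarrow> real"
    by (simp add: algebra_simps sum.distrib sum_subtractf)
  show ?thesis
    unfolding t5 C_def[symmetric] split t1 t2 t3 t4
    unfolding corr_poly_def corr_coeff.simps C_def[symmetric] join ..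
qed

section \<open>The expectation as a polynomial in the sum and the product of its arguments\<close>

context fourth_moment_law
begin

lemma corr_0:
  "corr J 0 m c \<mu> \<nu> = (\<mu> * \<nu>) ^ m"
proof -
  have *: "fdet m (shift (gram 0 c \<omega>) \<mu>) = (- \<mu>) ^ m" for \<omega> \<mu>
  proof -
    have "Matrix.mat m m (\<lambda>(i, j). shift (gram 0 c \<omega>) \<mu> i j) = (- \<mu>) \<cdot>\<^sub>m 1\<^sub>m m"
      by (intro Matrix.eq_matI) (auto simp: shift_def gram_def)
    then show ?thesis by (simp add: fdet_def)
  qed
  interpret P: prob_space "PiM ({..<0::nat} \<times> J) (\<lambda>_. Q)"
    by (rule prob_space_PiM) unfold_locales
  have "corr J 0 m c \<mu> \<nu> = (\<integral>\<omega>. (- \<mu>) ^ m * (- \<nu>) ^ m \<partial>PiM ({..<0::nat} \<times> J) (\<lambda>_. Q))"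
    unfolding corr_def * by (rule refl)
  also have "\<dots> = (- \<mu>) ^ m * (- \<nu>) ^ m"
    by (subst Bochner_Integration.lebesgue_integral_const) (use P.prob_space in simp)
  finally show ?thesis by (simp flip: power_mult_distrib)
qed

text \<open>All \<open>m\<close> and \<open>c\<close> are treated in one induction since the
  cumulant term refers to \<open>m - 1\<close> columns. Once \<open>corr\<close> is a polynomial,
  uniqueness of derivatives makes \<open>corr1\<close> and \<open>corr11\<close> polynomials as
  well; the trace term is then the difference of two values of \<open>corr1\<close> divided by \<mu>
  - \<nu>, which amounts to the derivative in p.\<close>

theorem corr_eq_corr_poly:
  assumes "finite J" "inj_on c {..<m}" "c ` {..<m} \<subseteq> J"
  shows "corr J n m c \<mu> \<nu> = corr_poly (b - 3) n m (\<mu> + \<nu>) (\<mu> * \<nu>)"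
  using assms(2,3)
proof (induction n arbitrary: m c \<mu> \<nu>)
  case 0
  have "corr_poly (b - 3) 0 m s p = p ^ m" for s p
  proof -
    have *: "(\<Sum>r\<le>m'. of_bool (r = 0) * s ^ r) = 1" for m' by (induction m') auto
    have "corr_poly (b - 3) 0 m s p = (\<Sum>k\<le>m. if k = m then (\<Sum>r\<le>m. of_bool (r = 0) * s ^ r) * p ^ k else 0)"
      unfolding corr_poly_def sum_distrib_right by (intro sum.cong refl) auto
    then show ?thesis by (simp add: *)
  qed
  then show ?case by (simp add: corr_0)
next
  case (Suc n)
  note J = assms(1) Suc.prems
  define C where "C = corr_coeff (b - 3) n m"
  have corr: "corr J n m c \<mu> \<nu> = (\<Sum>k\<le>m. \<Sum>r\<le>m. C k r * (\<mu> + \<nu>) ^ r * (\<mu> * \<nu>) ^ k)" for \<mu> \<nu>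
    unfolding C_def Suc.IH[OF J(2,3)] corr_poly_def ..
  have corr1: "corr1 J n m c \<mu> \<nu> = - (\<Sum>k\<le>m. \<Sum>r\<le>m. C k r * (real r * (\<mu> + \<nu>) ^ (r - 1) * (\<mu> * \<nu>) ^ k
       + (\<mu> + \<nu>) ^ r * (real k * (\<mu> * \<nu>) ^ (k - 1)) * \<nu>))" for \<mu> \<nu>
  proof -
    have "((\<lambda>\<mu>. corr J n m c \<mu> \<nu>) has_real_derivative (\<Sum>k\<le>m. \<Sum>r\<le>m. C k r * (real r * (\<mu> + \<nu>) ^ (r - 1) * (\<mu> * \<nu>) ^ k
       + (\<mu> + \<nu>) ^ r * (real k * (\<mu> * \<nu>) ^ (k - 1)) * \<nu>))) (at \<mu>)"
      unfolding corr by (auto intro!: derivative_eq_intros sum.cong simp: algebra_simps simp del: power_mult_distrib)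
    from DERIV_unique[OF this has_derivative_corr[OF J]] show ?thesis by simp
  qed
  have corr11: "corr11 J n m c \<mu> \<nu> = (\<Sum>k\<le>m. \<Sum>r\<le>m. C k r *
       (real r * (real (r - 1) * (\<mu> + \<nu>) ^ (r - 2)) * (\<mu> * \<nu>) ^ k
        + real r * (\<mu> + \<nu>) ^ (r - 1) * (real k * (\<mu> * \<nu>) ^ (k - 1)) * (\<mu> + \<nu>)
        + (\<mu> + \<nu>) ^ r * (real k * (real (k - 1) * (\<mu> * \<nu>) ^ (k - 2))) * (\<mu> * \<nu>)
        + (\<mu> + \<nu>) ^ r * (real k * (\<mu> * \<nu>) ^ (k - 1))))" for \<mu> \<nu>
  proof -
    have "((\<lambda>\<nu>. corr1 J n m c \<mu> \<nu>) has_real_derivative - (\<Sum>k\<le>m. \<Sum>r\<le>m. C k r *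
       (real r * (real (r - 1) * (\<mu> + \<nu>) ^ (r - 2)) * (\<mu> * \<nu>) ^ k
        + real r * (\<mu> + \<nu>) ^ (r - 1) * (real k * (\<mu> * \<nu>) ^ (k - 1)) * (\<mu> + \<nu>)
        + (\<mu> + \<nu>) ^ r * (real k * (real (k - 1) * (\<mu> * \<nu>) ^ (k - 2))) * (\<mu> * \<nu>)
        + (\<mu> + \<nu>) ^ r * (real k * (\<mu> * \<nu>) ^ (k - 1))))) (at \<nu>)"
      unfolding corr1 by (auto intro!: derivative_eq_intros sum.cong simp: algebra_simps numeral_2_eq_2 simp del: power_mult_distrib)
    from DERIV_unique[OF this has_derivative_corr1[OF J]] show ?thesis by simp
  qed
  have neq: "corr J (Suc n) m c \<mu> \<nu> = corr_poly (b - 3) (Suc n) m (\<mu> + \<nu>) (\<mu> * \<nu>)" if "\<mu> \<noteq> \<nu>" for \<mu> \<nu>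
  proof -
    have "(\<mu> - \<nu>) * corr_trace J n m c \<mu> \<nu> = (\<mu> - \<nu>) * (\<Sum>k\<le>m. \<Sum>r\<le>m. C k r * ((\<mu> + \<nu>) ^ r * (real k * (\<mu> * \<nu>) ^ (k - 1))))"
      unfolding corr_trace_resolvent[OF J] corr1 sum_distrib_left sum_negf[symmetric] sum_subtractf[symmetric]
      by (intro sum.cong refl) (simp add: algebra_simps)
    then have tr: "corr_trace J n m c \<mu> \<nu> = (\<Sum>k\<le>m. \<Sum>r\<le>m. C k r * ((\<mu> + \<nu>) ^ r * (real k * (\<mu> * \<nu>) ^ (k - 1))))"
      using that by simp
    have minors: "(\<Sum>i<m. corr J n (m - 1) (c \<circ> insert_index i) \<mu> \<nu>) = real m * corr_poly (b - 3) n (m - 1) (\<mu> + \<nu>) (\<mu> * \<nu>)"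
    proof -
      have "corr J n (m - 1) (c \<circ> insert_index i) \<mu> \<nu> = corr_poly (b - 3) n (m - 1) (\<mu> + \<nu>) (\<mu> * \<nu>)" for i
        by (rule Suc.IH[OF inj_on_comp_insert_index(1)[OF J(2)] order_trans[OF inj_on_comp_insert_index(2)[OF J(2)] J(3)]])
      then show ?thesis by (simp only: sum_constant card_lessThan)
    qed
    \<comment> \<open>The factors \<open>real k\<close> and \<open>real (k - 1)\<close> vanish
      exactly where the truncated exponents \<open>k - 1\<close> and \<open>k - 2\<close> would be
      wrong.\<close>
    have pw: "real k * (real (k - 1) * x ^ (k - 2)) * x = (real k - 1) * (real k * x ^ (k - 1))"
      "real k * x ^ (k - 1) * x = real k * x ^ k" for k :: nat and x :: real
      by (cases k; cases "k - 1"; simp)+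
    show ?thesis
      unfolding corr_Suc[OF J] corr_poly_Suc minors tr corr11 corr1 corr
      unfolding C_def[symmetric] sum_distrib_left sum_negf[symmetric]
      unfolding add.commute[of \<nu> \<mu>] mult.commute[of \<nu> \<mu>]
      unfolding mult.assoc[of "b - 3", symmetric] add_right_cancel sum.distrib[symmetric]
    proof (intro sum.cong refl)
      fix k r
      let ?s = "\<mu> + \<nu>" and ?p = "\<mu> * \<nu>"
      have 1: "?s ^ r * (real k * (real (k - 1) * ?p ^ (k - 2))) * ?p = ?s ^ r * ((real k - 1) * (real k * ?p ^ (k - 1)))"
        by (subst mult.assoc, subst pw(1)) (rule refl)
      have 2: "real r * ?s ^ (r - 1) * (real k * ?p ^ (k - 1)) * ?s = real r * ?s ^ r * (real k * ?p ^ (k - 1))"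
        by (subst pw(2)[symmetric]) (simp only: mult_ac)
      show "C k r * ?s ^ r * ?p ^ k
        + - (C k r * (real r * ?s ^ (r - 1) * ?p ^ k + ?s ^ r * (real k * ?p ^ (k - 1)) * \<nu>))
        + - (C k r * (real r * ?s ^ (r - 1) * ?p ^ k + ?s ^ r * (real k * ?p ^ (k - 1)) * \<mu>))
        + C k r * (real r * (real (r - 1) * ?s ^ (r - 2)) * ?p ^ k
          + real r * ?s ^ (r - 1) * (real k * ?p ^ (k - 1)) * ?s
          + ?s ^ r * (real k * (real (k - 1) * ?p ^ (k - 2))) * ?p
          + ?s ^ r * (real k * ?p ^ (k - 1)))
        + 2 * (C k r * (?s ^ r * (real k * ?p ^ (k - 1))))
        = C k r * (?s ^ r * ?p ^ k - 2 * (real r * ?s ^ (r - 1)) * ?p ^ k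
         + real r * (real (r - 1) * ?s ^ (r - 2)) * ?p ^ k - ?s ^ Suc r * (real k * ?p ^ (k - 1))
         + (real r + real k + 2) * ?s ^ r * (real k * ?p ^ (k - 1)))"
        unfolding 1 2 by (simp add: algebra_simps)
    qed
  qed
  \<comment> \<open>The resolvent identity determines the trace term only off the diagonal, which is reached by continuity.\<close>
  show ?case
  proof (cases "\<mu> = \<nu>")
    case True
    have "((\<lambda>\<mu>. corr J (Suc n) m c \<mu> \<nu>) \<longlongrightarrow> corr J (Suc n) m c \<nu> \<nu>) (at \<nu>)"
      using DERIV_isCont[OF has_derivative_corr[OF J]] by (simp add: isCont_def)
    moreover have "\<forall>\<^sub>F \<mu> in at \<nu>. corr J (Suc n) m c \<mu> \<nu> = corr_poly (b - 3) (Suc n) m (\<mu> + \<nu>) (\<mu> * \<nu>)"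
      unfolding eventually_at_filter using neq by simp
    ultimately have "((\<lambda>\<mu>. corr_poly (b - 3) (Suc n) m (\<mu> + \<nu>) (\<mu> * \<nu>)) \<longlongrightarrow> corr J (Suc n) m c \<nu> \<nu>) (at \<nu>)"
      by (rule Lim_transform_eventually)
    moreover have "((\<lambda>\<mu>. corr_poly (b - 3) (Suc n) m (\<mu> + \<nu>) (\<mu> * \<nu>)) \<longlongrightarrow> corr_poly (b - 3) (Suc n) m (\<nu> + \<nu>) (\<nu> * \<nu>)) (at \<nu>)"
      unfolding corr_poly_def by (intro tendsto_intros)
    ultimately show ?thesis
      using True by (metis tendsto_unique at_neq_bot)
  qed (rule neq)
qed

end

subsection \<open>Closed form of the coefficients\<close>

text \<open>The reciprocal Gamma function at k + n - m + 1, with its zeros at the poles of Gamma.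
  The recursion starts with no rows, so that n < m has to be covered too.\<close>

definition inv_fact_excess :: "nat \<Rightarrow> nat \<Rightarrow> nat \<Rightarrow> real" where
  "inv_fact_excess n m k = (if m \<le> k + n then 1 / fact (k + n - m) else 0)"

definition gauss_binom :: "nat \<Rightarrow> nat \<Rightarrow> nat \<Rightarrow> nat \<Rightarrow> real" where
  "gauss_binom n m k r = (if k + r \<le> m then real ((n + 2 + k) choose (m - k - r)) else 0)"

text \<open>The coefficients for \<open>\<beta> = 0\<close>, as for Gaussian entries.\<close>

definition gauss_coeff :: "nat \<Rightarrow> nat \<Rightarrow> nat \<Rightarrow> nat \<Rightarrow> real" where
  "gauss_coeff n m k r = (-1) ^ r * (fact n * fact m / (fact k * fact r)) * gauss_binom n m k r * inv_fact_excess n m k"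

text \<open>The functional equation of the reciprocal Gamma function; at m = k + n + 1 the left side
  is 0 by definition and the linear factor on the right vanishes.\<close>

lemma inv_fact_excess_Suc:
  "inv_fact_excess n m k = (real k + real n + 1 - real m) * inv_fact_excess n m (Suc k)"
  "inv_fact_excess (Suc n) m k = inv_fact_excess n m (Suc k)"
proof -
  show "inv_fact_excess n m k = (real k + real n + 1 - real m) * inv_fact_excess n m (Suc k)"
  proof (cases "m \<le> k + n")
    case True
    then have "Suc k + n - m = Suc (k + n - m)" by simp
    moreover have "real k + real n + 1 - real m = real (Suc (k + n - m))" using True by (simp add: of_nat_diff)
    ultimately show ?thesis using True by (simp add: inv_fact_excess_def field_simps del: of_nat_Suc)
  qed (auto simp: inv_fact_excess_def)
qed (simp add: inv_fact_excess_def)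

lemma binomial_step: "real (Suc j) * real (K choose Suc j) = (real K - real j) * real (K choose j)"
proof -
  have "real (Suc j) * real (K choose Suc j) = real K * real ((K - 1) choose j)"
    by (metis binomial_absorption of_nat_mult)
  also have "\<dots> = real ((K - j) * (K choose j))"
    by (metis binomial_absorb_comp of_nat_mult)
  also have "\<dots> = (real K - real j) * real (K choose j)"
    by (cases "j \<le> K") (auto simp: of_nat_diff)
  finally show ?thesis .
qed

text \<open>With M = m - k - r, Pascal's rule on two adjacent pairs combines the binomials with
  weights 1, 2, 1 into two with upper index n + 3 + k. All terms then are multiples of these two,
  whose ratio is known, and a linear identity remains. The cases M = 0 and M = 1 are separate
  because some of the terms are cut off there.\<close>

lemma gauss_binom_Suc:
  "(real n + 1) * gauss_binom (Suc n) m k r =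
     (real k + real n + 1 - real m) * (gauss_binom n m k r + 2 * gauss_binom n m k (Suc r) + gauss_binom n m k (Suc (Suc r)))
     + real r * gauss_binom n m (Suc k) (r - 1) + (real r + real k + 3) * gauss_binom n m (Suc k) r"
proof (cases "k + r \<le> m")
  case True
  then obtain M where M: "m = k + r + M" by (metis le_Suc_ex)
  \<comment> \<open>The factor \<open>real r\<close> hides the truncated \<open>r - 1\<close> at r =
    0.\<close>
  have r1: "real r * gauss_binom n m (Suc k) (r - 1) = real r * real ((n + 3 + k) choose M)"
    by (cases r) (simp_all add: M gauss_binom_def eval_nat_numeral)
  consider "M = 0" | "M = 1" | j where "M = Suc (Suc j)" by (metis One_nat_def not0_implies_Suc)
  then show ?thesis
  proof cases
    case 1
    then show ?thesis unfolding r1 by (simp add: M gauss_binom_def)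
  next
    case 2
    then show ?thesis unfolding r1 by (simp add: M gauss_binom_def algebra_simps)
  next
    case (3 j)
    define K where "K = n + 3 + k"
    have K: "Suc n + 2 + k = K" "n + 2 + Suc k = K" by (auto simp: K_def)
    have s: "gauss_binom n m k r + 2 * gauss_binom n m k (Suc r) + gauss_binom n m k (Suc (Suc r))
        = real (K choose M) + real (K choose Suc j)"
    proof -
      define L where "L = n + 2 + k"
      have L: "K = Suc L" by (simp add: K_def L_def)
      have "gauss_binom n m k r = real (L choose Suc (Suc j))"
        "gauss_binom n m k (Suc r) = real (L choose Suc j)"
        "gauss_binom n m k (Suc (Suc r)) = real (L choose j)"
        by (simp_all add: M 3 gauss_binom_def L_def)
      moreover have "K choose M = (L choose Suc j) + (L choose Suc (Suc j))"
        "K choose Suc j = (L choose j) + (L choose Suc j)"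
        unfolding 3 L by (rule binomial_Suc_Suc)+
      ultimately show ?thesis by simp
    qed
    have "gauss_binom (Suc n) m k r = real ((Suc n + 2 + k) choose M)"
      "gauss_binom n m (Suc k) r = real ((n + 2 + Suc k) choose Suc j)"
      by (simp_all add: M 3 gauss_binom_def)
    then have "gauss_binom (Suc n) m k r = real (K choose M)" "gauss_binom n m (Suc k) r = real (K choose Suc j)"
      unfolding K by simp_all
    note e = s this
    have "real M * real (K choose M) = (real K - real (Suc j)) * real (K choose Suc j)"
      unfolding 3 by (rule binomial_step)
    then have "real M * real (K choose M) = (real n + real k + 2 - real j) * real (K choose Suc j)"
      by (simp add: K_def)
    moreover have "real k + real n + 1 - real m = real n + 1 - real r - real M" "real M = real j + 2"
      by (simp_all add: M 3)
    moreover have "(n' + 1) * x = (k' + n' + 1 - m') * (x + y) + r' * x + (r' + k' + 3) * y"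
      if "M' * x = (n' + k' + 2 - j') * y" "k' + n' + 1 - m' = n' + 1 - r' - M'" "M' = j' + 2" for n' k' m' r' x y M' j' :: real
      using that(1) unfolding that(2) that(3) by (simp add: algebra_simps)
    ultimately have "(real n + 1) * real (K choose M) = (real k + real n + 1 - real m) * (real (K choose M) + real (K choose Suc j))
        + real r * real (K choose M) + (real r + real k + 3) * real (K choose Suc j)"
      by blast
    then show ?thesis unfolding r1[folded K_def] e .
  qed
next
  case False
  then show ?thesis by (cases r) (auto simp: gauss_binom_def)
qed

lemma gauss_coeff_0: "gauss_coeff 0 m k r = of_bool (k = m \<and> r = 0)"
proof (cases "k + r \<le> m \<and> m \<le> k")
  case True
  then have "k = m" "r = 0" by auto
  then show ?thesis by (simp add: gauss_coeff_def gauss_binom_def inv_fact_excess_def)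
qed (auto simp: gauss_coeff_def gauss_binom_def inv_fact_excess_def)

lemma gauss_coeff_Suc:
  "gauss_coeff (Suc n) m k r = gauss_coeff n m k r
     - 2 * real (Suc r) * gauss_coeff n m k (Suc r)
     + real (Suc (Suc r)) * real (Suc r) * gauss_coeff n m k (Suc (Suc r))
     - real (Suc k) * (if r = 0 then 0 else gauss_coeff n m (Suc k) (r - 1))
     + real (Suc k) * (real r + real k + 3) * gauss_coeff n m (Suc k) r"
proof -
  define c where "c = (-1) ^ r * (fact n * fact m / (fact k * fact r) :: real)"
  let ?e = "inv_fact_excess n m (Suc k)"
  have 1: "gauss_coeff n m k r = c * (gauss_binom n m k r * inv_fact_excess n m k)"
    by (simp add: gauss_coeff_def c_def)
  have 2: "real (Suc r) * gauss_coeff n m k (Suc r) = - c * (gauss_binom n m k (Suc r) * inv_fact_excess n m k)"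
    by (simp add: gauss_coeff_def c_def field_simps del: of_nat_Suc)
  have 3: "real (Suc (Suc r)) * real (Suc r) * gauss_coeff n m k (Suc (Suc r)) = c * (gauss_binom n m k (Suc (Suc r)) * inv_fact_excess n m k)"
    by (simp add: gauss_coeff_def c_def field_simps del: of_nat_Suc)
  have 4: "real (Suc k) * (if r = 0 then 0 else gauss_coeff n m (Suc k) (r - 1)) = - c * (real r * gauss_binom n m (Suc k) (r - 1) * ?e)"
    by (cases r) (simp_all add: gauss_coeff_def c_def field_simps del: of_nat_Suc)
  have 5: "real (Suc k) * gauss_coeff n m (Suc k) r = c * (gauss_binom n m (Suc k) r * ?e)"
    by (simp add: gauss_coeff_def c_def field_simps del: of_nat_Suc)
  have "gauss_coeff (Suc n) m k r = c * ((real n + 1) * gauss_binom (Suc n) m k r * ?e)"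
    by (simp add: gauss_coeff_def c_def inv_fact_excess_Suc(2) field_simps)
  also have "\<dots> = c * (gauss_binom n m k r * inv_fact_excess n m k) - 2 * (- c * (gauss_binom n m k (Suc r) * inv_fact_excess n m k))
     + c * (gauss_binom n m k (Suc (Suc r)) * inv_fact_excess n m k)
     - (- c * (real r * gauss_binom n m (Suc k) (r - 1) * ?e)) + (real r + real k + 3) * (c * (gauss_binom n m (Suc k) r * ?e))"
    unfolding gauss_binom_Suc inv_fact_excess_Suc(1)[of n m k] by (simp only: algebra_simps)
  finally show ?thesis
    unfolding 1[symmetric] 2[symmetric] 3[symmetric] 4[symmetric] 5[symmetric] by (simp add: mult_ac)
qed

text \<open>The cumulant term commutes with the Gaussian step, which acts on the indices
  \<open>k\<close> and \<open>r\<close> only. Hence j of the n rows are chosen at which it is taken;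
  each of them removes a column, with total weight m (m - 1) ... (m - j + 1), and the remaining rows
  and columns contribute the Gaussian coefficient.\<close>

lemma corr_coeff_closed:
  "corr_coeff \<beta> n m k r = (\<Sum>j\<le>m. \<beta> ^ j * real (n choose j) * (fact m / fact (m - j)) * gauss_coeff (n - j) (m - j) k r)"
proof (induction n arbitrary: m k r)
  case 0
  have "(\<Sum>j\<le>m. \<beta> ^ j * real (0 choose j) * (fact m / fact (m - j)) * gauss_coeff (0 - j) (m - j) k r)
      = (\<Sum>j\<le>m. if j = 0 then gauss_coeff 0 m k r else 0)"
    by (intro sum.cong refl) (auto simp: binomial_eq_0)
  then show ?case by (simp add: gauss_coeff_0)
next
  case (Suc n)
  note IH = Suc.IH
  define w where "w j = \<beta> ^ j * real (n choose j) * (fact m / fact (m - j))" for j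
  have a: "w j * gauss_coeff (Suc n - j) (m - j) k r = w j * gauss_coeff (n - j) (m - j) k r
     - 2 * real (Suc r) * (w j * gauss_coeff (n - j) (m - j) k (Suc r))
     + real (Suc (Suc r)) * real (Suc r) * (w j * gauss_coeff (n - j) (m - j) k (Suc (Suc r)))
     - real (Suc k) * (if r = 0 then 0 else w j * gauss_coeff (n - j) (m - j) (Suc k) (r - 1))
     + real (Suc k) * (real r + real k + 3) * (w j * gauss_coeff (n - j) (m - j) (Suc k) r)" for j
  proof (cases "j \<le> n")
    case True
    then have "Suc n - j = Suc (n - j)" by simp
    then show ?thesis by (simp only: gauss_coeff_Suc) (simp add: algebra_simps)
  next
    case False
    \<comment> \<open>More cumulant steps than rows have weight 0, so the truncated differences
      \<open>n - j\<close> do no harm.\<close>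
    then have "w j = 0" by (simp add: w_def)
    then show ?thesis by simp
  qed
  have b1: "corr_coeff \<beta> n m k r
     - 2 * real (Suc r) * corr_coeff \<beta> n m k (Suc r)
     + real (Suc (Suc r)) * real (Suc r) * corr_coeff \<beta> n m k (Suc (Suc r))
     - real (Suc k) * (if r = 0 then 0 else corr_coeff \<beta> n m (Suc k) (r - 1))
     + real (Suc k) * (real r + real k + 3) * corr_coeff \<beta> n m (Suc k) r
    = (\<Sum>j\<le>m. w j * gauss_coeff (Suc n - j) (m - j) k r)"
    unfolding a unfolding IH w_def[symmetric]
    by (cases "r = 0") (simp_all add: sum.distrib sum_subtractf sum_distrib_left del: of_nat_Suc)
  have b2: "\<beta> * real m * corr_coeff \<beta> n (m - 1) k r
    = (\<Sum>j\<le>m. \<beta> ^ j * (if j = 0 then 0 else real (n choose (j - 1))) * (fact m / fact (m - j)) * gauss_coeff (Suc n - j) (m - j) k r)"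
  proof (cases m)
    case (Suc m')
    show ?thesis
      unfolding IH[of "m - 1"] unfolding Suc sum.atMost_Suc_shift
      by (simp add: sum_distrib_left mult_ac)
  qed auto
  have pascal: "real (n choose j) + (if j = 0 then 0 else real (n choose (j - 1))) = real (Suc n choose j)" for j
    by (cases j) auto
  show ?case
    unfolding corr_coeff.simps b1 b2 sum.distrib[symmetric] pascal[symmetric] w_def
    by (intro sum.cong refl) (simp add: algebra_simps)
qed

text \<open>Removing a row together with a column preserves the excess n - m, so the factorials of k
  do not depend on j. Only the binomial couples j, k and r, which is what makes the generating
  function a product.\<close>

lemma corr_coeff_divide_fact:
  assumes "m \<le> n"
  shows "corr_coeff \<beta> n m k r / (fact n * fact m) =
    (\<Sum>j\<le>m. if k + r + j \<le> m then \<beta> ^ j / fact j * ((-1) ^ r / fact r) * (1 / (fact k * fact (k + (n - m))))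
        * real ((n - j + 2 + k) choose (m - j - k - r)) else 0)"
  unfolding corr_coeff_closed sum_divide_distrib
proof (intro sum.cong refl)
  fix j assume "j \<in> {..m}"
  then have j: "j \<le> m" "j \<le> n" using assms by auto
  have "m - j \<le> k + (n - j)" "k + (n - j) - (m - j) = k + (n - m)" using j assms by auto
  then have g: "gauss_coeff (n - j) (m - j) k r = (-1) ^ r * (fact (n - j) * fact (m - j) / (fact k * fact r))
      * gauss_binom (n - j) (m - j) k r * (1 / fact (k + (n - m)))"
    by (simp add: gauss_coeff_def inv_fact_excess_def)
  have n: "real (n choose j) = fact n / (fact j * fact (n - j))"
    using j by (simp add: binomial_fact)
  show "\<beta> ^ j * real (n choose j) * (fact m / fact (m - j)) * gauss_coeff (n - j) (m - j) k r / (fact n * fact m)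
     = (if k + r + j \<le> m then \<beta> ^ j / fact j * ((-1) ^ r / fact r) * (1 / (fact k * fact (k + (n - m))))
        * real ((n - j + 2 + k) choose (m - j - k - r)) else 0)"
  proof (cases "k + r + j \<le> m")
    case True
    then have "gauss_binom (n - j) (m - j) k r = real ((n - j + 2 + k) choose (m - j - k - r))"
      by (simp add: gauss_binom_def)
    then show ?thesis unfolding g n using True by (simp add: field_simps)
  next
    case False
    then have "gauss_binom (n - j) (m - j) k r = 0" using j by (auto simp: gauss_binom_def)
    then show ?thesis unfolding g using False by simp
  qed
qed

subsection \<open>The generating function\<close>

text \<open>Since the power \<open>U ^ r\<close> starts at order r, the inner sums can all be
  extended to the common range up to \<open>m\<close> and exchanged.\<close>

lemma fps_nth_compose_mult:
  fixes A U G :: "'a::comm_ring_1 fps"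
  assumes "fps_nth U 0 = 0"
  shows "fps_nth ((A oo U) * G) m = (\<Sum>r\<le>m. fps_nth A r * fps_nth (U ^ r * G) m)"
proof -
  have U: "fps_nth (U ^ r) i = 0" if "i < r" for i r
    using startsby_zero_power_prefix[OF assms] that by blast
  have "fps_nth ((A oo U) * G) m = (\<Sum>i=0..m. \<Sum>r\<le>m. fps_nth A r * fps_nth (U ^ r) i * fps_nth G (m - i))"
    unfolding fps_mult_nth[of "A oo U"] fps_compose_nth sum_distrib_right
  proof (rule sum.cong[OF refl])
    fix i assume "i \<in> {0..m}"
    then show "(\<Sum>r=0..i. fps_nth A r * fps_nth (U ^ r) i * fps_nth G (m - i))
        = (\<Sum>r\<le>m. fps_nth A r * fps_nth (U ^ r) i * fps_nth G (m - i))"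
      by (intro sum.mono_neutral_left) (auto simp: U)
  qed
  also have "\<dots> = (\<Sum>r\<le>m. fps_nth A r * fps_nth (U ^ r * G) m)"
    by (subst sum.swap) (simp add: fps_mult_nth sum_distrib_left mult.assoc)
  finally show ?thesis .
qed

lemma fps_nth_inverse_one_minus_X_power:
  "fps_nth (inverse (1 - fps_X) ^ Suc K :: 'a::field_char_0 fps) M = of_nat ((M + K) choose M)"
proof (induction K arbitrary: M)
  case 0
  have "inverse (1 - fps_X :: 'a fps) = Abs_fps (\<lambda>_. 1)"
    by (subst fps_inverse_gp'[symmetric], subst fps_inverse_idempotent) simp_all
  then show ?case by simp
next
  case (Suc K)
  have W: "inverse (1 - fps_X :: 'a fps) = Abs_fps (\<lambda>_. 1)"
    by (subst fps_inverse_gp'[symmetric], subst fps_inverse_idempotent) simp_all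
  have "fps_nth (inverse (1 - fps_X) ^ Suc (Suc K) :: 'a fps) M
      = fps_nth (inverse (1 - fps_X) ^ Suc K * Abs_fps (\<lambda>_. 1)) M"
    by (subst power_Suc2, subst (2) W) simp
  also have "\<dots> = (\<Sum>i=0..M. of_nat ((i + K) choose i))"
    by (simp add: fps_mult_nth Suc.IH del: power_Suc)
  also have "\<dots> = of_nat (\<Sum>i\<le>M. (K + i) choose i)"
    by (simp add: atLeast0AtMost add.commute)
  also have "\<dots> = of_nat ((M + Suc K) choose M)"
    by (subst sum_choose_lower) (simp add: add.commute)
  finally show ?case .
qed

text \<open>In terms of the modified Bessel function, w^\<alpha> times the value of this series at
  w^2 is I_\<alpha>(2 w).\<close>

definition bessel_fps :: "nat \<Rightarrow> complex fps" where
  "bessel_fps \<alpha> = Abs_fps (\<lambda>k. 1 / (fact k * fact (k + \<alpha>)))"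

definition bessel_fun :: "nat \<Rightarrow> complex \<Rightarrow> complex" where
  "bessel_fun \<alpha> = eval_fps (bessel_fps \<alpha>)"

lemma summable_bessel: "summable (\<lambda>k. norm (1 / (fact k * fact (k + \<alpha>)) * w ^ k :: complex))"
proof (rule summable_comparison_test')
  show "summable (\<lambda>k. norm w ^ k / fact k)"
    using summable_exp[of "norm w"] by (simp add: field_simps)
  fix k :: nat
  have "norm w ^ k / (fact k * fact (k + \<alpha>)) \<le> norm w ^ k / (fact k * 1)"
    by (intro divide_left_mono mult_left_mono) auto
  then show "norm (norm (1 / (fact k * fact (k + \<alpha>)) * w ^ k)) \<le> norm w ^ k / fact k"
    by (simp add: norm_mult norm_divide norm_power)
qed

lemma conv_radius_bessel: "fps_conv_radius (bessel_fps \<alpha>) = \<infinity>"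
  unfolding fps_conv_radius_def bessel_fps_def fps_nth_Abs_fps
  by (intro conv_radius_inftyI'' summable_norm_cancel[OF summable_bessel])

lemma bessel_fun_sums: "(\<lambda>k. 1 / (fact k * fact (k + \<alpha>)) * w ^ k) sums bessel_fun \<alpha> w"
  using summable_norm_cancel[OF summable_bessel, of \<alpha> w]
  by (simp add: bessel_fun_def eval_fps_def bessel_fps_def summable_sums)

definition corr_gf :: "real \<Rightarrow> nat \<Rightarrow> real \<Rightarrow> real \<Rightarrow> complex \<Rightarrow> complex" where
  "corr_gf \<beta> \<alpha> s p z = exp (of_real \<beta> * z) * (exp (- of_real s * (z * inverse (1 - z))) *
     (bessel_fun \<alpha> (of_real p * z * inverse (1 - z) ^ 2) * inverse (1 - z) ^ (\<alpha> + 3)))"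

lemma holomorphic_corr_gf: "corr_gf \<beta> \<alpha> s p holomorphic_on ball 0 1"
proof -
  have b: "bessel_fun \<alpha> holomorphic_on A" for A
    unfolding bessel_fun_def by (rule holomorphic_on_eval_fps) (auto simp: conv_radius_bessel)
  have "(bessel_fun \<alpha> \<circ> (\<lambda>z. of_real p * z * inverse (1 - z) ^ 2)) holomorphic_on ball 0 1"
    by (rule holomorphic_on_compose[OF _ b]) (auto intro!: holomorphic_intros)
  then show ?thesis
    unfolding corr_gf_def o_def by (intro holomorphic_intros) auto
qed

text \<open>The summation indices r, k and j belong to the exponential in s, to the Bessel series
  and to the exponential in \<beta>. The powers of 1 / (1 - z) add up to \<alpha> + 3 + 2 k + r, and
  the negative binomial series at order m - j - k - r produces the binomial of the closed
  form.\<close>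

lemma corr_gf_coeff:
  "(deriv ^^ m) (corr_gf \<beta> \<alpha> s p) 0 / fact m = of_real (corr_poly \<beta> (m + \<alpha>) m s p / (fact (m + \<alpha>) * fact m))"
proof -
  let ?W = "inverse (1 - fps_X) :: complex fps"
  let ?U = "fps_X * ?W" and ?V = "fps_const (of_real p) * fps_X * ?W ^ 2"
  let ?A = "fps_exp (- of_real s) :: complex fps" and ?B = "bessel_fps \<alpha>" and ?E = "fps_exp (of_real \<beta>) :: complex fps"
  define F where "F = ?E * ((?A oo ?U) * ((?B oo ?V) * ?W ^ (\<alpha> + 3)))"
  have X: "(\<lambda>z. inverse (1 - z)) has_fps_expansion ?W"
    by (intro has_fps_expansion_inverse has_fps_expansion_diff has_fps_expansion_1 has_fps_expansion_fps_X) simp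
  have U: "(\<lambda>z. z * inverse (1 - z)) has_fps_expansion ?U"
    by (intro has_fps_expansion_mult has_fps_expansion_fps_X X)
  have V: "(\<lambda>z. of_real p * z * inverse (1 - z) ^ 2) has_fps_expansion ?V"
    by (intro has_fps_expansion_mult has_fps_expansion_fps_X has_fps_expansion_const has_fps_expansion_power X)
  have "((\<lambda>z. exp (- of_real s * z)) \<circ> (\<lambda>z. z * inverse (1 - z))) has_fps_expansion (?A oo ?U)"
    by (rule has_fps_expansion_compose[OF has_fps_expansion_exp U]) simp
  moreover have "(bessel_fun \<alpha> \<circ> (\<lambda>z. of_real p * z * inverse (1 - z) ^ 2)) has_fps_expansion (?B oo ?V)"
    unfolding bessel_fun_def
    by (rule has_fps_expansion_compose[OF eval_fps_has_fps_expansion V]) (simp_all add: conv_radius_bessel)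
  ultimately have "corr_gf \<beta> \<alpha> s p has_fps_expansion F"
    unfolding corr_gf_def F_def o_def
    by (intro has_fps_expansion_mult has_fps_expansion_exp has_fps_expansion_power X)
  then have "(deriv ^^ m) (corr_gf \<beta> \<alpha> s p) 0 / fact m = fps_nth F m"
    by (simp add: fps_nth_fps_expansion)
  also have "F = (?A oo ?U) * ((?B oo ?V) * (?W ^ (\<alpha> + 3) * ?E))"
    by (simp add: F_def mult_ac)
  also have "fps_nth \<dots> m = (\<Sum>r\<le>m. fps_nth ?A r * fps_nth ((?B oo ?V) * (?U ^ r * (?W ^ (\<alpha> + 3) * ?E))) m)"
    by (subst fps_nth_compose_mult) (simp_all add: mult_ac)
  also have "\<dots> = (\<Sum>r\<le>m. fps_nth ?A r * (\<Sum>k\<le>m. fps_nth ?B k * fps_nth (?V ^ k * (?U ^ r * (?W ^ (\<alpha> + 3) * ?E))) m))"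
    by (subst fps_nth_compose_mult) simp_all
  also have "\<dots> = (\<Sum>k\<le>m. \<Sum>r\<le>m. fps_nth ?A r * fps_nth ?B k * fps_nth (?V ^ k * (?U ^ r * (?W ^ (\<alpha> + 3) * ?E))) m)"
    unfolding sum_distrib_left by (subst sum.swap) (simp add: mult.assoc)
  also have "\<dots> = (\<Sum>k\<le>m. \<Sum>r\<le>m. \<Sum>j\<le>m. if k + r + j \<le> m then
      of_real (\<beta> ^ j / fact j * ((-1) ^ r / fact r) * (1 / (fact k * fact (k + \<alpha>)))
        * real ((m + \<alpha> - j + 2 + k) choose (m - j - k - r)) * s ^ r * p ^ k) else 0)"
  proof (intro sum.cong refl)
    fix k r
    have "?V ^ k * (?U ^ r * (?W ^ (\<alpha> + 3) * ?E)) = fps_const (of_real p ^ k) * (fps_X ^ (k + r) * (?W ^ Suc (\<alpha> + 2 + 2 * k + r) * ?E))"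
      by (simp add: power_mult_distrib power_add mult_ac fps_const_power eval_nat_numeral flip: power_mult)
    note A = this
    have "fps_nth (?V ^ k * (?U ^ r * (?W ^ (\<alpha> + 3) * ?E))) m =
       of_real p ^ k * (if m < k + r then 0 else fps_nth (?E * ?W ^ Suc (\<alpha> + 2 + 2 * k + r)) (m - (k + r)))"
      by (subst A, subst mult.commute[of ?E]) (simp add: fps_X_power_mult_nth del: power_Suc)
    also have "\<dots> = of_real p ^ k * (\<Sum>j\<le>m. if k + r + j \<le> m then of_real (\<beta> ^ j / fact j) * of_nat ((m + \<alpha> - j + 2 + k) choose (m - j - k - r)) else 0)"
    proof (cases "k + r \<le> m")
      case True
      have "fps_nth (?E * ?W ^ Suc (\<alpha> + 2 + 2 * k + r)) (m - (k + r)) =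
        (\<Sum>j=0..m - (k + r). of_real (\<beta> ^ j / fact j) * of_nat ((m + \<alpha> - j + 2 + k) choose (m - j - k - r)))"
        unfolding fps_mult_nth fps_nth_inverse_one_minus_X_power
      proof (intro sum.cong refl arg_cong2[where f = "(*)"])
        fix j assume "j \<in> {0..m - (k + r)}"
        then have "m - (k + r) - j + (\<alpha> + 2 + 2 * k + r) = m + \<alpha> - j + 2 + k" "m - (k + r) - j = m - j - k - r"
          using True by auto
        then show "of_nat (m - (k + r) - j + (\<alpha> + 2 + 2 * k + r) choose (m - (k + r) - j)) = (of_nat (m + \<alpha> - j + 2 + k choose (m - j - k - r)) :: complex)"
          by (simp only:)
      qed simp
      also have "\<dots> = (\<Sum>j\<le>m. if k + r + j \<le> m then of_real (\<beta> ^ j / fact j) * of_nat ((m + \<alpha> - j + 2 + k) choose (m - j - k - r)) else 0)"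
        using True by (intro sum.mono_neutral_cong_left) auto
      finally show ?thesis using True by simp
    qed (auto intro!: sum.neutral[symmetric])
    finally have 1: "fps_nth (?V ^ k * (?U ^ r * (?W ^ (\<alpha> + 3) * ?E))) m =
       of_real p ^ k * (\<Sum>j\<le>m. if k + r + j \<le> m then of_real (\<beta> ^ j / fact j) * of_nat ((m + \<alpha> - j + 2 + k) choose (m - j - k - r)) else 0)" .
    have 2: "fps_nth ?A r * fps_nth ?B k * of_real p ^ k = of_real (((-1) ^ r / fact r) * (1 / (fact k * fact (k + \<alpha>))) * s ^ r * p ^ k)"
      by (simp add: bessel_fps_def power_minus[of "complex_of_real s"])
    show "fps_nth ?A r * fps_nth ?B k * fps_nth (?V ^ k * (?U ^ r * (?W ^ (\<alpha> + 3) * ?E))) m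
      = (\<Sum>j\<le>m. if k + r + j \<le> m then
      of_real (\<beta> ^ j / fact j * ((-1) ^ r / fact r) * (1 / (fact k * fact (k + \<alpha>)))
        * real ((m + \<alpha> - j + 2 + k) choose (m - j - k - r)) * s ^ r * p ^ k) else 0)"
      unfolding 1 unfolding mult.assoc[symmetric] 2 sum_distrib_left by (intro sum.cong refl) (simp add: mult_ac)
  qed
  also have "\<dots> = of_real (corr_poly \<beta> (m + \<alpha>) m s p / (fact (m + \<alpha>) * fact m))"
  proof -
    have "corr_poly \<beta> (m + \<alpha>) m s p / (fact (m + \<alpha>) * fact m)
      = (\<Sum>k\<le>m. \<Sum>r\<le>m. corr_coeff \<beta> (m + \<alpha>) m k r / (fact (m + \<alpha>) * fact m) * s ^ r * p ^ k)"
      by (simp add: corr_poly_def sum_divide_distrib)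
    also have "\<dots> = (\<Sum>k\<le>m. \<Sum>r\<le>m. \<Sum>j\<le>m. if k + r + j \<le> m then
      \<beta> ^ j / fact j * ((-1) ^ r / fact r) * (1 / (fact k * fact (k + \<alpha>)))
        * real ((m + \<alpha> - j + 2 + k) choose (m - j - k - r)) * s ^ r * p ^ k else 0)"
      by (subst corr_coeff_divide_fact, simp, unfold sum_distrib_right, intro sum.cong refl) simp
    finally show ?thesis by (simp add: if_distrib[of complex_of_real] cong: if_cong)
  qed
  finally show ?thesis .
qed

section \<open>Fourier coefficients of power series on a circle\<close>

lemma integral_cis:
  "(\<integral>\<theta>. indicator {-pi..pi} \<theta> *\<^sub>R cis (real_of_int k * \<theta>) \<partial>lborel) = (if k = 0 then 2 * of_real pi else 0)"
proof (cases "k = 0")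
  case True
  have "(\<integral>\<theta>. indicator {-pi..pi} \<theta> *\<^sub>R (1::complex) \<partial>lborel) = of_real pi - of_real (- pi)"
    by (rule integral_FTC_Icc) (auto intro!: derivative_eq_intros continuous_intros simp: has_vector_derivative_of_real)
  then show ?thesis using True by simp
next
  case False
  have "(\<integral>\<theta>. indicator {-pi..pi} \<theta> *\<^sub>R cis (real_of_int k * \<theta>) \<partial>lborel)
      = cis (real_of_int k * pi) / (\<i> * of_int k) - cis (real_of_int k * (- pi)) / (\<i> * of_int k)"
  proof (rule integral_FTC_Icc)
    fix x
    show "((\<lambda>\<theta>. cis (real_of_int k * \<theta>) / (\<i> * of_int k)) has_vector_derivative cis (real_of_int k * x)) (at x within {-pi..pi})"
      using False unfolding cis_conv_exp
      by (auto intro!: derivative_eq_intros has_vector_derivative_real_field simp: field_simps)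
  qed (auto intro!: continuous_intros)
  also have "\<dots> = 0"
    using False by (simp add: cis.ctr complex_eq_iff field_simps)
  finally show ?thesis using False by simp
qed

lemma fourier_coefficient:
  fixes a :: "nat \<Rightarrow> complex"
  assumes "summable (\<lambda>k. norm (a k) * \<rho> ^ k)" "\<rho> \<ge> 0" "\<And>\<theta>. (\<lambda>k. a k * (of_real \<rho> * cis \<theta>) ^ k) sums f \<theta>"
  shows "(\<integral>\<theta>. indicator {-pi..pi} \<theta> *\<^sub>R (f \<theta> * cis (- (real m * \<theta>))) \<partial>lborel) = 2 * of_real pi * a m * of_real \<rho> ^ m"
proof -
  let ?g = "\<lambda>k \<theta>. indicator {-pi..pi} \<theta> *\<^sub>R (a k * (of_real \<rho> * cis \<theta>) ^ k * cis (- (real m * \<theta>)))"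
  have g: "?g k \<theta> = (a k * of_real \<rho> ^ k) * (indicator {-pi..pi} \<theta> *\<^sub>R cis (real_of_int (int k - int m) * \<theta>))" for k \<theta>
  proof -
    have "cis \<theta> ^ k * cis (- (real m * \<theta>)) = cis (real_of_int (int k - int m) * \<theta>)"
      by (simp only: Complex.DeMoivre cis_mult) (simp add: algebra_simps)
    then show ?thesis by (simp add: power_mult_distrib mult.assoc)
  qed
  have int: "integrable lborel (\<lambda>\<theta>. indicator {-pi..pi} \<theta> *\<^sub>R cis (real_of_int i * \<theta>))" for i
    by (rule borel_integrable_compact[of "{-pi..pi}", unfolded set_integrable_def]) (auto intro!: continuous_intros)
  have "(\<lambda>k. \<integral>\<theta>. ?g k \<theta> \<partial>lborel) sums (\<integral>\<theta>. (\<Sum>k. ?g k \<theta>) \<partial>lborel)"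
  proof (rule sums_integral)
    show "integrable lborel (?g k)" for k
      unfolding g by (intro integrable_mult_right int)
    have n: "norm (?g k \<theta>) = indicator {-pi..pi} \<theta> * (norm (a k) * \<rho> ^ k)" for k \<theta>
      using assms(2) by (simp add: norm_mult norm_power)
    show "AE \<theta> in lborel. summable (\<lambda>k. norm (?g k \<theta>))"
      unfolding n by (intro AE_I2 summable_mult assms)
    show "summable (\<lambda>k. \<integral>\<theta>. norm (?g k \<theta>) \<partial>lborel)"
      unfolding n by (simp add: summable_mult assms)
  qed
  moreover have "(\<integral>\<theta>. ?g k \<theta> \<partial>lborel) = (if k = m then 2 * of_real pi * a m * of_real \<rho> ^ m else 0)" for k
    unfolding g integral_mult_right_zero integral_cis by simp
  moreover have "(\<Sum>k. ?g k \<theta>) = indicator {-pi..pi} \<theta> *\<^sub>R (f \<theta> * cis (- (real m * \<theta>)))" for \<theta>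
    by (intro sums_unique[symmetric] sums_scaleR_right sums_mult2 assms)
  ultimately have "(\<lambda>k. if k = m then 2 * of_real pi * a m * of_real \<rho> ^ m else 0) sums
      (\<integral>\<theta>. indicator {-pi..pi} \<theta> *\<^sub>R (f \<theta> * cis (- (real m * \<theta>))) \<partial>lborel)"
    by simp
  from sums_unique2[OF this sums_single[of m "\<lambda>_. 2 * of_real pi * a m * of_real \<rho> ^ m"]] show ?thesis by simp
qed

subsection \<open>Integral representation\<close>

lemma integrable_Icc_continuous:
  fixes f :: "real \<Rightarrow> complex"
  assumes "continuous_on {a..b} f"
  shows "integrable lborel (\<lambda>x. indicator {a..b} x *\<^sub>R f x)"
  by (rule borel_integrable_compact[of "{a..b}", unfolded set_integrable_def]) (use assms in auto)

lemma integral_indicator_mult: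
  fixes g :: "'a \<Rightarrow> complex"
  shows "(\<integral>x. indicator A x *\<^sub>R (c * g x) \<partial>M) = c * (\<integral>x. indicator A x *\<^sub>R g x \<partial>M)"
  unfolding integral_mult_right_zero[symmetric] by (intro Bochner_Integration.integral_cong) auto

text \<open>As 2 cos \<phi> = cis \<phi> + cis (-\<phi>), the exponential splits into two. The one
  with cis (-\<phi>) is expanded, and its j-th term selects the Fourier coefficient of order j +
  \<alpha> of the other one, giving w^(2 j + \<alpha>) / (j! (j + \<alpha>)!).\<close>

lemma bessel_integral:
  "(\<integral>\<phi>. indicator {-pi..pi} \<phi> *\<^sub>R (exp (2 * w * of_real (cos \<phi>)) * cis (- (real \<alpha> * \<phi>))) \<partial>lborel)
     = 2 * of_real pi * (w ^ \<alpha> * bessel_fun \<alpha> (w\<^sup>2))"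
proof -
  have exps: "(\<lambda>k. 1 / fact k * z ^ k) sums exp z" for z :: complex
    using exp_converges[of z] by (simp add: scaleR_conv_of_real divide_inverse mult.commute of_real_inverse)
  have inner: "(\<integral>\<phi>. indicator {-pi..pi} \<phi> *\<^sub>R (exp (w * cis \<phi>) * cis (- (real (j + \<alpha>) * \<phi>))) \<partial>lborel)
     = 2 * of_real pi * (w ^ (j + \<alpha>) / fact (j + \<alpha>))" for j
  proof -
    have "summable (\<lambda>k. norm (w ^ k / fact k) * 1 ^ k)"
      using summable_norm_exp[of w] by (simp add: scaleR_conv_of_real norm_mult norm_divide norm_power divide_inverse mult.commute)
    from fourier_coefficient[OF this, of "\<lambda>\<phi>. exp (w * cis \<phi>)" "j + \<alpha>"] show ?thesis
      using exps[of "w * cis _"] by (simp add: power_mult_distrib divide_inverse mult_ac)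
  qed
  let ?g = "\<lambda>j \<phi>. indicator {-pi..pi} \<phi> *\<^sub>R (w ^ j / fact j * (exp (w * cis \<phi>) * cis (- (real (j + \<alpha>) * \<phi>))))"
  have int: "integrable lborel (\<lambda>\<phi>. indicator {-pi..pi} \<phi> *\<^sub>R (exp (w * cis \<phi>) * cis (- (real k * \<phi>))))" for k
    by (intro integrable_Icc_continuous continuous_intros)
  have g: "?g j \<phi> = w ^ j / fact j * (indicator {-pi..pi} \<phi> *\<^sub>R (exp (w * cis \<phi>) * cis (- (real (j + \<alpha>) * \<phi>))))" for j \<phi>
    by simp
  have ng: "norm (?g j \<phi>) = norm w ^ j / fact j * norm (indicator {-pi..pi} \<phi> *\<^sub>R (exp (w * cis \<phi>) * cis (- (real 0 * \<phi>))))" for j \<phi>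
    by (simp add: norm_mult norm_divide norm_power)
  have sw: "summable (\<lambda>j. norm w ^ j / fact j)"
    using summable_exp[of "norm w"] by (simp add: field_simps)
  have "(\<lambda>j. \<integral>\<phi>. ?g j \<phi> \<partial>lborel) sums (\<integral>\<phi>. (\<Sum>j. ?g j \<phi>) \<partial>lborel)"
  proof (rule sums_integral)
    show "integrable lborel (?g j)" for j
      unfolding g by (intro integrable_mult_right int)
    show "AE \<phi> in lborel. summable (\<lambda>j. norm (?g j \<phi>))"
      unfolding ng by (intro AE_I2 summable_mult2 sw)
    show "summable (\<lambda>j. \<integral>\<phi>. norm (?g j \<phi>) \<partial>lborel)"
      unfolding ng integral_mult_right_zero by (intro summable_mult2 sw)
  qed
  moreover have "(\<integral>\<phi>. ?g j \<phi> \<partial>lborel) = 2 * of_real pi * (w ^ \<alpha> * (1 / (fact j * fact (j + \<alpha>)) * (w\<^sup>2) ^ j))" for j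
  proof -
    have "j + (j + \<alpha>) = \<alpha> + 2 * j" by simp
    then have "w ^ j * w ^ (j + \<alpha>) = w ^ \<alpha> * (w\<^sup>2) ^ j"
      by (simp only: power_add[symmetric] power_mult[symmetric])
    then have "w ^ j / fact j * (2 * of_real pi * (w ^ (j + \<alpha>) / fact (j + \<alpha>)))
        = 2 * of_real pi * (w ^ \<alpha> * (w\<^sup>2) ^ j / (fact j * fact (j + \<alpha>)))"
      by (simp only: times_divide_eq_left times_divide_eq_right divide_divide_eq_left mult_ac)
    then show ?thesis
      unfolding g integral_mult_right_zero inner by simp
  qed
  moreover have "(\<Sum>j. ?g j \<phi>) = indicator {-pi..pi} \<phi> *\<^sub>R (exp (2 * w * of_real (cos \<phi>)) * cis (- (real \<alpha> * \<phi>)))" for \<phi>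
  proof -
    have c: "2 * w * of_real (cos \<phi>) = w * cis (- \<phi>) + w * cis \<phi>"
      by (simp add: complex_eq_iff)
    have e: "?g j \<phi> = indicator {-pi..pi} \<phi> *\<^sub>R (1 / fact j * (w * cis (- \<phi>)) ^ j * (exp (w * cis \<phi>) * cis (- (real \<alpha> * \<phi>))))" for j
    proof -
      have "cis (- (real (j + \<alpha>) * \<phi>)) = cis (- \<phi>) ^ j * cis (- (real \<alpha> * \<phi>))"
        by (simp only: Complex.DeMoivre cis_mult) (simp add: algebra_simps)
      then show ?thesis by (simp add: power_mult_distrib)
    qed
    have "(\<lambda>j. ?g j \<phi>) sums (indicator {-pi..pi} \<phi> *\<^sub>R (exp (w * cis (- \<phi>)) * (exp (w * cis \<phi>) * cis (- (real \<alpha> * \<phi>)))))"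
      unfolding e by (intro sums_scaleR_right sums_mult2 exps)
    then show ?thesis unfolding c exp_add by (simp add: sums_iff mult.assoc)
  qed
  ultimately have "(\<lambda>j. 2 * of_real pi * (w ^ \<alpha> * (1 / (fact j * fact (j + \<alpha>)) * (w\<^sup>2) ^ j))) sums
     (\<integral>\<phi>. indicator {-pi..pi} \<phi> *\<^sub>R (exp (2 * w * of_real (cos \<phi>)) * cis (- (real \<alpha> * \<phi>))) \<partial>lborel)"
    by simp
  moreover have "(\<lambda>j. 2 * of_real pi * (w ^ \<alpha> * (1 / (fact j * fact (j + \<alpha>)) * (w\<^sup>2) ^ j))) sums
     (2 * of_real pi * (w ^ \<alpha> * bessel_fun \<alpha> (w\<^sup>2)))"
    by (intro sums_mult bessel_fun_sums)
  ultimately show ?thesis by (rule sums_unique2)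
qed

text \<open>The integrand after the substitution \<open>z = exp(- 2 \<zeta>)\<close>, where \<open>q = \<surd>(\<mu> \<nu>)\<close> and \<open>d = (\<surd>\<mu> - \<surd>\<nu>)\<^sup>2\<close>,
  so that \<open>\<mu> + \<nu> = d + 2 q\<close>.\<close>

definition corr_kernel :: "real \<Rightarrow> nat \<Rightarrow> nat \<Rightarrow> real \<Rightarrow> real \<Rightarrow> complex \<Rightarrow> real \<Rightarrow> complex" where
  "corr_kernel \<beta> \<alpha> M d q \<zeta> \<phi> = exp (of_real \<beta> * exp (- 2 * \<zeta>)) * exp (of_nat M * \<zeta>) / (2 * sinh \<zeta>) ^ 3 *
     exp (- of_real (d / 2) * (cosh \<zeta> / sinh \<zeta>) - of_real q * (sinh (\<zeta> / 2) / cosh (\<zeta> / 2))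
       - of_real (2 * q * (sin (\<phi> / 2))\<^sup>2) / sinh \<zeta>) * cis (- (real \<alpha> * \<phi>))"

lemma norm_sinh_complex: "(norm (sinh z))\<^sup>2 = (sinh (Re z))\<^sup>2 + (sin (Im z))\<^sup>2"
proof -
  have "sinh z = Complex (sinh (Re z) * cos (Im z)) (cosh (Re z) * sin (Im z))"
    by (auto simp: sinh_field_def sinh_def cosh_def complex_eq_iff Re_exp Im_exp field_simps)
  then have "(norm (sinh z))\<^sup>2 = (sinh (Re z))\<^sup>2 * (cos (Im z))\<^sup>2 + (cosh (Re z))\<^sup>2 * (sin (Im z))\<^sup>2"
    by (simp add: cmod_power2 power_mult_distrib)
  also have "\<dots> = (sinh (Re z))\<^sup>2 * ((cos (Im z))\<^sup>2 + (sin (Im z))\<^sup>2) + (sin (Im z))\<^sup>2"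
    by (simp only: cosh_square_eq ring_distribs mult_1_left add_ac)
  finally show ?thesis by (simp only: sin_cos_squared_add2 mult_1_right)
qed

lemma Re_sinh_complex: "Re (sinh z) = sinh (Re z) * cos (Im z)"
  by (simp add: sinh_field_def sinh_def Re_exp field_simps)

lemma sinh_neq_0_complex: "Re z > 0 \<Longrightarrow> sinh z \<noteq> (0::complex)"
  using norm_sinh_complex[of z] by (auto simp: sum_power2_eq_zero_iff)

lemma cosh_half_neq_0: "Re z > 0 \<Longrightarrow> cosh (z / 2) \<noteq> (0::complex)"
  using sinh_neq_0_complex[of z] sinh_double[of "z / 2"] by auto

text \<open>Three facts explain the shape of the kernel: z / (1 - z) + 1/2 = coth \<zeta> / 2, the
  argument of the Bessel function is w^2 with w = q / (2 sinh \<zeta>), and (cosh \<zeta> - 1) /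
  sinh \<zeta> = tanh (\<zeta> / 2). The last one performs the cancellation: subtracting q / sinh
  \<zeta> from q coth \<zeta> leaves tanh, and 1 - cos \<phi> leaves the squared sine. The factor
  w^\<alpha> absorbs \<alpha> of the \<alpha> + 3 powers of 1 / (1 - z).\<close>

lemma corr_gf_kernel_identity:
  fixes \<zeta> :: complex
  assumes "Re \<zeta> > 0" "q > 0"
  shows "of_real (q ^ \<alpha> * exp (- (d + 2 * q) / 2)) * corr_gf \<beta> \<alpha> (d + 2 * q) (q\<^sup>2) (exp (- 2 * \<zeta>)) * exp (of_nat (2 * m) * \<zeta>) =
    1 / (2 * of_real pi) * (\<integral>\<phi>. indicator {-pi..pi} \<phi> *\<^sub>R corr_kernel \<beta> \<alpha> (2 * m + \<alpha> + 3) d q \<zeta> \<phi> \<partial>lborel)"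
proof -
  define z where "z = exp (- 2 * \<zeta>)"
  define w where "w = of_real q / (2 * sinh \<zeta>)"
  define e where "e = exp (- \<zeta>)"
  have s0: "sinh \<zeta> \<noteq> 0" using assms by (intro sinh_neq_0_complex)
  have ch0: "cosh (\<zeta> / 2) \<noteq> 0" using assms by (intro cosh_half_neq_0)
  have z: "z = e\<^sup>2" unfolding z_def e_def by (simp flip: exp_of_nat_mult)
  have e0: "e \<noteq> 0" by (simp add: e_def)
  have inv: "exp \<zeta> = 1 / e" by (simp add: e_def exp_minus field_simps)
  have sh: "2 * sinh \<zeta> = 1 / e - e"
    unfolding sinh_field_def inv e_def by (simp add: exp_minus)
  have chz: "2 * cosh \<zeta> = 1 / e + e"
    unfolding cosh_field_def inv e_def by (simp add: exp_minus)
  have z1: "1 - z = e * (2 * sinh \<zeta>)"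
    unfolding sh z using e0 by (simp add: field_simps power2_eq_square)
  have z1n: "1 - z \<noteq> 0" using z1 s0 e0 by simp
  have arg: "of_real (q\<^sup>2) * z * inverse (1 - z) ^ 2 = w\<^sup>2"
    unfolding z1 w_def unfolding z using e0 s0 by (simp add: field_simps)
  have coth: "z * inverse (1 - z) + 1 / 2 = cosh \<zeta> / (2 * sinh \<zeta>)"
  proof -
    have "z * inverse (1 - z) + 1 / 2 = (1 + z) / (2 * (1 - z))"
    proof -
      have "(1 - t) * inverse t + 1 / 2 = (2 - t) / (2 * t)" if "t \<noteq> 0" for t :: complex
        using that by (simp add: field_simps)
      from this[of "1 - z"] z1n show ?thesis by simp
    qed
    also have "1 + z = e * (2 * cosh \<zeta>)"
      unfolding chz z using e0 by (simp add: field_simps power2_eq_square)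
    also have "e * (2 * cosh \<zeta>) / (2 * (1 - z)) = cosh \<zeta> / (2 * sinh \<zeta>)"
      unfolding z1 using e0 s0 by (simp add: field_simps)
    finally show ?thesis .
  qed
  have pw: "of_real q ^ \<alpha> * inverse (1 - z) ^ (\<alpha> + 3) * exp (of_nat (2 * m) * \<zeta>)
     = w ^ \<alpha> * (exp (of_nat (2 * m + \<alpha> + 3) * \<zeta>) / (2 * sinh \<zeta>) ^ 3)"
  proof -
    have "exp (of_nat (2 * m + \<alpha> + 3) * \<zeta>) = exp (of_nat (2 * m) * \<zeta>) * (1 / e) ^ (\<alpha> + 3)"
      unfolding inv[symmetric] by (simp flip: exp_of_nat_mult exp_add add: algebra_simps)
    then show ?thesis
      unfolding z1 w_def by (simp add: power_add power_mult_distrib power_divide inverse_eq_divide)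
  qed
  have half: "(cosh \<zeta> - 1) / sinh \<zeta> = sinh (\<zeta> / 2) / cosh (\<zeta> / 2)"
  proof -
    have "cosh \<zeta> - 1 = 2 * sinh (\<zeta> / 2) ^ 2"
      using cosh_double[of "\<zeta> / 2"] cosh_square_eq[of "\<zeta> / 2"] by simp
    moreover have "sinh \<zeta> = 2 * sinh (\<zeta> / 2) * cosh (\<zeta> / 2)"
      using sinh_double[of "\<zeta> / 2"] by simp
    ultimately show ?thesis using s0 ch0 by (simp add: power2_eq_square)
  qed
  have kernel: "corr_kernel \<beta> \<alpha> (2 * m + \<alpha> + 3) d q \<zeta> \<phi> =
      exp (of_real \<beta> * z) * (exp (of_nat (2 * m + \<alpha> + 3) * \<zeta>) / (2 * sinh \<zeta>) ^ 3) * exp (- of_real (d + 2 * q) * (cosh \<zeta> / (2 * sinh \<zeta>)))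
        * (exp (2 * w * of_real (cos \<phi>)) * cis (- (real \<alpha> * \<phi>)))" for \<phi>
  proof -
    have "2 * (sin (\<phi> / 2))\<^sup>2 = 1 - cos \<phi>"
      using cos_double_sin[of "\<phi> / 2"] by simp
    then have c: "2 * q * (sin (\<phi> / 2))\<^sup>2 = q * (1 - cos \<phi>)" by (metis mult.assoc mult.commute)
    have "- of_real (d / 2) * (cosh \<zeta> / sinh \<zeta>) - of_real q * (sinh (\<zeta> / 2) / cosh (\<zeta> / 2))
       - of_real (2 * q * (sin (\<phi> / 2))\<^sup>2) / sinh \<zeta>
      = - of_real (d + 2 * q) * (cosh \<zeta> / (2 * sinh \<zeta>)) + 2 * w * of_real (cos \<phi>)"
      unfolding half[symmetric] c w_def using s0 by (simp add: field_simps)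
    then show ?thesis unfolding corr_kernel_def z_def by (simp add: exp_add mult_ac)
  qed
  have "1 / (2 * of_real pi) * (\<integral>\<phi>. indicator {-pi..pi} \<phi> *\<^sub>R corr_kernel \<beta> \<alpha> (2 * m + \<alpha> + 3) d q \<zeta> \<phi> \<partial>lborel)
     = exp (of_real \<beta> * z) * (exp (of_nat (2 * m + \<alpha> + 3) * \<zeta>) / (2 * sinh \<zeta>) ^ 3) * exp (- of_real (d + 2 * q) * (cosh \<zeta> / (2 * sinh \<zeta>)))
        * (w ^ \<alpha> * bessel_fun \<alpha> (w\<^sup>2))"
    unfolding kernel integral_indicator_mult bessel_integral by simp
  also have "\<dots> = exp (of_real \<beta> * z) * exp (- of_real (d + 2 * q) * (z * inverse (1 - z) + 1 / 2))
     * bessel_fun \<alpha> (w\<^sup>2) * (w ^ \<alpha> * (exp (of_nat (2 * m + \<alpha> + 3) * \<zeta>) / (2 * sinh \<zeta>) ^ 3))"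
    unfolding coth by (simp only: mult_ac)
  also have "\<dots> = exp (of_real \<beta> * z) * (exp (- of_real (d + 2 * q) * (z * inverse (1 - z))) * of_real (exp (- (d + 2 * q) / 2)))
     * bessel_fun \<alpha> (w\<^sup>2) * (of_real q ^ \<alpha> * inverse (1 - z) ^ (\<alpha> + 3) * exp (of_nat (2 * m) * \<zeta>))"
  proof -
    have t: "of_real (- (d + 2 * q) / 2) = - complex_of_real (d + 2 * q) * (1 / 2)" by simp
    have "exp (- of_real (d + 2 * q) * (z * inverse (1 - z) + 1 / 2))
        = exp (- of_real (d + 2 * q) * (z * inverse (1 - z))) * complex_of_real (exp (- (d + 2 * q) / 2))"
      unfolding exp_of_real[symmetric] exp_add[symmetric] t by (simp only: distrib_left)
    then show ?thesis unfolding pw by (simp only: mult_ac)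
  qed
  finally show ?thesis
    unfolding corr_gf_def z_def[symmetric] arg by (simp add: mult_ac)
qed

lemma corr_poly_integral:
  assumes "n > 0" "q > 0"
  shows "of_real (q ^ \<alpha> * exp (- (d + 2 * q) / 2) * (corr_poly \<beta> (m + \<alpha>) m (d + 2 * q) (q\<^sup>2) / (fact (m + \<alpha>) * fact m)))
   = 1 / (4 * of_real pi ^ 2) * (\<integral>\<theta>. indicator {-pi..pi} \<theta> *\<^sub>R (\<integral>\<phi>. indicator {-pi..pi} \<phi> *\<^sub>R
       corr_kernel \<beta> \<alpha> (2 * m + \<alpha> + 3) d q (Complex (1 / (2 * real n)) (- \<theta> / 2)) \<phi> \<partial>lborel) \<partial>lborel)"
proof -
  let ?F = "corr_gf \<beta> \<alpha> (d + 2 * q) (q\<^sup>2)"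
  define \<rho> where "\<rho> = exp (- 1 / real n)"
  \<comment> \<open>Convergence at the larger radius \<open>r\<close> gives absolute convergence on
    the circle of radius \<open>\<rho>\<close>.\<close>
  define r where "r = exp (- 1 / (2 * real n))"
  define a where "a k = (deriv ^^ k) ?F 0 / fact k" for k
  let ?\<zeta> = "\<lambda>\<theta>. Complex (1 / (2 * real n)) (- \<theta> / 2)"
  have \<rho>: "0 < \<rho>" "\<rho> < r" "r < 1" using assms by (auto simp: \<rho>_def r_def field_simps)
  have ser: "(\<lambda>k. a k * z ^ k) sums ?F z" if "norm z < 1" for z
    using holomorphic_power_series[OF holomorphic_corr_gf[of \<beta> \<alpha> "d + 2 * q" "q\<^sup>2"], of z] that by (simp add: a_def)
  have "summable (\<lambda>k. a k * of_real r ^ k)"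
    using ser[of "of_real r"] \<rho> by (auto simp: sums_iff)
  then have "summable (\<lambda>k. norm (a k * of_real \<rho> ^ k))"
    by (rule powser_insidea) (use \<rho> in simp)
  then have "summable (\<lambda>k. norm (a k) * \<rho> ^ k)"
    using \<rho> by (simp add: norm_mult norm_power)
  then have "(\<integral>\<theta>. indicator {-pi..pi} \<theta> *\<^sub>R (?F (of_real \<rho> * cis \<theta>) * cis (- (real m * \<theta>))) \<partial>lborel) = 2 * of_real pi * a m * of_real \<rho> ^ m"
    by (rule fourier_coefficient) (use \<rho> in \<open>auto intro!: ser simp: norm_mult\<close>)
  then have "a m = 1 / (2 * of_real pi) * (\<integral>\<theta>. indicator {-pi..pi} \<theta> *\<^sub>R (?F (of_real \<rho> * cis \<theta>) * cis (- (real m * \<theta>))) \<partial>lborel) / of_real \<rho> ^ m"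
    using \<rho> by (simp add: field_simps)
  also have "\<dots> = 1 / (2 * of_real pi) * (\<integral>\<theta>. indicator {-pi..pi} \<theta> *\<^sub>R (?F (exp (- 2 * ?\<zeta> \<theta>)) * exp (of_nat (2 * m) * ?\<zeta> \<theta>)) \<partial>lborel)"
  proof -
    have z: "of_real \<rho> * cis \<theta> = exp (- 2 * ?\<zeta> \<theta>)" for \<theta>
    proof -
      have "- 2 * ?\<zeta> \<theta> = of_real (- 1 / real n) + \<i> * of_real \<theta>"
        by (simp add: complex_eq_iff)
      then show ?thesis unfolding \<rho>_def cis_conv_exp by (simp only: exp_add exp_of_real)
    qed
    have p: "cis (- (real m * \<theta>)) / of_real \<rho> ^ m = exp (of_nat (2 * m) * ?\<zeta> \<theta>)" for \<theta>
    proof -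
      have "cis (- (real m * \<theta>)) / of_real \<rho> ^ m = 1 / (of_real \<rho> * cis \<theta>) ^ m"
      proof -
        have "cis (- (real m * \<theta>)) = inverse (cis \<theta> ^ m)" by (simp add: Complex.DeMoivre)
        then show ?thesis by (simp only: power_mult_distrib inverse_mult_distrib divide_inverse mult_1_left mult.commute)
      qed
      also have "\<dots> = exp (2 * ?\<zeta> \<theta>) ^ m" unfolding z by (simp add: exp_minus field_simps)
      also have "\<dots> = exp (of_nat (2 * m) * ?\<zeta> \<theta>)" by (simp flip: exp_of_nat_mult add: mult_ac)
      finally show ?thesis .
    qed
    show ?thesis
      unfolding p[symmetric] z[symmetric] times_divide_eq_right[symmetric] integral_divide_zero[symmetric]
      by (simp add: scaleR_conv_of_real)
  qed
  finally have a: "a m = 1 / (2 * of_real pi) * (\<integral>\<theta>. indicator {-pi..pi} \<theta> *\<^sub>R (?F (exp (- 2 * ?\<zeta> \<theta>)) * exp (of_nat (2 * m) * ?\<zeta> \<theta>)) \<partial>lborel)" .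
  have "of_real (q ^ \<alpha> * exp (- (d + 2 * q) / 2) * (corr_poly \<beta> (m + \<alpha>) m (d + 2 * q) (q\<^sup>2) / (fact (m + \<alpha>) * fact m)))
     = of_real (q ^ \<alpha> * exp (- (d + 2 * q) / 2)) * a m"
    unfolding a_def corr_gf_coeff by simp
  also have "\<dots> = 1 / (2 * of_real pi) * (\<integral>\<theta>. indicator {-pi..pi} \<theta> *\<^sub>R (of_real (q ^ \<alpha> * exp (- (d + 2 * q) / 2)) *
      ?F (exp (- 2 * ?\<zeta> \<theta>)) * exp (of_nat (2 * m) * ?\<zeta> \<theta>)) \<partial>lborel)"
    unfolding a mult.assoc integral_indicator_mult by (rule mult.left_commute)
  also have "\<dots> = 1 / (2 * of_real pi) * (\<integral>\<theta>. indicator {-pi..pi} \<theta> *\<^sub>R (1 / (2 * of_real pi) * (\<integral>\<phi>. indicator {-pi..pi} \<phi> *\<^sub>R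
       corr_kernel \<beta> \<alpha> (2 * m + \<alpha> + 3) d q (?\<zeta> \<theta>) \<phi> \<partial>lborel)) \<partial>lborel)"
    using assms by (subst corr_gf_kernel_identity) auto
  also have "\<dots> = 1 / (4 * of_real pi ^ 2) * (\<integral>\<theta>. indicator {-pi..pi} \<theta> *\<^sub>R (\<integral>\<phi>. indicator {-pi..pi} \<phi> *\<^sub>R
       corr_kernel \<beta> \<alpha> (2 * m + \<alpha> + 3) d q (?\<zeta> \<theta>) \<phi> \<partial>lborel) \<partial>lborel)"
    unfolding integral_indicator_mult by (simp add: power2_eq_square)
  finally show ?thesis .
qed

subsection \<open>Dominated convergence\<close>

lemma half_le_sin:
  fixes t :: real
  assumes "0 \<le> t" "t \<le> pi / 2"
  shows "t / 2 \<le> sin t"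
proof (cases "t = 0")
  case False
  then have t: "0 < t / 2" using assms by simp
  \<comment> \<open>The double angle formula writes sin t as 2 sin (t / 2) cos (t / 2); together
    with the mean value theorem this leaves t times two cosines at points of [0, pi / 4], each at
    least 1 / sqrt 2.\<close>
  obtain c where c: "0 < c" "c < t / 2" "sin (t / 2) - sin 0 = (t / 2 - 0) * cos c"
    using MVT2[OF t, of sin cos] by (auto intro: DERIV_sin)
  have s: "1 / sqrt 2 \<le> cos x" if "0 \<le> x" "x \<le> t / 2" for x
  proof -
    have "cos (pi / 4) \<le> cos x" using that assms by (intro cos_monotone_0_pi_le) auto
    moreover have "1 / sqrt 2 = sqrt 2 / (2::real)" by (simp add: field_simps)
    ultimately show ?thesis by (simp add: cos_45)
  qed
  have "t * (1 / 2) = t * ((1 / sqrt 2) * (1 / sqrt 2))" by simp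
  also have "\<dots> \<le> t * (cos c * cos (t / 2))"
    using c t assms s[of c] s[of "t / 2"] by (intro mult_left_mono mult_mono) (auto intro: order_trans[OF _ s])
  also have "\<dots> = 2 * sin (t / 2) * cos (t / 2)" using c by simp
  also have "\<dots> = sin t" using sin_double[of "t / 2"] by simp
  finally show ?thesis by simp
qed simp

lemma sin_square_ge:
  fixes t :: real
  assumes "\<bar>t\<bar> \<le> pi / 2"
  shows "t\<^sup>2 / 4 \<le> (sin t)\<^sup>2"
proof -
  have "(\<bar>t\<bar> / 2)\<^sup>2 \<le> (sin \<bar>t\<bar>)\<^sup>2"
    using half_le_sin[of "\<bar>t\<bar>"] assms by (intro power_mono) auto
  moreover have "(sin \<bar>t\<bar>)\<^sup>2 = (sin t)\<^sup>2" by (cases "t \<ge> 0") auto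
  ultimately show ?thesis by (simp add: power_divide)
qed

lemma le_sinh:
  fixes a :: real
  assumes "0 \<le> a"
  shows "a \<le> sinh a"
proof -
  have "sinh 0 - 0 \<le> sinh a - a"
    by (rule DERIV_nonneg_imp_nondecreasing[of 0 a "\<lambda>x. sinh x - x"])
      (use assms cosh_real_ge_1 in \<open>auto intro!: derivative_eq_intros exI\<close>)
  then show ?thesis by simp
qed

lemma sinh_le_double:
  fixes a :: real
  assumes "0 \<le> a" "a \<le> 1"
  shows "sinh a \<le> 2 * a"
proof -
  have "exp a \<le> 1 + a + a\<^sup>2" "1 + - a \<le> exp (- a)"
    using exp_bound[of a] exp_ge_add_one_self[of "- a"] assms by auto
  moreover have "a\<^sup>2 \<le> a" using assms by (simp add: power2_eq_square mult_left_le)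
  ultimately have "exp a - exp (- a) \<le> 4 * a" using assms by linarith
  then show ?thesis by (simp add: sinh_field_def)
qed

lemma integrable_inverse_one_plus_square: "integrable lborel (\<lambda>u::real. 1 / (1 + u\<^sup>2))"
proof -
  have "set_integrable lborel (einterval (-\<infinity>) \<infinity>) (\<lambda>u::real. 1 / (1 + u\<^sup>2))"
  proof (rule interval_integral_FTC_nonneg(1)[of _ _ arctan _ "- (pi / 2)" "pi / 2"])
    show "((arctan \<circ> real_of_ereal) \<longlongrightarrow> - (pi / 2)) (at_right (-\<infinity>))"
      using tendsto_arctan_at_bot by (simp add: ereal_tendsto_simps)
    show "((arctan \<circ> real_of_ereal) \<longlongrightarrow> pi / 2) (at_left \<infinity>)"
      using tendsto_arctan_at_top by (simp add: ereal_tendsto_simps)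
    show "DERIV arctan x :> 1 / (1 + x\<^sup>2)" for x
      using DERIV_arctan[of x] by (simp add: inverse_eq_divide)
    show "isCont (\<lambda>u. 1 / (1 + u\<^sup>2)) x" for x :: real
      using add_pos_nonneg[of 1 "x\<^sup>2"] by (intro continuous_intros) simp
  qed auto
  then show ?thesis by (simp add: set_integrable_def einterval_eq_UNIV)
qed

lemma integral_gaussian:
  assumes "c > 0"
  shows "integrable lborel (\<lambda>v::real. exp (- c * v\<^sup>2))" "(\<integral>v. exp (- c * v\<^sup>2) \<partial>lborel) = sqrt (pi / c)"
proof -
  define \<sigma> where "\<sigma> = 1 / sqrt (2 * c)"
  have \<sigma>: "\<sigma> > 0" "\<sigma>\<^sup>2 = 1 / (2 * c)" using assms by (auto simp: \<sigma>_def power_divide)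
  have e: "exp (- c * v\<^sup>2) = sqrt (pi / c) * normal_density 0 \<sigma> v" for v
    using assms by (simp add: normal_density_def \<sigma>(2))
  show "integrable lborel (\<lambda>v::real. exp (- c * v\<^sup>2))"
    unfolding e using \<sigma> by (intro integrable_mult_right integrable_normal_density)
  show "(\<integral>v. exp (- c * v\<^sup>2) \<partial>lborel) = sqrt (pi / c)"
    unfolding e integral_mult_right_zero using \<sigma> by simp
qed

text \<open>The pair consists of the rescaled angles u and v. The power -3/2 of 1 + u^2 is the
  modulus of p^-3 for p = 1 - i u, and the Gaussian in v has rate c Re (1 / p). Integration over v
  costs a factor sqrt (1 + u^2) and leaves the integrable 1 / (1 + u^2).\<close>

definition kernel_bound :: "real \<Rightarrow> real \<times> real \<Rightarrow> real" where
  "kernel_bound c p = 1 / sqrt (1 + (fst p)\<^sup>2) ^ 3 * exp (- (c / (1 + (fst p)\<^sup>2)) * (snd p)\<^sup>2)"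

lemma integrable_kernel_bound:
  assumes "c > 0"
  shows "integrable (lborel \<Otimes>\<^sub>M lborel) (kernel_bound c)"
proof (rule lborel_pair.Fubini_integrable)
  have pos: "1 + u\<^sup>2 > 0" for u :: real by (simp add: add_pos_nonneg)
  show "kernel_bound c \<in> borel_measurable (lborel \<Otimes>\<^sub>M lborel)"
    unfolding kernel_bound_def by measurable
  have inner: "integrable lborel (\<lambda>v. kernel_bound c (u, v))" for u
    unfolding kernel_bound_def using integral_gaussian(1)[of "c / (1 + u\<^sup>2)"] assms pos[of u] by simp
  then show "AE u in lborel. integrable lborel (\<lambda>v. kernel_bound c (u, v))" by simp
  have "(\<integral>v. norm (kernel_bound c (u, v)) \<partial>lborel) = sqrt (pi / c) * (1 / (1 + u\<^sup>2))" for u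
  proof -
    have "(\<integral>v. norm (kernel_bound c (u, v)) \<partial>lborel) = 1 / sqrt (1 + u\<^sup>2) ^ 3 * (\<integral>v. exp (- (c / (1 + u\<^sup>2)) * v\<^sup>2) \<partial>lborel)"
      unfolding kernel_bound_def using pos[of u] by (simp add: abs_mult)
    also have "\<dots> = 1 / sqrt (1 + u\<^sup>2) ^ 3 * sqrt (pi / (c / (1 + u\<^sup>2)))"
      using assms pos[of u] by (subst integral_gaussian(2)) auto
    also have "\<dots> = sqrt (pi / c) * (sqrt (1 + u\<^sup>2) / sqrt (1 + u\<^sup>2) ^ 3)"
      by (simp add: real_sqrt_mult real_sqrt_divide)
    also have "sqrt (1 + u\<^sup>2) / sqrt (1 + u\<^sup>2) ^ 3 = 1 / (1 + u\<^sup>2)"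
    proof -
      define t where "t = sqrt (1 + u\<^sup>2)"
      have "t > 0" "1 + u\<^sup>2 = t\<^sup>2" using pos[of u] by (auto simp: t_def)
      then have "t / t ^ 3 = 1 / (1 + u\<^sup>2)" by (simp add: power2_eq_square power3_eq_cube)
      then show ?thesis by (simp add: t_def)
    qed
    finally show ?thesis .
  qed
  then show "integrable lborel (\<lambda>u. \<integral>v. norm (kernel_bound c (u, v)) \<partial>lborel)"
    using integrable_mult_right[OF integrable_inverse_one_plus_square] by simp
qed

text \<open>Both signs are that of the real part of cosh z times the conjugate of sinh z, which
  equals cosh (Re z) sinh (Re z).\<close>

lemma Re_cosh_div_sinh_nonneg: "Re z > 0 \<Longrightarrow> Re (cosh z / sinh z) \<ge> 0"
  and Re_sinh_div_cosh_nonneg: "Re z > 0 \<Longrightarrow> Re (sinh z / cosh z) \<ge> 0"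
proof -
  assume z: "Re z > 0"
  have s: "sinh z = Complex (sinh (Re z) * cos (Im z)) (cosh (Re z) * sin (Im z))"
    by (auto simp: sinh_field_def sinh_def cosh_def complex_eq_iff Re_exp Im_exp field_simps)
  have c: "cosh z = Complex (cosh (Re z) * cos (Im z)) (sinh (Re z) * sin (Im z))"
    by (auto simp: cosh_field_def sinh_def cosh_def complex_eq_iff Re_exp Im_exp field_simps)
  have p: "cosh (Re z) * sinh (Re z) \<ge> 0" using z by simp
  have "Re (cosh z) * Re (sinh z) + Im (cosh z) * Im (sinh z) = cosh (Re z) * sinh (Re z) * ((cos (Im z))\<^sup>2 + (sin (Im z))\<^sup>2)"
  proof -
    have alg: "C * x * (S * x) + S * y * (C * y) = C * S * (x\<^sup>2 + y\<^sup>2)" for C S x y :: real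
      by (simp add: power2_eq_square algebra_simps)
    show ?thesis unfolding s c complex.sel by (rule alg)
  qed
  then have n: "Re (cosh z) * Re (sinh z) + Im (cosh z) * Im (sinh z) \<ge> 0"
    using p by (simp only: sin_cos_squared_add2 mult_1_right)
  show "Re (cosh z / sinh z) \<ge> 0" unfolding Re_divide using n by simp
  show "Re (sinh z / cosh z) \<ge> 0" unfolding Re_divide using n by (simp add: mult.commute)
qed

text \<open>The range of u corresponds to \<bar>Im \<zeta>\<bar> \<le> pi / 2, where the sine is
  bounded below by a multiple of its argument; z = 1 is the only singularity near the
  circle.\<close>

lemma norm_sinh_lower:
  fixes u :: real
  assumes n: "n > 0" and u: "\<bar>u\<bar> \<le> pi * real n"
  shows "sqrt (1 + u\<^sup>2) / 2 \<le> 2 * real n * norm (sinh ((1 - \<i> * of_real u) / (2 * of_nat n)))"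
proof -
  define \<zeta> where "\<zeta> = (1 - \<i> * of_real u) / (2 * of_nat n)"
  have Re: "Re \<zeta> = 1 / (2 * real n)" and Im: "Im \<zeta> = - (u / (2 * real n))"
    by (simp_all add: \<zeta>_def Re_divide Im_divide power2_eq_square)
  have b: "\<bar>Im \<zeta>\<bar> \<le> pi / 2" using u n by (simp add: Im abs_mult field_simps)
  have "1 / (2 * real n) \<le> sinh (Re \<zeta>)" using le_sinh[of "Re \<zeta>"] n by (simp add: Re)
  then have "(1 / (2 * real n))\<^sup>2 \<le> (sinh (Re \<zeta>))\<^sup>2" by (intro power_mono) auto
  then have "(1 / (2 * real n))\<^sup>2 + (u / (2 * real n))\<^sup>2 / 4 \<le> (norm (sinh \<zeta>))\<^sup>2"
    unfolding norm_sinh_complex using sin_square_ge[OF b] by (simp add: Im)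
  then have "(2 * real n)\<^sup>2 * ((1 / (2 * real n))\<^sup>2 + (u / (2 * real n))\<^sup>2 / 4) \<le> (2 * real n)\<^sup>2 * (norm (sinh \<zeta>))\<^sup>2"
    by (intro mult_left_mono) auto
  also have "(2 * real n)\<^sup>2 * ((1 / (2 * real n))\<^sup>2 + (u / (2 * real n))\<^sup>2 / 4) = 1 + u\<^sup>2 / 4"
    using n by (simp add: power_divide power_mult_distrib field_simps)
  finally have "(1 + u\<^sup>2) / 4 \<le> (2 * real n * norm (sinh \<zeta>))\<^sup>2" by (simp add: power_mult_distrib)
  then have "sqrt ((1 + u\<^sup>2) / 4) \<le> 2 * real n * norm (sinh \<zeta>)"
    by (intro real_le_lsqrt) auto
  then show ?thesis by (simp add: real_sqrt_divide \<zeta>_def)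
qed

text \<open>The coth and tanh terms are dropped since they have a favourable sign; all decay comes
  from the pole and from the term with the squared sine. exp (5 / 2) stems from M \<le> 5 n and Re
  \<zeta> = 1 / (2 n), the 8 from the cubed lower bound for sinh. \<xi> / 64 collects q \<ge> n
  \<xi> / 2, the sine bound v^2 / (16 n^2) and Re (1 / sinh \<zeta>) \<ge> n / (4 (1 + u^2)). The
  minimum with 1 and the factor exp 4 serve the far arc.\<close>

lemma norm_corr_kernel_le:
  fixes u v :: real
  assumes n: "n > 0" and u: "\<bar>u\<bar> \<le> pi * real n" and v: "\<bar>v\<bar> \<le> pi * real n"
    and M: "real M \<le> 5 * real n" and q: "real n * \<xi> / 2 \<le> q" and \<xi>: "\<xi> > 0" and d: "d \<ge> 0"
  shows "norm (corr_kernel \<beta> \<alpha> M d q ((1 - \<i> * of_real u) / (2 * of_nat n)) (v / real n) / of_nat n ^ 3)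
     \<le> 8 * (exp \<bar>\<beta>\<bar> * exp (5 / 2) * exp 4) * kernel_bound (min 1 (\<xi> / 64)) (u, v)"
proof -
  define \<zeta> where "\<zeta> = (1 - \<i> * of_real u) / (2 * of_nat n)"
  have Re: "Re \<zeta> = 1 / (2 * real n)" and Im: "Im \<zeta> = - (u / (2 * real n))"
    by (simp_all add: \<zeta>_def Re_divide Im_divide power2_eq_square)
  have n1: "real n \<ge> 1" using n by simp
  have Rp: "Re \<zeta> > 0" using n Re by simp
  have pos: "1 + u\<^sup>2 > 0" by (simp add: add_pos_nonneg)
  have "0 \<le> real n * \<xi> / 2" using \<xi> by simp
  then have q0: "q \<ge> 0" using q by linarith
  have b: "\<bar>Im \<zeta>\<bar> \<le> pi / 2" using u n by (simp add: Im abs_mult field_simps)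
  have low': "sqrt (1 + u\<^sup>2) / 2 \<le> 2 * real n * norm (sinh \<zeta>)"
    unfolding \<zeta>_def by (rule norm_sinh_lower[OF n u])
  have f1: "norm (exp (of_real \<beta> * exp (- 2 * \<zeta>))) \<le> exp \<bar>\<beta>\<bar>"
  proof -
    have "Re (of_real \<beta> * exp (- 2 * \<zeta>)) \<le> norm (of_real \<beta> * exp (- 2 * \<zeta>))" by (rule complex_Re_le_cmod)
    also have "\<dots> = \<bar>\<beta>\<bar> * exp (- 2 * Re \<zeta>)" by (simp add: norm_mult norm_exp_eq_Re)
    also have "\<dots> \<le> \<bar>\<beta>\<bar> * 1" using Rp by (intro mult_left_mono) auto
    finally show ?thesis by (simp add: norm_exp_eq_Re)
  qed
  have f2: "norm (exp (of_nat M * \<zeta>)) \<le> exp (5 / 2)"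
    using M n by (simp add: norm_exp_eq_Re Re field_simps)
  have f3: "1 / (norm (2 * sinh \<zeta>) ^ 3 * real n ^ 3) \<le> 8 * (1 / sqrt (1 + u\<^sup>2) ^ 3)"
  proof -
    have "(sqrt (1 + u\<^sup>2) / 2) ^ 3 \<le> (2 * real n * norm (sinh \<zeta>)) ^ 3"
      by (intro power_mono low') auto
    then have "1 / (2 * real n * norm (sinh \<zeta>)) ^ 3 \<le> 1 / (sqrt (1 + u\<^sup>2) / 2) ^ 3"
      using pos by (intro divide_left_mono mult_pos_pos zero_less_power order_less_le_trans[OF _ low']) auto
    then show ?thesis by (simp add: norm_mult power_mult_distrib power_divide mult_ac)
  qed
  let ?E = "- of_real (d / 2) * (cosh \<zeta> / sinh \<zeta>) - of_real q * (sinh (\<zeta> / 2) / cosh (\<zeta> / 2))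
       - of_real (2 * q * (sin (v / real n / 2))\<^sup>2) / sinh \<zeta>"
  have ReE: "Re ?E \<le> - (2 * q * (sin (v / real n / 2))\<^sup>2 * Re (1 / sinh \<zeta>))"
  proof -
    have "of_real (2 * q * (sin (v / real n / 2))\<^sup>2) / sinh \<zeta> = of_real (2 * q * (sin (v / real n / 2))\<^sup>2) * (1 / sinh \<zeta>)"
      by simp
    then have "Re (of_real (2 * q * (sin (v / real n / 2))\<^sup>2) / sinh \<zeta>) = 2 * q * (sin (v / real n / 2))\<^sup>2 * Re (1 / sinh \<zeta>)"
      by (simp only: Re_complex_of_real times_complex.sel Im_complex_of_real mult_zero_left diff_zero)
    moreover have "d / 2 * Re (cosh \<zeta> / sinh \<zeta>) \<ge> 0" "q * Re (sinh (\<zeta> / 2) / cosh (\<zeta> / 2)) \<ge> 0"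
      using d q0 Re_cosh_div_sinh_nonneg[of \<zeta>] Re_sinh_div_cosh_nonneg[of "\<zeta> / 2"] Rp by simp_all
    moreover have "Re (- of_real (d / 2) * (cosh \<zeta> / sinh \<zeta>)) = - (d / 2 * Re (cosh \<zeta> / sinh \<zeta>))"
      "Re (of_real q * (sinh (\<zeta> / 2) / cosh (\<zeta> / 2))) = q * Re (sinh (\<zeta> / 2) / cosh (\<zeta> / 2))"
      by (simp_all only: Re_complex_of_real times_complex.sel Im_complex_of_real mult_zero_left diff_zero
          uminus_complex.sel minus_zero mult_minus_left)
    ultimately show ?thesis by (simp only: minus_complex.sel)
  qed
  have Rinv: "Re (1 / sinh \<zeta>) = sinh (Re \<zeta>) * cos (Im \<zeta>) / (norm (sinh \<zeta>))\<^sup>2"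
    by (simp add: Re_divide cmod_power2 Re_sinh_complex)
  have f4: "norm (exp ?E) \<le> exp 4 * exp (- (min 1 (\<xi> / 64) / (1 + u\<^sup>2)) * v\<^sup>2)"
  proof (cases "\<bar>u\<bar> \<le> pi * real n / 2")
    case True
    \<comment> \<open>On the inner arc \<bar>Im \<zeta>\<bar> \<le> pi / 4, hence the cosine that
      controls the sign of Re (1 / sinh \<zeta>) stays away from 0.\<close>
    have "1 / 2 \<le> cos (Im \<zeta>)"
    proof -
      have "cos (pi / 3) \<le> cos \<bar>Im \<zeta>\<bar>"
        using True n by (intro cos_monotone_0_pi_le) (auto simp: Im abs_mult field_simps)
      then show ?thesis by (simp add: cos_60)
    qed
    moreover have "1 / (2 * real n) \<le> sinh (Re \<zeta>)" using le_sinh[of "Re \<zeta>"] Rp Re by simp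
    ultimately have num: "1 / (2 * real n) * (1 / 2) \<le> sinh (Re \<zeta>) * cos (Im \<zeta>)"
      using n Rp by (intro mult_mono) auto
    have den: "(norm (sinh \<zeta>))\<^sup>2 \<le> (1 + u\<^sup>2) / (real n)\<^sup>2"
    proof -
      have "sinh (Re \<zeta>) \<le> 2 * (1 / (2 * real n))" using sinh_le_double[of "Re \<zeta>"] Rp Re n1 by simp
      then have "(sinh (Re \<zeta>))\<^sup>2 \<le> (1 / real n)\<^sup>2" using Rp by (intro power_mono) auto
      moreover have "(sin (Im \<zeta>))\<^sup>2 \<le> (Im \<zeta>)\<^sup>2" using abs_sin_x_le_abs_x[of "Im \<zeta>"] by (simp add: abs_le_square_iff)
      ultimately have "(norm (sinh \<zeta>))\<^sup>2 \<le> (1 / real n)\<^sup>2 + (u / (2 * real n))\<^sup>2"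
        unfolding norm_sinh_complex Im by simp
      also have "\<dots> \<le> (1 / real n)\<^sup>2 + (u / real n)\<^sup>2"
        using n by (simp add: power_divide field_simps)
      also have "\<dots> = (1 + u\<^sup>2) / (real n)\<^sup>2" by (simp add: power_divide add_divide_distrib)
      finally show ?thesis .
    qed
    have den0: "(norm (sinh \<zeta>))\<^sup>2 > 0" using sinh_neq_0_complex[OF Rp] by simp
    have "(1 / (2 * real n) * (1 / 2)) / ((1 + u\<^sup>2) / (real n)\<^sup>2) \<le> Re (1 / sinh \<zeta>)"
      unfolding Rinv using num den den0 n by (intro frac_le) (auto intro: order_trans[OF _ num])
    then have R: "real n / (4 * (1 + u\<^sup>2)) \<le> Re (1 / sinh \<zeta>)"
      using n by (simp add: power2_eq_square)
    have S: "(v / (2 * real n))\<^sup>2 / 4 \<le> (sin (v / real n / 2))\<^sup>2"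
      using sin_square_ge[of "v / real n / 2"] v n by (simp add: abs_mult field_simps)
    have "2 * (real n * \<xi> / 2) * ((v / (2 * real n))\<^sup>2 / 4) * (real n / (4 * (1 + u\<^sup>2)))
        \<le> 2 * q * (sin (v / real n / 2))\<^sup>2 * Re (1 / sinh \<zeta>)"
      using S R q q0 \<xi> n pos by (intro mult_mono) auto
    also have "2 * (real n * \<xi> / 2) * ((v / (2 * real n))\<^sup>2 / 4) * (real n / (4 * (1 + u\<^sup>2))) = \<xi> / 64 / (1 + u\<^sup>2) * v\<^sup>2"
      using n by (simp add: power2_eq_square)
    finally have "Re ?E \<le> - (\<xi> / 64 / (1 + u\<^sup>2) * v\<^sup>2)" using ReE by linarith
    also have "\<dots> \<le> - (min 1 (\<xi> / 64) / (1 + u\<^sup>2)) * v\<^sup>2"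
    proof -
      have "min 1 (\<xi> / 64) / (1 + u\<^sup>2) * v\<^sup>2 \<le> \<xi> / 64 / (1 + u\<^sup>2) * v\<^sup>2"
        using pos by (intro mult_right_mono divide_right_mono) auto
      then show ?thesis by simp
    qed
    finally have "norm (exp ?E) \<le> 1 * exp (- (min 1 (\<xi> / 64) / (1 + u\<^sup>2)) * v\<^sup>2)"
      by (simp only: norm_exp_eq_Re exp_le_cancel_iff mult_1_left)
    also have "\<dots> \<le> exp 4 * exp (- (min 1 (\<xi> / 64) / (1 + u\<^sup>2)) * v\<^sup>2)"
      by (intro mult_right_mono) auto
    finally show ?thesis .
  next
    \<comment> \<open>Here \<open>Re (1 / sinh \<zeta>)\<close> may be close to 0, but \<open>v\<^sup>2 \<le> 4 u\<^sup>2\<close> bounds the claimed Gaussian factor from below.\<close>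
    case False
    have "cos (Im \<zeta>) \<ge> 0" using b by (intro cos_ge_zero) auto
    then have "Re (1 / sinh \<zeta>) \<ge> 0" unfolding Rinv using Rp by simp
    then have "2 * q * (sin (v / real n / 2))\<^sup>2 * Re (1 / sinh \<zeta>) \<ge> 0"
      using q0 by (intro mult_nonneg_nonneg) auto
    then have "Re ?E \<le> 0" using ReE by linarith
    moreover have "min 1 (\<xi> / 64) / (1 + u\<^sup>2) * v\<^sup>2 \<le> 4"
    proof -
      have "\<bar>v\<bar> \<le> 2 * \<bar>u\<bar>" using False v by linarith
      then have "\<bar>v\<bar>\<^sup>2 \<le> (2 * \<bar>u\<bar>)\<^sup>2" by (rule power_mono) simp
      then have "v\<^sup>2 \<le> 4 * (1 + u\<^sup>2)" by (simp add: power_mult_distrib)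
      then have "v\<^sup>2 / (1 + u\<^sup>2) \<le> 4" using pos by (simp add: field_simps)
      moreover have "min 1 (\<xi> / 64) * (v\<^sup>2 / (1 + u\<^sup>2)) \<le> 1 * (v\<^sup>2 / (1 + u\<^sup>2))"
        using pos by (intro mult_right_mono) auto
      ultimately show ?thesis by simp
    qed
    ultimately have "Re ?E \<le> 4 + - (min 1 (\<xi> / 64) / (1 + u\<^sup>2)) * v\<^sup>2" by simp
    then have "exp (Re ?E) \<le> exp (4 + - (min 1 (\<xi> / 64) / (1 + u\<^sup>2)) * v\<^sup>2)" by simp
    then show ?thesis by (simp only: norm_exp_eq_Re exp_add)
  qed
  have "norm (corr_kernel \<beta> \<alpha> M d q \<zeta> (v / real n) / of_nat n ^ 3)
     = norm (exp (of_real \<beta> * exp (- 2 * \<zeta>))) * norm (exp (of_nat M * \<zeta>)) * (1 / (norm (2 * sinh \<zeta>) ^ 3 * real n ^ 3)) * norm (exp ?E)"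
    unfolding corr_kernel_def by (simp add: norm_mult norm_divide norm_power)
  also have "\<dots> \<le> exp \<bar>\<beta>\<bar> * exp (5 / 2) * (8 * (1 / sqrt (1 + u\<^sup>2) ^ 3)) * (exp 4 * exp (- (min 1 (\<xi> / 64) / (1 + u\<^sup>2)) * v\<^sup>2))"
    using pos by (intro mult_mono f1 f2 f3 f4) auto
  also have "\<dots> = 8 * (exp \<bar>\<beta>\<bar> * exp (5 / 2) * exp 4) * kernel_bound (min 1 (\<xi> / 64)) (u, v)"
    unfolding kernel_bound_def by (simp add: mult_ac)
  finally show ?thesis unfolding \<zeta>_def .
qed

section \<open>The pointwise limit of the rescaled integrand\<close>

definition limit_kernel :: "real \<Rightarrow> real \<Rightarrow> real \<Rightarrow> real \<times> real \<Rightarrow> complex" where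
  "limit_kernel \<beta> \<xi> D w = exp (of_real \<beta>) * (exp (of_real (1 - \<xi> / 4) * (1 - \<i> * of_real (fst w))) / (1 - \<i> * of_real (fst w)) ^ 3 *
     exp (- of_real (D + \<xi> * (snd w)\<^sup>2) / (1 - \<i> * of_real (fst w))))"

lemma tendsto_mult_sinh_divide:
  fixes p :: complex and c :: "nat \<Rightarrow> complex"
  assumes "p \<noteq> 0" "filterlim c at_infinity sequentially"
  shows "(\<lambda>n. c n * sinh (p / c n)) \<longlonglongrightarrow> p"
proof -
  have c0: "\<forall>\<^sub>F n in sequentially. c n \<noteq> 0"
    using assms(2) filterlim_at_infinity_imp_eventually_ne by blast
  have h: "(\<lambda>n. p / c n) \<longlonglongrightarrow> 0"
    by (rule tendsto_divide_0[OF tendsto_const assms(2)])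
  then have "filterlim (\<lambda>n. p / c n) (at 0) sequentially"
    using c0 assms(1) by (auto simp: filterlim_at elim!: eventually_mono)
  moreover have "((\<lambda>h. sinh h / h) \<longlongrightarrow> (1::complex)) (at 0)"
  proof -
    have "(sinh has_field_derivative 1) (at (0::complex))"
      by (auto intro!: derivative_eq_intros)
    then show ?thesis by (simp add: has_field_derivative_iff)
  qed
  ultimately have "(\<lambda>n. sinh (p / c n) / (p / c n)) \<longlonglongrightarrow> 1"
    by (rule filterlim_compose[rotated])
  then have "(\<lambda>n. p * (sinh (p / c n) / (p / c n))) \<longlonglongrightarrow> p * 1"
    by (intro tendsto_mult tendsto_const)
  then show ?thesis
    by (rule Lim_transform_eventually[THEN tendsto_eq_rhs])
      (use c0 assms(1) in \<open>auto elim!: eventually_mono simp: field_simps\<close>)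
qed

lemma tendsto_mult_sin_divide:
  fixes v :: real
  shows "(\<lambda>n. real n * sin (v / real n / 2)) \<longlonglongrightarrow> v / 2"
proof (cases "v = 0")
  case False
  have h: "(\<lambda>n. v / real n / 2) \<longlonglongrightarrow> 0"
    by real_asymp
  then have "filterlim (\<lambda>n. v / real n / 2) (at 0) sequentially"
    using eventually_gt_at_top[of 0] False by (auto simp: filterlim_at elim!: eventually_mono)
  moreover have "((\<lambda>h. sin h / h) \<longlongrightarrow> (1::real)) (at 0)"
    using DERIV_sin[of "0::real"] by (simp add: has_field_derivative_iff)
  ultimately have "(\<lambda>n. sin (v / real n / 2) / (v / real n / 2)) \<longlonglongrightarrow> 1"
    by (rule filterlim_compose[rotated])
  then have "(\<lambda>n. v / 2 * (sin (v / real n / 2) / (v / real n / 2))) \<longlonglongrightarrow> v / 2 * 1"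
    by (intro tendsto_mult tendsto_const)
  then show ?thesis
    by (rule Lim_transform_eventually[THEN tendsto_eq_rhs])
      (use eventually_gt_at_top[of "0::nat"] False in \<open>auto elim!: eventually_mono simp: field_simps\<close>)
qed simp

text \<open>With p = 1 - i u and \<zeta> = p / (2 n), 2 n sinh \<zeta> tends to p. So M \<zeta>
  tends to p, the coth term to D / p, the tanh term to \<xi> p / 4 and the sine term to \<xi> v^2 /
  p, while the phase with \<alpha> disappears. The sum of the two multiples of p has the coefficient
  1 - \<xi> / 4.\<close>

lemma tendsto_corr_kernel:
  fixes q d :: "nat \<Rightarrow> real" and M :: "nat \<Rightarrow> nat"
  assumes q: "(\<lambda>n. q n / real n) \<longlonglongrightarrow> \<xi>" and d: "(\<lambda>n. real n * d n) \<longlonglongrightarrow> D"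
    and M: "(\<lambda>n. real (M n) / (2 * real n)) \<longlonglongrightarrow> 1"
  shows "(\<lambda>n. corr_kernel \<beta> \<alpha> (M n) (d n) (q n) ((1 - \<i> * of_real u) / (2 * of_nat n)) (v / real n) / of_nat n ^ 3)
    \<longlonglongrightarrow> limit_kernel \<beta> \<xi> D (u, v)"
proof -
  define p where "p = 1 - \<i> * of_real u"
  have p0: "p \<noteq> 0" by (auto simp: p_def complex_eq_iff)
  define \<zeta> where "\<zeta> n = p / (2 * of_nat n)" for n
  have inf: "filterlim (\<lambda>n. of_nat n :: complex) at_infinity sequentially"
    by (rule tendsto_of_nat)
  have inf2: "filterlim (\<lambda>n. 2 * of_nat n :: complex) at_infinity sequentially"
    by (rule tendsto_mult_filterlim_at_infinity[OF tendsto_const _ inf]) simp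
  have inf4: "filterlim (\<lambda>n. 4 * of_nat n :: complex) at_infinity sequentially"
    by (rule tendsto_mult_filterlim_at_infinity[OF tendsto_const _ inf]) simp
  have \<zeta>: "\<zeta> \<longlonglongrightarrow> 0"
    unfolding \<zeta>_def by (rule tendsto_divide_0[OF tendsto_const inf2])
  have S: "(\<lambda>n. 2 * of_nat n * sinh (\<zeta> n)) \<longlonglongrightarrow> p"
    unfolding \<zeta>_def by (rule tendsto_mult_sinh_divide[OF p0 inf2])
  have S2: "(\<lambda>n. of_nat n * sinh (\<zeta> n / 2)) \<longlonglongrightarrow> p / 4"
  proof -
    have "(\<lambda>n. 4 * of_nat n * sinh (p / (4 * of_nat n)) / 4) \<longlonglongrightarrow> p / 4"
      by (intro tendsto_divide tendsto_const tendsto_mult_sinh_divide[OF p0 inf4]) simp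
    then show ?thesis by (simp add: \<zeta>_def)
  qed
  have C: "(\<lambda>n. cosh (\<zeta> n)) \<longlonglongrightarrow> 1" "(\<lambda>n. cosh (\<zeta> n / 2)) \<longlonglongrightarrow> 1"
    using tendsto_cosh[OF \<zeta>] tendsto_cosh[OF tendsto_divide[OF \<zeta> tendsto_const[of 2]]] by simp_all
  have MZ: "(\<lambda>n. of_nat (M n) * \<zeta> n) \<longlonglongrightarrow> p"
  proof -
    have "(\<lambda>n. complex_of_real (real (M n) / (2 * real n)) * p) \<longlonglongrightarrow> of_real 1 * p"
      by (intro tendsto_intros M)
    then show ?thesis by (simp add: \<zeta>_def)
  qed
  have E: "(\<lambda>n. - ((of_real (real n * d n) * cosh (\<zeta> n)) / (2 * of_nat n * sinh (\<zeta> n)))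
      - (of_real (q n / real n) * (of_nat n * sinh (\<zeta> n / 2))) / cosh (\<zeta> n / 2)
      - of_real (4 * (q n / real n) * (real n * sin (v / real n / 2))\<^sup>2) / (2 * of_nat n * sinh (\<zeta> n)))
     \<longlonglongrightarrow> - (of_real D * 1 / p) - (of_real \<xi> * (p / 4)) / 1 - of_real (4 * \<xi> * (v / 2)\<^sup>2) / p"
    by (intro tendsto_intros q d S S2 C tendsto_mult_sin_divide p0) simp
  have "(\<lambda>n. exp (of_real \<beta> * exp (- 2 * \<zeta> n)) * exp (of_nat (M n) * \<zeta> n) / (2 * of_nat n * sinh (\<zeta> n)) ^ 3 *
     exp (- ((of_real (real n * d n) * cosh (\<zeta> n)) / (2 * of_nat n * sinh (\<zeta> n)))
      - (of_real (q n / real n) * (of_nat n * sinh (\<zeta> n / 2))) / cosh (\<zeta> n / 2)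
      - of_real (4 * (q n / real n) * (real n * sin (v / real n / 2))\<^sup>2) / (2 * of_nat n * sinh (\<zeta> n))) *
     cis (- (real \<alpha> * (v / real n))))
    \<longlonglongrightarrow> exp (of_real \<beta> * exp (- 2 * 0)) * exp p / p ^ 3 *
     exp (- (of_real D * 1 / p) - (of_real \<xi> * (p / 4)) / 1 - of_real (4 * \<xi> * (v / 2)\<^sup>2) / p) * cis (- (real \<alpha> * 0))"
    by (intro tendsto_intros \<zeta> MZ S E) (use p0 in \<open>auto intro: real_tendsto_divide_at_top filterlim_real_sequentially\<close>)
  also have "exp (of_real \<beta> * exp (- 2 * 0)) * exp p / p ^ 3 *
     exp (- (of_real D * 1 / p) - (of_real \<xi> * (p / 4)) / 1 - of_real (4 * \<xi> * (v / 2)\<^sup>2) / p) * cis (- (real \<alpha> * 0))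
     = limit_kernel \<beta> \<xi> D (u, v)"
  proof -
    have "p + (- (of_real D * 1 / p) - (of_real \<xi> * (p / 4)) / 1 - of_real (4 * \<xi> * (v / 2)\<^sup>2) / p)
      = of_real (1 - \<xi> / 4) * p + - of_real (D + \<xi> * v\<^sup>2) / p"
      using p0 by (simp add: field_simps)
    then have "exp p * exp (- (of_real D * 1 / p) - (of_real \<xi> * (p / 4)) / 1 - of_real (4 * \<xi> * (v / 2)\<^sup>2) / p)
      = exp (of_real (1 - \<xi> / 4) * p) * exp (- of_real (D + \<xi> * v\<^sup>2) / p)"
      by (simp only: exp_add[symmetric])
    then show ?thesis
      unfolding limit_kernel_def fst_conv snd_conv p_def[symmetric] by (simp add: field_simps)
  qed
  finally show ?thesis
  proof (rule Lim_transform_eventually)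
    show "\<forall>\<^sub>F n in sequentially. exp (of_real \<beta> * exp (- 2 * \<zeta> n)) * exp (of_nat (M n) * \<zeta> n) / (2 * of_nat n * sinh (\<zeta> n)) ^ 3 *
     exp (- ((of_real (real n * d n) * cosh (\<zeta> n)) / (2 * of_nat n * sinh (\<zeta> n)))
      - (of_real (q n / real n) * (of_nat n * sinh (\<zeta> n / 2))) / cosh (\<zeta> n / 2)
      - of_real (4 * (q n / real n) * (real n * sin (v / real n / 2))\<^sup>2) / (2 * of_nat n * sinh (\<zeta> n))) *
     cis (- (real \<alpha> * (v / real n))) =
     corr_kernel \<beta> \<alpha> (M n) (d n) (q n) ((1 - \<i> * of_real u) / (2 * of_nat n)) (v / real n) / of_nat n ^ 3"
      using eventually_gt_at_top[of "0::nat"]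
    proof eventually_elim
      case (elim n)
      define N where "N = complex_of_nat n"
      have N: "N \<noteq> 0" "complex_of_real (real n) = N" using elim by (auto simp: N_def)
      have z: "\<zeta> n = (1 - \<i> * of_real u) / (2 * of_nat n)" by (simp add: \<zeta>_def p_def)
      have "Re (\<zeta> n) > 0" using elim by (simp add: z Re_divide power2_eq_square)
      then have s: "sinh (\<zeta> n) \<noteq> 0" by (rule sinh_neq_0_complex)
      have 1: "of_real (real n * d n) * cosh (\<zeta> n) / (2 * N * sinh (\<zeta> n)) = of_real (d n / 2) * (cosh (\<zeta> n) / sinh (\<zeta> n))"
        using N s by (simp add: field_simps)
      have 2: "of_real (q n / real n) * (N * sinh (\<zeta> n / 2)) / cosh (\<zeta> n / 2) = of_real (q n) * (sinh (\<zeta> n / 2) / cosh (\<zeta> n / 2))"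
        using N by simp
      have 3: "of_real (4 * (q n / real n) * (real n * sin (v / real n / 2))\<^sup>2) / (2 * N * sinh (\<zeta> n))
        = of_real (2 * q n * (sin (v / real n / 2))\<^sup>2) / sinh (\<zeta> n)"
        using N s by (simp add: field_simps power2_eq_square)
      show ?case
        unfolding corr_kernel_def z[symmetric] unfolding N_def[symmetric] 1 2 3
        by (simp add: power_mult_distrib mult_ac)
    qed
  qed
qed

section \<open>Passage to the limit under the double integral\<close>

lemma borel_measurable_lborel_pairI:
  fixes f :: "real \<times> real \<Rightarrow> complex"
  assumes "continuous_on UNIV f"
  shows "f \<in> borel_measurable (lborel \<Otimes>\<^sub>M lborel)"
proof -
  have "sets (lborel \<Otimes>\<^sub>M lborel :: (real \<times> real) measure) = sets borel"
    by (metis borel_prod sets_lborel sets_pair_measure_cong)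
  then show ?thesis
    using borel_measurable_continuous_onI[OF assms] measurable_cong_sets by blast
qed

lemma one_minus_imaginary_neq_0: "1 - \<i> * complex_of_real u \<noteq> 0"
  by (auto simp: complex_eq_iff)

lemma measurable_limit_kernel: "limit_kernel \<beta> \<xi> D \<in> borel_measurable (lborel \<Otimes>\<^sub>M lborel)"
  unfolding limit_kernel_def using one_minus_imaginary_neq_0
  by (intro borel_measurable_lborel_pairI continuous_intros) auto

lemma measurable_corr_kernel:
  assumes "n > 0"
  shows "(\<lambda>w. corr_kernel \<beta> \<alpha> M d q ((1 - \<i> * of_real (fst w)) / (2 * of_nat n)) (snd w / real n)) \<in> borel_measurable (lborel \<Otimes>\<^sub>M lborel)"
proof (rule borel_measurable_lborel_pairI)
  have "Re ((1 - \<i> * complex_of_real u) / (2 * of_nat n)) > 0" for u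
    using assms by (simp add: Re_divide power2_eq_square)
  then have "sinh ((1 - \<i> * complex_of_real u) / (2 * of_nat n)) \<noteq> 0" "cosh ((1 - \<i> * complex_of_real u) / (2 * of_nat n) / 2) \<noteq> 0" for u
    using sinh_neq_0_complex cosh_half_neq_0 by blast+
  then show "continuous_on UNIV (\<lambda>w. corr_kernel \<beta> \<alpha> M d q ((1 - \<i> * of_real (fst w)) / (2 * of_nat n)) (snd w / real n))"
    unfolding corr_kernel_def using assms by (intro continuous_intros) auto
qed

lemma integral_Icc_rescale:
  fixes f :: "real \<Rightarrow> complex"
  assumes "n > 0"
  shows "(\<integral>\<theta>. indicator {-pi..pi} \<theta> *\<^sub>R f \<theta> \<partial>lborel)
    = (\<integral>u. indicator {- (pi * real n)..pi * real n} u *\<^sub>R (f (u / real n) / of_nat n) \<partial>lborel)"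
proof -
  have i: "indicator {-pi..pi} (0 + 1 / real n * u) = (indicator {- (pi * real n)..pi * real n} u :: real)" for u
    using assms by (auto simp: indicator_def field_simps)
  have "(\<integral>\<theta>. indicator {-pi..pi} \<theta> *\<^sub>R f \<theta> \<partial>lborel)
    = \<bar>1 / real n\<bar> *\<^sub>R (\<integral>u. indicator {-pi..pi} (0 + 1 / real n * u) *\<^sub>R f (0 + 1 / real n * u) \<partial>lborel)"
    using assms by (intro lborel_integral_real_affine) simp
  also have "\<dots> = 1 / of_nat n * (\<integral>u. indicator {- (pi * real n)..pi * real n} u *\<^sub>R f (u / real n) \<partial>lborel)"
    unfolding i by (simp add: scaleR_conv_of_real)
  also have "\<dots> = (\<integral>u. indicator {- (pi * real n)..pi * real n} u *\<^sub>R (1 / of_nat n * f (u / real n)) \<partial>lborel)"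
    by (rule integral_indicator_mult[symmetric])
  finally show ?thesis by simp
qed

text \<open>Rescaling the two angles produces 1 / n^2, and the prefactor 1 / n completes this to the
  1 / n^3 required by the pole of order three. The majorant is available only from some index
  \<open>k\<close> on, hence the shifted sequence in the proof.\<close>

lemma corr_kernel_integral_limit:
  fixes q d :: "nat \<Rightarrow> real" and M :: "nat \<Rightarrow> nat"
  assumes \<xi>: "\<xi> > 0" and q: "(\<lambda>n. q n / real n) \<longlonglongrightarrow> \<xi>" and d: "(\<lambda>n. real n * d n) \<longlonglongrightarrow> D"
    and M: "(\<lambda>n. real (M n) / (2 * real n)) \<longlonglongrightarrow> 1"
    and d0: "\<forall>\<^sub>F n in sequentially. d n \<ge> 0"
  shows "(\<lambda>n. 1 / of_nat n * (\<integral>\<theta>. indicator {-pi..pi} \<theta> *\<^sub>R (\<integral>\<phi>. indicator {-pi..pi} \<phi> *\<^sub>R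
       corr_kernel \<beta> \<alpha> (M n) (d n) (q n) (Complex (1 / (2 * real n)) (- \<theta> / 2)) \<phi> \<partial>lborel) \<partial>lborel))
     \<longlonglongrightarrow> integral\<^sup>L (lborel \<Otimes>\<^sub>M lborel) (limit_kernel \<beta> \<xi> D)"
proof -
  let ?L = "lborel \<Otimes>\<^sub>M lborel :: (real \<times> real) measure"
  define B where "B = 8 * (exp \<bar>\<beta>\<bar> * exp (5 / 2) * exp 4)"
  define c where "c = min 1 (\<xi> / 64)"
  let ?I = "\<lambda>n. indicator {- (pi * real n)..pi * real n} :: real \<Rightarrow> real"
  define G where "G n w = ?I n (fst w) *\<^sub>R (?I n (snd w) *\<^sub>R
     (corr_kernel \<beta> \<alpha> (M n) (d n) (q n) ((1 - \<i> * of_real (fst w)) / (2 * of_nat n)) (snd w / real n) / of_nat n ^ 3))" for n w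
  have "\<forall>\<^sub>F n in sequentially. \<xi> / 2 < q n / real n"
    using order_tendstoD(1)[OF q, of "\<xi> / 2"] \<xi> by simp
  moreover have "\<forall>\<^sub>F n in sequentially. real (M n) / (2 * real n) < 5 / 2"
    using order_tendstoD(2)[OF M, of "5 / 2"] by simp
  ultimately have "\<forall>\<^sub>F n in sequentially. n > 0 \<and> real n * \<xi> / 2 \<le> q n \<and> real (M n) \<le> 5 * real n \<and> d n \<ge> 0"
    using d0 eventually_gt_at_top[of 0] by eventually_elim (simp add: field_simps)
  then obtain k where k: "\<And>n. n \<ge> k \<Longrightarrow> n > 0 \<and> real n * \<xi> / 2 \<le> q n \<and> real (M n) \<le> 5 * real n \<and> d n \<ge> 0"
    unfolding eventually_sequentially by blast
  have pos: "kernel_bound c w \<ge> 0" for w by (simp add: kernel_bound_def)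
  have bound: "norm (G n w) \<le> B * kernel_bound c w" if "n \<ge> k" for n w
  proof (cases "\<bar>fst w\<bar> \<le> pi * real n \<and> \<bar>snd w\<bar> \<le> pi * real n")
    case True
    then have "norm (G n w) = norm (corr_kernel \<beta> \<alpha> (M n) (d n) (q n) ((1 - \<i> * of_real (fst w)) / (2 * of_nat n)) (snd w / real n) / of_nat n ^ 3)"
      unfolding G_def by (simp add: indicator_def abs_le_iff)
    also have "\<dots> \<le> B * kernel_bound c (fst w, snd w)"
      unfolding B_def c_def using k[OF that] True \<xi> by (intro norm_corr_kernel_le) auto
    finally show ?thesis by simp
  next
    case False
    then have "G n w = 0" unfolding G_def by (auto simp: indicator_def abs_le_iff)
    then show ?thesis using pos[of w] by (simp add: B_def)
  qed
  have measG: "G n \<in> borel_measurable ?L" if "n > 0" for n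
    unfolding G_def
    by (intro borel_measurable_scaleR borel_measurable_divide measurable_corr_kernel that borel_measurable_const) measurable
  have intb: "integrable ?L (\<lambda>w. B * kernel_bound c w)"
    by (intro integrable_mult_right integrable_kernel_bound) (use \<xi> in \<open>simp add: c_def\<close>)
  have intG: "integrable ?L (G n)" if "n \<ge> k" for n
  proof (rule Bochner_Integration.integrable_bound[OF intb measG])
    show "AE w in ?L. norm (G n w) \<le> norm (B * kernel_bound c w)"
      unfolding real_norm_def by (intro AE_I2 order_trans[OF bound[OF that] abs_ge_self])
  qed (use k[OF that] in simp)
  have "(\<lambda>n. integral\<^sup>L ?L (G (n + k))) \<longlonglongrightarrow> integral\<^sup>L ?L (limit_kernel \<beta> \<xi> D)"
  proof (rule integral_dominated_convergence[where w = "\<lambda>w. B * kernel_bound c w"])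
    show "AE w in ?L. (\<lambda>n. G (n + k) w) \<longlonglongrightarrow> limit_kernel \<beta> \<xi> D w"
    proof (rule AE_I2)
      fix w :: "real \<times> real"
      have "filterlim (\<lambda>n. pi * real n) at_top sequentially" by real_asymp
      then have "\<forall>\<^sub>F n in sequentially. \<bar>fst w\<bar> \<le> pi * real n" "\<forall>\<^sub>F n in sequentially. \<bar>snd w\<bar> \<le> pi * real n"
        by (auto simp: filterlim_at_top)
      then have "\<forall>\<^sub>F n in sequentially. corr_kernel \<beta> \<alpha> (M n) (d n) (q n) ((1 - \<i> * of_real (fst w)) / (2 * of_nat n)) (snd w / real n) / of_nat n ^ 3 = G n w"
        by eventually_elim (simp add: G_def indicator_def abs_le_iff)
      then have "(\<lambda>n. G n w) \<longlonglongrightarrow> limit_kernel \<beta> \<xi> D (fst w, snd w)"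
        by (rule Lim_transform_eventually[OF tendsto_corr_kernel[OF q d M]])
      then show "(\<lambda>n. G (n + k) w) \<longlonglongrightarrow> limit_kernel \<beta> \<xi> D w"
        using LIMSEQ_ignore_initial_segment[of "\<lambda>n. G n w" _ k] by simp
    qed
    show "G (n + k) \<in> borel_measurable ?L" for n using k[of "n + k"] by (intro measG) simp
    show "AE w in ?L. norm (G (n + k) w) \<le> B * kernel_bound c w" for n
      by (intro AE_I2 bound) simp
  qed (rule measurable_limit_kernel intb)+
  then have "(\<lambda>n. integral\<^sup>L ?L (G n)) \<longlonglongrightarrow> integral\<^sup>L ?L (limit_kernel \<beta> \<xi> D)"
    by (rule LIMSEQ_offset)
  then show ?thesis
  proof (rule Lim_transform_eventually)
    show "\<forall>\<^sub>F n in sequentially. integral\<^sup>L ?L (G n) = 1 / of_nat n * (\<integral>\<theta>. indicator {-pi..pi} \<theta> *\<^sub>R (\<integral>\<phi>. indicator {-pi..pi} \<phi> *\<^sub>R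
       corr_kernel \<beta> \<alpha> (M n) (d n) (q n) (Complex (1 / (2 * real n)) (- \<theta> / 2)) \<phi> \<partial>lborel) \<partial>lborel)"
      using eventually_ge_at_top[of k]
    proof eventually_elim
      case (elim n)
      have n: "n > 0" using k[OF elim] by simp
      let ?K = "\<lambda>u v. corr_kernel \<beta> \<alpha> (M n) (d n) (q n) ((1 - \<i> * of_real u) / (2 * of_nat n)) (v / real n)"
      have z: "Complex (1 / (2 * real n)) (- (u / real n) / 2) = (1 - \<i> * of_real u) / (2 * of_nat n)" for u
        using n by (simp add: complex_eq_iff Re_divide Im_divide power2_eq_square)
      have "integral\<^sup>L ?L (G n) = (\<integral>u. \<integral>v. G n (u, v) \<partial>lborel \<partial>lborel)"
        by (rule lborel_pair.integral_fst'[symmetric, OF intG[OF elim]])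
      also have "\<dots> = (\<integral>u. ?I n u *\<^sub>R (\<integral>v. ?I n v *\<^sub>R (?K u v / of_nat n ^ 3) \<partial>lborel) \<partial>lborel)"
      proof -
        have "(\<integral>v. r *\<^sub>R f v \<partial>lborel) = r *\<^sub>R (\<integral>v. f v \<partial>lborel)" for r and f :: "real \<Rightarrow> complex"
          unfolding scaleR_conv_of_real by (rule integral_mult_right_zero)
        then show ?thesis unfolding G_def fst_conv snd_conv by (simp only:)
      qed
      also have "\<dots> = (\<integral>u. ?I n u *\<^sub>R (1 / of_nat n ^ 3 * (\<integral>v. ?I n v *\<^sub>R ?K u v \<partial>lborel)) \<partial>lborel)"
        by (subst integral_indicator_mult[symmetric]) simp
      also have "\<dots> = 1 / of_nat n ^ 3 * (\<integral>u. ?I n u *\<^sub>R (\<integral>v. ?I n v *\<^sub>R ?K u v \<partial>lborel) \<partial>lborel)"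
        by (rule integral_indicator_mult)
      finally have 1: "integral\<^sup>L ?L (G n) = 1 / of_nat n ^ 3 * (\<integral>u. ?I n u *\<^sub>R (\<integral>v. ?I n v *\<^sub>R ?K u v \<partial>lborel) \<partial>lborel)" .
      have "(\<integral>\<theta>. indicator {-pi..pi} \<theta> *\<^sub>R (\<integral>\<phi>. indicator {-pi..pi} \<phi> *\<^sub>R
         corr_kernel \<beta> \<alpha> (M n) (d n) (q n) (Complex (1 / (2 * real n)) (- \<theta> / 2)) \<phi> \<partial>lborel) \<partial>lborel)
        = (\<integral>u. ?I n u *\<^sub>R ((\<integral>v. ?I n v *\<^sub>R (?K u v / of_nat n) \<partial>lborel) / of_nat n) \<partial>lborel)"
        unfolding integral_Icc_rescale[OF n] z ..
      also have "\<dots> = (\<integral>u. ?I n u *\<^sub>R (1 / of_nat n ^ 2 * (\<integral>v. ?I n v *\<^sub>R ?K u v \<partial>lborel)) \<partial>lborel)"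
      proof -
        have "(\<integral>v. ?I n v *\<^sub>R (?K u v / of_nat n) \<partial>lborel) / of_nat n = 1 / of_nat n ^ 2 * (\<integral>v. ?I n v *\<^sub>R ?K u v \<partial>lborel)" for u
          using integral_indicator_mult[of lborel "{- (pi * real n)..pi * real n}" "1 / of_nat n" "?K u"]
          by (simp add: power2_eq_square)
        then show ?thesis by simp
      qed
      also have "\<dots> = 1 / of_nat n ^ 2 * (\<integral>u. ?I n u *\<^sub>R (\<integral>v. ?I n v *\<^sub>R ?K u v \<partial>lborel) \<partial>lborel)"
        by (rule integral_indicator_mult)
      finally show ?case unfolding 1 by (simp add: power2_eq_square power3_eq_cube)
    qed
  qed
qed

lemma integrable_limit_kernel:
  assumes "\<xi> > 0" "D \<ge> 0"
  shows "integrable (lborel \<Otimes>\<^sub>M lborel) (limit_kernel \<beta> \<xi> D)"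
proof (rule Bochner_Integration.integrable_bound[OF _ measurable_limit_kernel])
  show "integrable (lborel \<Otimes>\<^sub>M lborel) (\<lambda>w. exp \<beta> * exp (1 - \<xi> / 4) * kernel_bound \<xi> w)"
    by (intro integrable_mult_right integrable_kernel_bound assms)
  have "norm (limit_kernel \<beta> \<xi> D (u, v)) \<le> exp \<beta> * exp (1 - \<xi> / 4) * kernel_bound \<xi> (u, v)" for u v
  proof -
    have np: "norm (1 - \<i> * complex_of_real u) = sqrt (1 + u\<^sup>2)" by (simp add: cmod_def)
    have "Re (- of_real (D + \<xi> * v\<^sup>2) / (1 - \<i> * complex_of_real u)) = - (D + \<xi> * v\<^sup>2) / (1 + u\<^sup>2)"
      by (simp add: Re_divide)
    also have "\<dots> \<le> - (\<xi> / (1 + u\<^sup>2)) * v\<^sup>2"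
    proof -
      have "- (D + \<xi> * v\<^sup>2) / (1 + u\<^sup>2) \<le> - (\<xi> * v\<^sup>2) / (1 + u\<^sup>2)"
        using assms by (intro divide_right_mono) auto
      then show ?thesis by simp
    qed
    finally have "norm (exp (- of_real (D + \<xi> * v\<^sup>2) / (1 - \<i> * complex_of_real u))) \<le> exp (- (\<xi> / (1 + u\<^sup>2)) * v\<^sup>2)"
      by (simp only: norm_exp_eq_Re exp_le_cancel_iff)
    then have "exp \<beta> * exp (1 - \<xi> / 4) * (1 / sqrt (1 + u\<^sup>2) ^ 3) * norm (exp (- of_real (D + \<xi> * v\<^sup>2) / (1 - \<i> * complex_of_real u)))
      \<le> exp \<beta> * exp (1 - \<xi> / 4) * (1 / sqrt (1 + u\<^sup>2) ^ 3) * exp (- (\<xi> / (1 + u\<^sup>2)) * v\<^sup>2)"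
      by (intro mult_left_mono) auto
    then show ?thesis
      unfolding limit_kernel_def kernel_bound_def fst_conv snd_conv
      by (simp add: norm_mult norm_divide norm_power np norm_exp_eq_Re)
  qed
  then show "AE w in lborel \<Otimes>\<^sub>M lborel. norm (limit_kernel \<beta> \<xi> D w) \<le> norm (exp \<beta> * exp (1 - \<xi> / 4) * kernel_bound \<xi> w)"
    by (intro AE_I2) (auto intro: order_trans[OF _ abs_ge_self])
qed

subsection \<open>Evaluation of the limit integral\<close>

text \<open>The Taylor coefficients of \<open>z\<^bsup>j\<^esup> / (1 - z)\<^sup>2\<close> as integrals over the circle of radius \<open>exp(- 1 / n)\<close>, in the scale \<open>1 / n\<close>.
  With \<open>l = \<lfloor>c n\<rfloor>\<close> the limit \<open>n \<rightarrow> \<infinity>\<close> inverts the Laplace transform \<open>p\<^bsup>-2\<^esup>\<close>.\<close>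

lemma laplace_inversion_discrete:
  fixes n :: nat and l :: int
  assumes "n > 0"
  shows "(\<integral>u. indicator {- (pi * real n)..pi * real n} u *\<^sub>R
      (exp (of_real (real_of_int l / real n) * (1 - \<i> * of_real u)) / (2 * of_nat n * sinh ((1 - \<i> * of_real u) / (2 * of_nat n)))\<^sup>2) \<partial>lborel)
     = 2 * of_real pi * of_real (real (nat l) / real n)"
proof -
  define \<rho> where "\<rho> = exp (- 1 / real n)"
  have \<rho>: "0 < \<rho>" "\<rho> < 1" using assms by (auto simp: \<rho>_def)
  \<comment> \<open>At least one of \<open>m\<close> and \<open>j\<close> is 0. The coefficient of
    z^m in z^j / (1 - z)^2 is m + 1 - j, truncated at 0, which is l for l > 0 and 0 otherwise: the
    positive part is the truncated subtraction.\<close>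
  define m where "m = nat (l - 1)"
  define j where "j = nat (1 - l)"
  have mj: "int m - int j = l - 1" "Suc m - j = nat l" by (auto simp: m_def j_def)
  let ?a = "\<lambda>k. of_nat (Suc k - j) :: complex"
  have ser: "(\<lambda>k. ?a k * z ^ k) sums (z ^ j * (1 / (1 - z)\<^sup>2))" if "norm z < 1" for z
  proof -
    have "(\<lambda>k. z ^ j * (of_nat (Suc k) * z ^ k)) sums (z ^ j * (1 / (1 - z)\<^sup>2))"
      by (intro sums_mult geometric_deriv_sums that)
    moreover have "z ^ j * (of_nat (Suc k) * z ^ k) = ?a (k + j) * z ^ (k + j)" for k
      by (simp add: power_add)
    ultimately have "(\<lambda>k. ?a (k + j) * z ^ (k + j)) sums (z ^ j * (1 / (1 - z)\<^sup>2))" by (simp only:)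
    then show ?thesis by (subst (asm) sums_zero_iff_shift) auto
  qed
  have "summable (\<lambda>k. norm (?a k) * \<rho> ^ k)"
  proof (rule summable_comparison_test')
    show "summable (\<lambda>k. of_nat (Suc k) * \<rho> ^ k)"
      using geometric_deriv_sums[of \<rho>] \<rho> by (auto simp: sums_iff)
    show "norm (norm (?a k) * \<rho> ^ k) \<le> of_nat (Suc k) * \<rho> ^ k" for k
      using \<rho> by (simp add: abs_mult mult_right_mono)
  qed
  then have F: "(\<integral>\<theta>. indicator {-pi..pi} \<theta> *\<^sub>R ((of_real \<rho> * cis \<theta>) ^ j * (1 / (1 - of_real \<rho> * cis \<theta>)\<^sup>2) * cis (- (real m * \<theta>))) \<partial>lborel)
     = 2 * of_real pi * ?a m * of_real \<rho> ^ m"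
  proof (rule fourier_coefficient)
    show "(\<lambda>k. ?a k * (of_real \<rho> * cis \<theta>) ^ k) sums ((of_real \<rho> * cis \<theta>) ^ j * (1 / (1 - of_real \<rho> * cis \<theta>)\<^sup>2))" for \<theta>
      by (rule ser) (use \<rho> in \<open>simp add: norm_mult\<close>)
  qed (use \<rho> in simp)
  have "(\<integral>u. indicator {- (pi * real n)..pi * real n} u *\<^sub>R
      (exp (of_real (real_of_int l / real n) * (1 - \<i> * of_real u)) / (2 * of_nat n * sinh ((1 - \<i> * of_real u) / (2 * of_nat n)))\<^sup>2) \<partial>lborel)
    = (\<integral>u. indicator {- (pi * real n)..pi * real n} u *\<^sub>R (1 / (of_real \<rho> ^ m * of_nat n) *
        ((of_real \<rho> * cis (u / real n)) ^ j * (1 / (1 - of_real \<rho> * cis (u / real n))\<^sup>2) * cis (- (real m * (u / real n))) / of_nat n)) \<partial>lborel)"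
  proof (intro Bochner_Integration.integral_cong refl arg_cong2[where f = scaleR])
    fix u
    define \<zeta> where "\<zeta> = (1 - \<i> * of_real u) / (2 * of_nat n)"
    define e where "e = exp (- \<zeta>)"
    have e0: "e \<noteq> 0" by (simp add: e_def)
    have z: "of_real \<rho> * cis (u / real n) = e\<^sup>2"
    proof -
      have "complex_of_real (- 1 / real n) + \<i> * complex_of_real (u / real n) = of_nat 2 * (- \<zeta>)"
        using assms by (simp add: \<zeta>_def field_simps)
      then show ?thesis
        unfolding \<rho>_def cis_conv_exp e_def by (simp only: exp_of_real[symmetric] exp_add[symmetric] exp_of_nat_mult[symmetric])
    qed
    have inv: "exp \<zeta> = 1 / e" by (simp add: e_def exp_minus field_simps)
    have sh: "2 * sinh \<zeta> = 1 / e - e"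
      unfolding sinh_field_def inv e_def by (simp add: exp_minus)
    have z1: "1 - e\<^sup>2 = e * (2 * sinh \<zeta>)"
      unfolding sh using e0 by (simp add: field_simps power2_eq_square)
    have r: "cis (- (real m * (u / real n))) / of_real \<rho> ^ m = 1 / (e\<^sup>2) ^ m"
    proof -
      have "cis (- (real m * (u / real n))) = inverse (cis (u / real n) ^ m)" by (simp add: Complex.DeMoivre)
      then show ?thesis unfolding z[symmetric] by (simp only: power_mult_distrib inverse_mult_distrib divide_inverse mult_1_left mult.commute)
    qed
    have el: "exp (of_real (real_of_int l / real n) * (1 - \<i> * of_real u)) = (e\<^sup>2) ^ j / (e\<^sup>2) ^ m / e\<^sup>2"
    proof -
      have "(e\<^sup>2) ^ j / (e\<^sup>2) ^ m / e\<^sup>2 = exp (of_nat (2 * j) * (- \<zeta>)) / exp (of_nat (2 * m) * (- \<zeta>)) / exp (of_nat 2 * (- \<zeta>))"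
        unfolding e_def exp_of_nat_mult by (simp add: power_mult)
      also have "\<dots> = exp (of_nat (2 * j) * (- \<zeta>) - of_nat (2 * m) * (- \<zeta>) - of_nat 2 * (- \<zeta>))"
        by (simp only: exp_diff)
      also have "of_nat (2 * j) * (- \<zeta>) - of_nat (2 * m) * (- \<zeta>) - of_nat 2 * (- \<zeta>) = 2 * of_int (int m - int j + 1) * \<zeta>"
        by (simp add: algebra_simps)
      also have "\<dots> = of_real (real_of_int l / real n) * (1 - \<i> * of_real u)"
        unfolding mj(1) \<zeta>_def using assms by simp
      finally show ?thesis by simp
    qed
    have "1 / (of_real \<rho> ^ m * of_nat n) *
        ((of_real \<rho> * cis (u / real n)) ^ j * (1 / (1 - of_real \<rho> * cis (u / real n))\<^sup>2) * cis (- (real m * (u / real n))) / of_nat n)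
      = (e\<^sup>2) ^ j * (1 / (1 - e\<^sup>2)\<^sup>2) * (cis (- (real m * (u / real n))) / of_real \<rho> ^ m) / (of_nat n)\<^sup>2"
      unfolding z by (simp add: power2_eq_square)
    also have "\<dots> = (e\<^sup>2) ^ j / (e\<^sup>2) ^ m / e\<^sup>2 / (2 * of_nat n * sinh \<zeta>)\<^sup>2"
      unfolding r z1 by (simp add: power_mult_distrib)
    finally show "exp (of_real (real_of_int l / real n) * (1 - \<i> * of_real u)) / (2 * of_nat n * sinh ((1 - \<i> * of_real u) / (2 * of_nat n)))\<^sup>2
      = 1 / (of_real \<rho> ^ m * of_nat n) *
        ((of_real \<rho> * cis (u / real n)) ^ j * (1 / (1 - of_real \<rho> * cis (u / real n))\<^sup>2) * cis (- (real m * (u / real n))) / of_nat n)"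
      unfolding el \<zeta>_def[symmetric] by simp
  qed
  also have "\<dots> = 1 / (of_real \<rho> ^ m * of_nat n) * (2 * of_real pi * ?a m * of_real \<rho> ^ m)"
    unfolding integral_indicator_mult F[symmetric] integral_Icc_rescale[OF assms] ..
  also have "\<dots> = 2 * of_real pi * of_real (real (nat l) / real n)"
    using \<rho> unfolding mj(2) by simp
  finally show ?thesis .
qed

text \<open>In the rescaled variable the circles flatten to the line Re p = 1, so Taylor
  coefficients take the place of closing a contour. The double pole gives the integrable majorant 1
  / (1 + u^2), up to a constant.\<close>

lemma laplace_inversion_square:
  fixes c :: real
  shows "(\<integral>u. exp (of_real c * (1 - \<i> * of_real u)) / (1 - \<i> * of_real u)\<^sup>2 \<partial>lborel) = 2 * of_real pi * of_real (max c 0)"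
proof -
  let ?I = "\<lambda>n. indicator {- (pi * real n)..pi * real n} :: real \<Rightarrow> real"
  \<comment> \<open>An integer is required for a Taylor coefficient; rounding down keeps the
    exponent below \<open>c\<close> for every n.\<close>
  define l where "l n = \<lfloor>c * real n\<rfloor>" for n
  define G where "G n u = ?I n u *\<^sub>R (exp (of_real (real_of_int (l n) / real n) * (1 - \<i> * of_real u)) /
     (2 * of_nat n * sinh ((1 - \<i> * of_real u) / (2 * of_nat n)))\<^sup>2)" for n :: nat and u
  have lim: "(\<lambda>n. real_of_int (l n) / real n) \<longlonglongrightarrow> c"
    unfolding l_def by real_asymp
  have limn: "(\<lambda>n. real (nat (l n)) / real n) \<longlonglongrightarrow> max c 0"
  proof -
    have "(\<lambda>n. max (real_of_int (l n) / real n) 0) \<longlonglongrightarrow> max c 0"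
      by (intro tendsto_max lim tendsto_const)
    moreover have "max (real_of_int (l n) / real n) 0 = real (nat (l n)) / real n" for n
      by (cases "l n \<ge> 0") (auto simp: max_def divide_le_0_iff zero_le_divide_iff not_le)
    ultimately show ?thesis by simp
  qed
  have meas: "G n \<in> borel_measurable lborel" if "n > 0" for n
  proof -
    have "Re ((1 - \<i> * complex_of_real u) / (2 * of_nat n)) > 0" for u
      using that by (simp add: Re_divide power2_eq_square)
    then have "sinh ((1 - \<i> * complex_of_real u) / (2 * of_nat n)) \<noteq> 0" for u
      using sinh_neq_0_complex by blast
    then have "continuous_on UNIV (\<lambda>u. exp (of_real (real_of_int (l n) / real n) * (1 - \<i> * of_real u)) /
     (2 * of_nat n * sinh ((1 - \<i> * of_real u) / (2 * of_nat n)))\<^sup>2)"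
      using that by (intro continuous_intros) auto
    from borel_measurable_continuous_onI[OF this] show ?thesis
      unfolding G_def by (intro borel_measurable_scaleR) simp_all
  qed
  have bound: "norm (G n u) \<le> 4 * exp \<bar>c\<bar> * (1 / (1 + u\<^sup>2))" if n: "n > 0" for n u
  proof (cases "\<bar>u\<bar> \<le> pi * real n")
    case True
    define s where "s = 2 * real n * norm (sinh ((1 - \<i> * of_real u) / (2 * of_nat n)))"
    have p: "0 < sqrt (1 + u\<^sup>2)" by (simp add: add_pos_nonneg)
    have "sqrt (1 + u\<^sup>2) / 2 \<le> s" unfolding s_def by (rule norm_sinh_lower[OF n True])
    then have "(sqrt (1 + u\<^sup>2) / 2)\<^sup>2 \<le> s\<^sup>2" by (intro power_mono) auto
    then have s: "(1 + u\<^sup>2) / 4 \<le> s\<^sup>2" by (simp add: power_divide)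
    have "real_of_int (l n) / real n \<le> c * real n / real n"
      unfolding l_def by (intro divide_right_mono) auto
    then have "real_of_int (l n) / real n \<le> \<bar>c\<bar>" using n by simp
    then have e: "exp (real_of_int (l n) / real n) \<le> exp \<bar>c\<bar>" by simp
    have "norm (G n u) = exp (real_of_int (l n) / real n) / s\<^sup>2"
      using True unfolding G_def s_def by (simp add: indicator_def abs_le_iff norm_divide norm_mult norm_power norm_exp_eq_Re)
    also have "\<dots> \<le> exp \<bar>c\<bar> / ((1 + u\<^sup>2) / 4)"
      using s e p by (intro frac_le) (auto simp: add_pos_nonneg)
    finally show ?thesis by (simp add: mult_ac)
  next
    case False
    then have "G n u = 0" unfolding G_def by (auto simp: indicator_def abs_le_iff)
    then show ?thesis by simp
  qed
  have "(\<lambda>n. integral\<^sup>L lborel (G (n + 1))) \<longlonglongrightarrow> (\<integral>u. exp (of_real c * (1 - \<i> * of_real u)) / (1 - \<i> * of_real u)\<^sup>2 \<partial>lborel)"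
  proof (rule integral_dominated_convergence[where w = "\<lambda>u. 4 * exp \<bar>c\<bar> * (1 / (1 + u\<^sup>2))"])
    show "(\<lambda>u. exp (of_real c * (1 - \<i> * of_real u)) / (1 - \<i> * of_real u)\<^sup>2) \<in> borel_measurable lborel"
      using borel_measurable_continuous_onI[of "\<lambda>u. exp (of_real c * (1 - \<i> * of_real u)) / (1 - \<i> * of_real u)\<^sup>2"]
        one_minus_imaginary_neq_0 by (auto intro!: continuous_intros)
    show "AE u in lborel. (\<lambda>n. G (n + 1) u) \<longlonglongrightarrow> exp (of_real c * (1 - \<i> * of_real u)) / (1 - \<i> * of_real u)\<^sup>2"
    proof (rule AE_I2)
      fix u
      have inf2: "filterlim (\<lambda>n. 2 * of_nat n :: complex) at_infinity sequentially"
        by (rule tendsto_mult_filterlim_at_infinity[OF tendsto_const _ tendsto_of_nat]) simp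
      have "(\<lambda>n. exp (of_real (real_of_int (l n) / real n) * (1 - \<i> * of_real u)) /
         (2 * of_nat n * sinh ((1 - \<i> * of_real u) / (2 * of_nat n)))\<^sup>2) \<longlonglongrightarrow> exp (of_real c * (1 - \<i> * of_real u)) / (1 - \<i> * of_real u)\<^sup>2"
        using one_minus_imaginary_neq_0[of u]
        by (intro tendsto_intros lim tendsto_mult_sinh_divide[OF _ inf2]) auto
      moreover have "\<forall>\<^sub>F n in sequentially. exp (of_real (real_of_int (l n) / real n) * (1 - \<i> * of_real u)) /
         (2 * of_nat n * sinh ((1 - \<i> * of_real u) / (2 * of_nat n)))\<^sup>2 = G n u"
      proof -
        have "filterlim (\<lambda>n. pi * real n) at_top sequentially" by real_asymp
        then have "\<forall>\<^sub>F n in sequentially. \<bar>u\<bar> \<le> pi * real n" by (auto simp: filterlim_at_top)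
        then show ?thesis by eventually_elim (simp add: G_def indicator_def abs_le_iff)
      qed
      ultimately have "(\<lambda>n. G n u) \<longlonglongrightarrow> exp (of_real c * (1 - \<i> * of_real u)) / (1 - \<i> * of_real u)\<^sup>2"
        by (rule Lim_transform_eventually)
      then show "(\<lambda>n. G (n + 1) u) \<longlonglongrightarrow> exp (of_real c * (1 - \<i> * of_real u)) / (1 - \<i> * of_real u)\<^sup>2"
        by (rule LIMSEQ_ignore_initial_segment)
    qed
    show "integrable lborel (\<lambda>u. 4 * exp \<bar>c\<bar> * (1 / (1 + u\<^sup>2)))"
      by (intro integrable_mult_right integrable_inverse_one_plus_square)
  qed (use meas bound in auto)
  moreover have "(\<lambda>n. integral\<^sup>L lborel (G (n + 1))) \<longlonglongrightarrow> 2 * of_real pi * of_real (max c 0)"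
  proof -
    have "integral\<^sup>L lborel (G (n + 1)) = 2 * of_real pi * of_real (real (nat (l (n + 1))) / real (n + 1))" for n
      unfolding G_def by (rule laplace_inversion_discrete) simp
    moreover have "(\<lambda>n. 2 * complex_of_real pi * of_real (real (nat (l (n + 1))) / real (n + 1))) \<longlonglongrightarrow> 2 * of_real pi * of_real (max c 0)"
      by (intro tendsto_intros LIMSEQ_ignore_initial_segment[OF limn])
    ultimately show ?thesis by simp
  qed
  ultimately show ?thesis by (rule LIMSEQ_unique)
qed

section \<open>The Fourier transform of a Gaussian with complex parameter\<close>

definition gauss_ft :: "real \<Rightarrow> complex \<Rightarrow> complex" where
  "gauss_ft \<delta> c = (\<integral>v. exp (- c * of_real (v\<^sup>2)) * cis (v * \<delta>) \<partial>lborel)"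

lemma norm_exp_minus_one_le: "norm (exp z - 1) \<le> norm z * exp (norm z)" for z :: complex
  using Taylor_exp_field[of z 0] by (simp add: mult.commute)

lemma integrable_gaussian_moment:
  assumes "c > 0"
  shows "integrable lborel (\<lambda>v::real. v\<^sup>2 * exp (- c * v\<^sup>2))"
proof (rule Bochner_Integration.integrable_bound)
  show "integrable lborel (\<lambda>v::real. 2 / c * exp (- (c / 2) * v\<^sup>2))"
    by (intro integrable_mult_right integral_gaussian) (use assms in simp)
  have "v\<^sup>2 * exp (- c * v\<^sup>2) \<le> 2 / c * exp (- (c / 2) * v\<^sup>2)" for v
  proof -
    have "c / 2 * v\<^sup>2 \<le> exp (c / 2 * v\<^sup>2)" using exp_ge_add_one_self[of "c / 2 * v\<^sup>2"] by linarith
    then have "v\<^sup>2 \<le> 2 / c * exp (c / 2 * v\<^sup>2)" using assms by (simp add: field_simps)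
    then have "v\<^sup>2 * exp (- c * v\<^sup>2) \<le> 2 / c * exp (c / 2 * v\<^sup>2) * exp (- c * v\<^sup>2)" by (intro mult_right_mono) auto
    also have "\<dots> = 2 / c * exp (- (c / 2) * v\<^sup>2)" by (simp add: exp_add[symmetric] field_simps)
    finally show ?thesis .
  qed
  then show "AE v in lborel. norm (v\<^sup>2 * exp (- c * v\<^sup>2)) \<le> norm (2 / c * exp (- (c / 2) * v\<^sup>2))"
    using assms by (intro AE_I2) (simp add: abs_mult)
qed simp

lemma measurable_gauss:
  "(\<lambda>v. f v * (exp (- c * of_real (v\<^sup>2)) * cis (v * \<delta>))) \<in> borel_measurable lborel" if "continuous_on UNIV f" for f :: "real \<Rightarrow> complex"
proof -
  have "continuous_on UNIV (\<lambda>v. f v * (exp (- c * of_real (v\<^sup>2)) * cis (v * \<delta>)))"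
    by (intro continuous_intros that)
  from borel_measurable_continuous_onI[OF this] show ?thesis
    by simp
qed

lemma norm_gauss: "norm (exp (- c * of_real (v\<^sup>2)) * cis (v * \<delta>)) = exp (- Re c * v\<^sup>2)"
  by (simp add: norm_mult norm_exp_eq_Re)

lemma integrable_gauss:
  assumes "Re c > 0"
  shows "integrable lborel (\<lambda>v. exp (- c * of_real (v\<^sup>2)) * cis (v * \<delta>))"
proof (rule Bochner_Integration.integrable_bound[OF integral_gaussian(1)[OF assms]])
  show "(\<lambda>v. exp (- c * of_real (v\<^sup>2)) * cis (v * \<delta>)) \<in> borel_measurable lborel"
    using measurable_gauss[of "\<lambda>_. 1" c \<delta>] by simp
  show "AE v in lborel. norm (exp (- c * of_real (v\<^sup>2)) * cis (v * \<delta>)) \<le> norm (exp (- Re c * v\<^sup>2))"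
    unfolding norm_gauss by simp
qed

lemma integrable_gauss_square:
  assumes "Re c > 0"
  shows "integrable lborel (\<lambda>v. of_real (v\<^sup>2) * (exp (- c * of_real (v\<^sup>2)) * cis (v * \<delta>)))"
proof (rule Bochner_Integration.integrable_bound[OF integrable_gaussian_moment[OF assms]])
  show "(\<lambda>v. of_real (v\<^sup>2) * (exp (- c * of_real (v\<^sup>2)) * cis (v * \<delta>))) \<in> borel_measurable lborel"
    by (rule measurable_gauss) (auto intro!: continuous_intros)
  show "AE v in lborel. norm (of_real (v\<^sup>2) * (exp (- c * of_real (v\<^sup>2)) * cis (v * \<delta>))) \<le> norm (v\<^sup>2 * exp (- Re c * v\<^sup>2))"
    unfolding norm_mult[of "of_real _"] norm_gauss by (intro AE_I2) (simp add: abs_mult del: of_real_power)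
qed

text \<open>Integration by parts. It expresses the derivative of \<open>gauss_ft\<close> in the
  parameter \<open>c\<close> by \<open>gauss_ft\<close> itself, so that a linear differential
  equation results.\<close>

lemma gauss_second_moment:
  assumes "Re c > 0"
  shows "(\<integral>v. of_real (v\<^sup>2) * (exp (- c * of_real (v\<^sup>2)) * cis (v * \<delta>)) \<partial>lborel) = (1 / (2 * c) - of_real (\<delta>\<^sup>2) / (4 * c\<^sup>2)) * gauss_ft \<delta> c"
proof -
  \<comment> \<open>This shift cancels the linear term in the derivative of \<open>(v + s) exp(- c v\<^sup>2 + i v \<delta>)\<close>.\<close>
  define s where "s = \<i> * of_real \<delta> / (2 * c)"
  have c0: "c \<noteq> 0" using assms by auto
  let ?e = "\<lambda>v. exp (- c * of_real (v\<^sup>2)) * cis (v * \<delta>)"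
  let ?f = "\<lambda>v. (1 - of_real (\<delta>\<^sup>2) / (2 * c)) * ?e v - 2 * c * (of_real (v\<^sup>2) * ?e v)"
  let ?F = "\<lambda>v. (of_real v + s) * ?e v"
  have int: "integrable lborel ?f"
    by (intro Bochner_Integration.integrable_diff integrable_mult_right integrable_gauss integrable_gauss_square assms)
  have lim: "((\<lambda>v. (\<bar>v\<bar> + norm s) * exp (- Re c * v\<^sup>2)) \<longlongrightarrow> 0) at_top" "((\<lambda>v. (\<bar>v\<bar> + norm s) * exp (- Re c * v\<^sup>2)) \<longlongrightarrow> 0) at_bot"
    using assms by real_asymp+
  have nF: "norm (?F v) \<le> (\<bar>v\<bar> + norm s) * exp (- Re c * v\<^sup>2)" for v
    unfolding norm_mult[of "of_real v + s"] norm_gauss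
    by (intro mult_right_mono order_trans[OF norm_triangle_ineq]) auto
  have "(LBINT v=-\<infinity>..\<infinity>. ?f v) = 0 - 0"
  proof (rule interval_integral_FTC_integrable[where F = ?F])
    fix v :: real
    have "((\<lambda>v. (of_real v + s) * (exp (- c * of_real (v\<^sup>2)) * exp (\<i> * of_real (v * \<delta>)))) has_vector_derivative
        (exp (- c * of_real (v\<^sup>2)) * exp (\<i> * of_real (v * \<delta>)) + (of_real v + s) * ((- c * of_real (2 * v) * exp (- c * of_real (v\<^sup>2))) * exp (\<i> * of_real (v * \<delta>))
          + exp (- c * of_real (v\<^sup>2)) * (\<i> * of_real \<delta> * exp (\<i> * of_real (v * \<delta>)))))) (at v)"
      by (auto intro!: derivative_eq_intros has_vector_derivative_real_field simp: algebra_simps)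
    moreover have "exp (- c * of_real (v\<^sup>2)) * exp (\<i> * of_real (v * \<delta>)) + (of_real v + s) * ((- c * of_real (2 * v) * exp (- c * of_real (v\<^sup>2))) * exp (\<i> * of_real (v * \<delta>))
          + exp (- c * of_real (v\<^sup>2)) * (\<i> * of_real \<delta> * exp (\<i> * of_real (v * \<delta>)))) = ?f v"
    proof -
      have alg: "(1 + a * (b + d)) * (x * y) = x * y + a * ((b * x) * y + x * (d * y))" "(k - l * m) * x = k * x - l * (m * x)"
        for a b d x y k l m :: complex
        by (simp_all add: algebra_simps)
      have "1 + (of_real v + s) * (- c * of_real (2 * v) + \<i> * of_real \<delta>) = (1 - of_real (\<delta>\<^sup>2) / (2 * c)) - 2 * c * of_real (v\<^sup>2)"
        unfolding s_def using c0 by (simp add: field_simps power2_eq_square)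
      then have "(1 + (of_real v + s) * (- c * of_real (2 * v) + \<i> * of_real \<delta>)) * (exp (- c * of_real (v\<^sup>2)) * exp (\<i> * of_real (v * \<delta>)))
         = ((1 - of_real (\<delta>\<^sup>2) / (2 * c)) - 2 * c * of_real (v\<^sup>2)) * (exp (- c * of_real (v\<^sup>2)) * exp (\<i> * of_real (v * \<delta>)))"
        by (simp only:)
      then show ?thesis unfolding cis_conv_exp alg .
    qed
    ultimately show "(?F has_vector_derivative ?f v) (at v)" unfolding cis_conv_exp by (simp only:)
    have "continuous_on UNIV ?f" using c0 by (intro continuous_intros) auto
    then show "isCont ?f v" by (rule continuous_on_interior) simp
  next
    show "set_integrable lborel (einterval (-\<infinity>) \<infinity>) ?f"
      unfolding set_integrable_def einterval_eq_UNIV indicator_UNIV scaleR_one by (rule int)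
    show "((?F \<circ> real_of_ereal) \<longlongrightarrow> 0) (at_right (-\<infinity>))"
      using Lim_null_comparison[OF _ lim(2), of ?F] nF by (simp add: ereal_tendsto_simps)
    show "((?F \<circ> real_of_ereal) \<longlongrightarrow> 0) (at_left \<infinity>)"
      using Lim_null_comparison[OF _ lim(1), of ?F] nF by (simp add: ereal_tendsto_simps)
  qed simp
  then have "integral\<^sup>L lborel ?f = 0"
    unfolding interval_lebesgue_integral_def einterval_eq_UNIV set_lebesgue_integral_def indicator_UNIV scaleR_one by simp
  then have "(1 - of_real (\<delta>\<^sup>2) / (2 * c)) * gauss_ft \<delta> c - 2 * c * (\<integral>v. of_real (v\<^sup>2) * ?e v \<partial>lborel) = 0"
    unfolding gauss_ft_def
    by (subst (asm) Bochner_Integration.integral_diff)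
      (use integrable_gauss[OF assms, of \<delta>] integrable_gauss_square[OF assms, of \<delta>] in \<open>auto simp del: of_real_power intro!: integrable_mult_right\<close>)
  then show ?thesis using c0 by (simp add: field_simps power2_eq_square)
qed

lemma has_derivative_gauss_ft:
  assumes "Re c > 0"
  shows "(gauss_ft \<delta> has_field_derivative - (1 / (2 * c) - of_real (\<delta>\<^sup>2) / (4 * c\<^sup>2)) * gauss_ft \<delta> c) (at c)"
proof -
  let ?e = "\<lambda>c v. exp (- c * of_real (v\<^sup>2)) * cis (v * \<delta>)"
  \<comment> \<open>For increments h with \<bar>h\<bar> < r the difference quotient of exp (- h v^2)
    is at most v^2 exp (r v^2) in modulus, which spends half of the Gaussian decay and leaves the
    majorant v^2 exp (- r v^2).\<close>
  define r where "r = Re c / 2"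
  have r: "r > 0" using assms by (simp add: r_def)
  have "((\<lambda>h. (gauss_ft \<delta> (c + h) - gauss_ft \<delta> c) / h) \<longlongrightarrow> - (\<integral>v. of_real (v\<^sup>2) * ?e c v \<partial>lborel)) (at 0)"
    unfolding tendsto_at_iff_sequentially
  proof (intro allI impI)
    fix X :: "nat \<Rightarrow> complex"
    assume X0: "\<forall>i. X i \<in> UNIV - {0}" and X: "X \<longlonglongrightarrow> 0"
    have "\<forall>\<^sub>F n in sequentially. norm (X n) < r"
      using order_tendstoD(2)[OF tendsto_norm_zero[OF X] r] .
    then obtain k where k: "\<And>n. n \<ge> k \<Longrightarrow> norm (X n) < r"
      unfolding eventually_sequentially by blast
    let ?g = "\<lambda>n v. (exp (- X n * of_real (v\<^sup>2)) - 1) / X n * ?e c v"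
    have split: "?e (c + X n) v = ?e c v + X n * ?g n v" for n v
    proof -
      have "- (c + X n) * of_real (v\<^sup>2) = - X n * of_real (v\<^sup>2) + - c * of_real (v\<^sup>2)"
        by (simp only: ring_distribs add.commute minus_add_distrib)
      then have 1: "?e (c + X n) v = exp (- X n * of_real (v\<^sup>2)) * ?e c v"
        by (simp only: exp_add mult.assoc)
      have 2: "E + x * ((y - 1) / x * E) = y * E" if "x \<noteq> 0" for E x y :: complex
        using that by (simp add: field_simps)
      show ?thesis unfolding 1 using X0 by (subst 2) auto
    qed
    have gb: "norm (?g (n + k) v) \<le> v\<^sup>2 * exp (- r * v\<^sup>2)" for n v
    proof -
      have "norm (exp (- X (n + k) * of_real (v\<^sup>2)) - 1) \<le> norm (X (n + k)) * v\<^sup>2 * exp (norm (X (n + k)) * v\<^sup>2)"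
        using norm_exp_minus_one_le[of "- X (n + k) * of_real (v\<^sup>2)"] by (simp add: norm_mult norm_power)
      also have "\<dots> \<le> norm (X (n + k)) * v\<^sup>2 * exp (r * v\<^sup>2)"
        using k[of "n + k"] by (intro mult_left_mono) (auto intro!: mult_right_mono)
      finally have "norm (exp (- X (n + k) * of_real (v\<^sup>2)) - 1) / norm (X (n + k)) \<le> v\<^sup>2 * exp (r * v\<^sup>2)"
        using X0 by (simp add: field_simps)
      then have "norm (?g (n + k) v) \<le> v\<^sup>2 * exp (r * v\<^sup>2) * exp (- Re c * v\<^sup>2)"
        unfolding norm_mult[of "_ / _"] norm_gauss norm_divide by (intro mult_right_mono) auto
      also have "\<dots> = v\<^sup>2 * exp (- r * v\<^sup>2)" by (simp add: exp_add[symmetric] r_def algebra_simps)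
      finally show ?thesis .
    qed
    have mg: "?g n \<in> borel_measurable lborel" for n
      using X0 by (intro measurable_gauss continuous_intros) auto
    have "(\<lambda>n. integral\<^sup>L lborel (?g (n + k))) \<longlonglongrightarrow> (\<integral>v. - of_real (v\<^sup>2) * ?e c v \<partial>lborel)"
    proof (rule integral_dominated_convergence[OF _ _ integrable_gaussian_moment[OF r]])
      show "(\<lambda>v. - of_real (v\<^sup>2) * ?e c v) \<in> borel_measurable lborel"
        by (intro measurable_gauss continuous_intros)
      show "AE v in lborel. (\<lambda>n. ?g (n + k) v) \<longlonglongrightarrow> - of_real (v\<^sup>2) * ?e c v"
      proof (rule AE_I2)
        fix v :: real
        have "((\<lambda>h. exp (- h * complex_of_real (v\<^sup>2))) has_field_derivative - of_real (v\<^sup>2)) (at 0)"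
          by (auto intro!: derivative_eq_intros)
        then have "((\<lambda>h. (exp (- h * complex_of_real (v\<^sup>2)) - 1) / h) \<longlongrightarrow> - of_real (v\<^sup>2)) (at 0)"
          by (simp add: has_field_derivative_iff)
        then have "(\<lambda>n. (exp (- X n * complex_of_real (v\<^sup>2)) - 1) / X n) \<longlonglongrightarrow> - of_real (v\<^sup>2)"
          using X0 X unfolding tendsto_at_iff_sequentially by (auto simp: o_def)
        then have "(\<lambda>n. ?g n v) \<longlonglongrightarrow> - of_real (v\<^sup>2) * ?e c v"
          by (intro tendsto_mult tendsto_const)
        then show "(\<lambda>n. ?g (n + k) v) \<longlonglongrightarrow> - of_real (v\<^sup>2) * ?e c v"
          by (rule LIMSEQ_ignore_initial_segment)
      qed
    qed (use mg gb in auto)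
    moreover have "integral\<^sup>L lborel (?g (n + k)) = (gauss_ft \<delta> (c + X (n + k)) - gauss_ft \<delta> c) / X (n + k)" for n
    proof -
      have ig: "integrable lborel (?g (n + k))"
      proof (rule Bochner_Integration.integrable_bound[OF integrable_gaussian_moment[OF r] mg])
        show "AE v in lborel. norm (?g (n + k) v) \<le> norm (v\<^sup>2 * exp (- r * v\<^sup>2))"
          unfolding real_norm_def by (intro AE_I2 order_trans[OF gb abs_ge_self])
      qed
      have "gauss_ft \<delta> (c + X (n + k)) = gauss_ft \<delta> c + X (n + k) * integral\<^sup>L lborel (?g (n + k))"
        unfolding gauss_ft_def split
        by (subst Bochner_Integration.integral_add[OF integrable_gauss[OF assms] integrable_mult_right[OF ig]])
          (simp only: integral_mult_right_zero)
      then show ?thesis using X0 by simp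
    qed
    ultimately have "(\<lambda>n. (gauss_ft \<delta> (c + X (n + k)) - gauss_ft \<delta> c) / X (n + k)) \<longlonglongrightarrow> (\<integral>v. - of_real (v\<^sup>2) * ?e c v \<partial>lborel)"
      by (simp only:)
    then have "(\<lambda>n. (gauss_ft \<delta> (c + X n) - gauss_ft \<delta> c) / X n) \<longlonglongrightarrow> (\<integral>v. - of_real (v\<^sup>2) * ?e c v \<partial>lborel)"
      by (rule LIMSEQ_offset)
    then show "((\<lambda>h. (gauss_ft \<delta> (c + h) - gauss_ft \<delta> c) / h) \<circ> X) \<longlonglongrightarrow> - (\<integral>v. of_real (v\<^sup>2) * ?e c v \<partial>lborel)"
      by (simp add: o_def)
  qed
  then show ?thesis
    unfolding gauss_second_moment[OF assms] DERIV_def by (simp only: mult_minus_left)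
qed

text \<open>The two additional factors integrate the differential equation, so the product is
  constant on the right half-plane, where the principal root is holomorphic. The constant is read
  off at c = 1/2 from the characteristic function of the standard normal law.\<close>

lemma gauss_ft_eq:
  assumes "Re c > 0"
  shows "gauss_ft \<delta> c * csqrt c * exp (of_real (\<delta>\<^sup>2) / (4 * c)) = of_real (sqrt pi)"
proof -
  let ?S = "{z. Re z > 0}"
  let ?H = "\<lambda>c. gauss_ft \<delta> c * csqrt c * exp (of_real (\<delta>\<^sup>2) / (4 * c))"
  have "\<exists>k. \<forall>z\<in>?S. ?H z = k"
  proof (rule has_field_derivative_zero_constant)
    show "convex ?S" by (rule convex_halfspace_Re_gt)
    fix z assume z: "z \<in> ?S"
    then have z0: "z \<noteq> 0" "csqrt z \<noteq> 0" "z \<notin> \<real>\<^sub>\<le>\<^sub>0" by (auto simp: complex_nonpos_Reals_iff)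
    have sq: "csqrt z * csqrt z = z" by (metis power2_csqrt power2_eq_square)
    have "(?H has_field_derivative
       (- (1 / (2 * z) - of_real (\<delta>\<^sup>2) / (4 * z\<^sup>2)) * gauss_ft \<delta> z * csqrt z + gauss_ft \<delta> z * (1 / (2 * csqrt z))) * exp (of_real (\<delta>\<^sup>2) / (4 * z))
        + gauss_ft \<delta> z * csqrt z * (- of_real (\<delta>\<^sup>2) / (4 * z\<^sup>2) * exp (of_real (\<delta>\<^sup>2) / (4 * z)))) (at z)"
      by (rule derivative_eq_intros has_derivative_gauss_ft has_field_derivative_csqrt refl | use z z0 in \<open>simp add: power2_eq_square field_simps\<close>)+
    moreover have "1 / (2 * csqrt z) = csqrt z / (2 * z)"
      using z0 sq by (simp add: field_simps)
    moreover have "(- (x - y) * g * q + g * (q * x)) * e + g * q * (- y * e) = 0" for x y g q e :: complex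
      by (simp add: algebra_simps)
    ultimately have "(?H has_field_derivative 0) (at z)"
      by (metis (no_types, lifting) minus_divide_left mult.right_neutral times_divide_eq_right)
    then show "(?H has_field_derivative 0) (at z within ?S)" by (rule has_field_derivative_at_within)
  qed
  then obtain k where k: "\<And>z. Re z > 0 \<Longrightarrow> ?H z = k" by blast
  have "gauss_ft \<delta> (1 / 2) = of_real (sqrt (2 * pi)) * of_real (exp (- \<delta>\<^sup>2 / 2))"
  proof -
    have "char std_normal_distribution \<delta> = (\<integral>v. std_normal_density v *\<^sub>R cis (\<delta> * v) \<partial>lborel)"
      unfolding char_def cis_conv_exp
      by (subst integral_density) (auto simp: normal_density_nonneg)
    also have "\<dots> = (\<integral>v. 1 / of_real (sqrt (2 * pi)) * (exp (- (1 / 2) * of_real (v\<^sup>2)) * cis (v * \<delta>)) \<partial>lborel)"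
      by (intro Bochner_Integration.integral_cong refl)
        (simp add: std_normal_density_def scaleR_conv_of_real exp_of_real[symmetric] mult.commute)
    also have "\<dots> = 1 / of_real (sqrt (2 * pi)) * gauss_ft \<delta> (1 / 2)"
      unfolding gauss_ft_def by (rule integral_mult_right_zero)
    finally show ?thesis unfolding char_std_normal_distribution by (simp add: field_simps)
  qed
  then have "k = of_real (sqrt (2 * pi)) * of_real (exp (- \<delta>\<^sup>2 / 2)) * csqrt (1 / 2) * exp (of_real (\<delta>\<^sup>2) / (4 * (1 / 2)))"
    using k[of "1 / 2"] by simp
  also have "csqrt (1 / 2) = of_real (sqrt (1 / 2))"
    using csqrt_of_real_nonneg[of "1 / 2"] by simp
  also have "exp (of_real (\<delta>\<^sup>2) / (4 * (1 / 2))) = complex_of_real (exp (\<delta>\<^sup>2 / 2))"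
    by (simp add: exp_of_real[symmetric])
  also have "of_real (sqrt (2 * pi)) * of_real (exp (- \<delta>\<^sup>2 / 2)) * of_real (sqrt (1 / 2)) * complex_of_real (exp (\<delta>\<^sup>2 / 2))
    = of_real (sqrt (2 * pi) * sqrt (1 / 2) * (exp (- \<delta>\<^sup>2 / 2) * exp (\<delta>\<^sup>2 / 2)))"
    by simp
  also have "\<dots> = of_real (sqrt pi)"
    by (simp add: exp_add[symmetric] real_sqrt_mult real_sqrt_divide)
  finally show ?thesis using k[OF assms] by simp
qed

text \<open>For \<open>c = \<xi> / p\<close> this trades the half-integral powers of \<open>p\<close> for integral ones.\<close>

lemma gauss_ft_reciprocal:
  assumes "Re c > 0"
  shows "gauss_ft 0 c * exp (- c * of_real (\<delta>\<^sup>2)) = 1 / (2 * c) * gauss_ft \<delta> (1 / (4 * c))"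
proof -
  define q where "q = csqrt c"
  have c0: "c \<noteq> 0" using assms by auto
  have q2: "q\<^sup>2 = c" and q0: "q \<noteq> 0" using c0 by (simp_all add: q_def)
  \<comment> \<open>The positive real part of the root fixes the branch: 1 / (2 q) then is the
    principal root of 1 / (4 c).\<close>
  have "Re q \<noteq> 0"
  proof
    assume "Re q = 0"
    then have "Re (q\<^sup>2) \<le> 0" by (simp add: power2_eq_square)
    then show False using q2 assms by simp
  qed
  moreover have "Re q \<ge> 0" unfolding q_def using csqrt_principal[of c] by auto
  ultimately have Rq: "Re q > 0" by simp
  have "csqrt (1 / (4 * c)) = 1 / (2 * q)"
  proof (rule csqrt_unique)
    show "(1 / (2 * q))\<^sup>2 = 1 / (4 * c)" by (simp add: power_divide power_mult_distrib q2)
    have "Re (1 / (2 * q)) = 2 * Re q / ((2 * Re q)\<^sup>2 + (2 * Im q)\<^sup>2)"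
      by (simp add: Re_divide)
    also have "\<dots> > 0" using Rq by (intro divide_pos_pos) (auto intro: add_pos_nonneg)
    finally show "0 < Re (1 / (2 * q)) \<or> Re (1 / (2 * q)) = 0 \<and> 0 \<le> Im (1 / (2 * q))" ..
  qed
  moreover have "Re (1 / (4 * c)) > 0"
    using assms by (simp add: Re_divide power2_eq_square add_pos_nonneg)
  ultimately have 1: "gauss_ft \<delta> (1 / (4 * c)) * (1 / (2 * q)) * exp (of_real (\<delta>\<^sup>2) * c) = of_real (sqrt pi)"
    using gauss_ft_eq[of "1 / (4 * c)" \<delta>] c0 by simp
  have 2: "gauss_ft 0 c * q = of_real (sqrt pi)"
    using gauss_ft_eq[OF assms, of 0] by (simp add: q_def)
  have e: "exp (of_real (\<delta>\<^sup>2) * c) * exp (- c * of_real (\<delta>\<^sup>2)) = 1"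
    by (simp add: exp_add[symmetric] mult.commute)
  have "gauss_ft 0 c * exp (- c * of_real (\<delta>\<^sup>2)) = (gauss_ft 0 c * q) * exp (- c * of_real (\<delta>\<^sup>2)) / q"
    using q0 by simp
  also have "\<dots> = gauss_ft \<delta> (1 / (4 * c)) * (1 / (2 * q)) * (exp (of_real (\<delta>\<^sup>2) * c) * exp (- c * of_real (\<delta>\<^sup>2))) / q"
    unfolding 2 1[symmetric] by (simp only: mult.assoc)
  also have "\<dots> = 1 / (2 * q\<^sup>2) * gauss_ft \<delta> (1 / (4 * c))"
    unfolding e by (simp add: power2_eq_square)
  finally show ?thesis unfolding q2 .
qed

section \<open>Reduction to the Fourier transform of a truncated parabola\<close>

text \<open>For fixed u the integral over v is \<open>gauss_ft\<close> at frequency 0 with c = \<xi>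
  / p. Duality turns the factor exp (- \<xi> \<delta>^2 / p) into the frequency \<delta> of the new
  variable k, and its prefactor 1 / (2 c) = p / (2 \<xi>) lowers the pole from p^-3 to p^-2. After
  Fubini the integral over u is the Laplace inversion at a - k^2 / (4 \<xi>).\<close>

lemma integral_limit_kernel:
  assumes "\<xi> > 0"
  shows "integral\<^sup>L (lborel \<Otimes>\<^sub>M lborel) (limit_kernel \<beta> \<xi> (\<xi> * \<delta>\<^sup>2)) =
    of_real (exp \<beta> * pi / \<xi>) * (\<integral>k. cis (k * \<delta>) * of_real (max (1 - \<xi> / 4 - k\<^sup>2 / (4 * \<xi>)) 0) \<partial>lborel)"
proof -
  define a where "a = 1 - \<xi> / 4"
  define h where "h u k = cis (k * \<delta>) * (exp (of_real (a - k\<^sup>2 / (4 * \<xi>)) * (1 - \<i> * of_real u)) / (1 - \<i> * of_real u)\<^sup>2)" for u k :: real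
  have inner: "(\<integral>v. limit_kernel \<beta> \<xi> (\<xi> * \<delta>\<^sup>2) (u, v) \<partial>lborel) = of_real (exp \<beta> / (2 * \<xi>)) * (\<integral>k. h u k \<partial>lborel)" for u
  proof -
    define p where "p = 1 - \<i> * complex_of_real u"
    have p0: "p \<noteq> 0" unfolding p_def by (rule one_minus_imaginary_neq_0)
    define c where "c = of_real \<xi> / p"
    have c4: "1 / (4 * c) = p / of_real (4 * \<xi>)" and c2: "1 / (2 * c) = p / of_real (2 * \<xi>)"
      using p0 assms by (simp_all add: c_def)
    have Rc: "Re c > 0"
      using assms by (simp add: c_def p_def Re_divide add_pos_nonneg)
    have E: "exp (- of_real (\<xi> * \<delta>\<^sup>2 + \<xi> * v\<^sup>2) / p) = exp (- c * of_real (\<delta>\<^sup>2)) * (exp (- c * of_real (v\<^sup>2)) * cis (v * 0))" for v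
    proof -
      have "- of_real (\<xi> * \<delta>\<^sup>2 + \<xi> * v\<^sup>2) / p = - c * of_real (\<delta>\<^sup>2) + - c * of_real (v\<^sup>2)"
        using p0 by (simp add: c_def field_simps)
      then show ?thesis by (simp only: exp_add mult_zero_right cis_zero mult_1_right)
    qed
    have "(\<integral>v. limit_kernel \<beta> \<xi> (\<xi> * \<delta>\<^sup>2) (u, v) \<partial>lborel)
        = (\<integral>v. (of_real (exp \<beta>) * (exp (of_real a * p) / p ^ 3) * exp (- c * of_real (\<delta>\<^sup>2))) * (exp (- c * of_real (v\<^sup>2)) * cis (v * 0)) \<partial>lborel)"
      unfolding limit_kernel_def fst_conv snd_conv p_def[symmetric] E a_def[symmetric] exp_of_real by (simp only: mult.assoc)
    also have "\<dots> = of_real (exp \<beta>) * (exp (of_real a * p) / p ^ 3) * (gauss_ft 0 c * exp (- c * of_real (\<delta>\<^sup>2)))"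
      unfolding integral_mult_right_zero gauss_ft_def[symmetric] by (simp only: mult_ac)
    also have "\<dots> = (of_real (exp \<beta> / (2 * \<xi>)) * (exp (of_real a * p) / p\<^sup>2)) * gauss_ft \<delta> (p / of_real (4 * \<xi>))"
      unfolding gauss_ft_reciprocal[OF Rc] c4 c2 using p0 by (simp add: power2_eq_square power3_eq_cube mult_ac)
    also have "\<dots> = (\<integral>k. (of_real (exp \<beta> / (2 * \<xi>)) * (exp (of_real a * p) / p\<^sup>2)) * (exp (- (p / of_real (4 * \<xi>)) * of_real (k\<^sup>2)) * cis (k * \<delta>)) \<partial>lborel)"
      unfolding gauss_ft_def integral_mult_right_zero ..
    also have "\<dots> = (\<integral>k. of_real (exp \<beta> / (2 * \<xi>)) * h u k \<partial>lborel)"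
    proof (intro Bochner_Integration.integral_cong refl)
      fix k
      have "of_real (a - k\<^sup>2 / (4 * \<xi>)) * p = of_real a * p + - (p / of_real (4 * \<xi>)) * of_real (k\<^sup>2)"
        using assms by (simp add: field_simps)
      then have "exp (of_real (a - k\<^sup>2 / (4 * \<xi>)) * p) = exp (of_real a * p) * exp (- (p / of_real (4 * \<xi>)) * of_real (k\<^sup>2))"
        by (simp only: exp_add)
      then show "(of_real (exp \<beta> / (2 * \<xi>)) * (exp (of_real a * p) / p\<^sup>2)) * (exp (- (p / of_real (4 * \<xi>)) * of_real (k\<^sup>2)) * cis (k * \<delta>))
          = of_real (exp \<beta> / (2 * \<xi>)) * h u k"
        unfolding h_def p_def[symmetric] by (simp only: times_divide_eq_left times_divide_eq_right mult_ac)
    qed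
    finally show ?thesis unfolding integral_mult_right_zero .
  qed
  \<comment> \<open>As Re p = 1, the modulus of the exponential does not depend on u, and the norm
    factors into a Gaussian in k and 1 / (1 + u^2).\<close>
  have nh: "norm (h u k) = exp a * exp (- (1 / (4 * \<xi>)) * k\<^sup>2) * (1 / (1 + u\<^sup>2))" for u k
    by (simp add: h_def norm_mult norm_divide norm_power norm_exp_eq_Re exp_add[symmetric] cmod_power2)
  have inth: "integrable (lborel \<Otimes>\<^sub>M lborel) (\<lambda>(u, k). h u k)"
  proof (rule lborel_pair.Fubini_integrable)
    have "(\<lambda>w. h (fst w) (snd w)) \<in> borel_measurable (lborel \<Otimes>\<^sub>M lborel)"
      unfolding h_def using one_minus_imaginary_neq_0 assms
      by (intro borel_measurable_lborel_pairI continuous_intros) auto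
    then show "(\<lambda>(u, k). h u k) \<in> borel_measurable (lborel \<Otimes>\<^sub>M lborel)"
      by (simp add: split_beta')
    have g: "integrable lborel (\<lambda>k. exp a * exp (- (1 / (4 * \<xi>)) * k\<^sup>2) * (1 / (1 + u\<^sup>2)))" for u
      by (intro integrable_mult_left integrable_mult_right integral_gaussian) (use assms in simp)
    have "integrable lborel (\<lambda>k. h u k)" for u
    proof (rule Bochner_Integration.integrable_bound[OF g])
      have "continuous_on UNIV (h u)"
        unfolding h_def using one_minus_imaginary_neq_0[of u] assms by (intro continuous_intros) auto
      from borel_measurable_continuous_onI[OF this] show "h u \<in> borel_measurable lborel" by simp
      show "AE k in lborel. norm (h u k) \<le> norm (exp a * exp (- (1 / (4 * \<xi>)) * k\<^sup>2) * (1 / (1 + u\<^sup>2)))"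
        unfolding nh real_norm_def by (intro AE_I2 abs_ge_self)
    qed
    then show "AE u in lborel. integrable lborel (\<lambda>k. case (u, k) of (u, k) \<Rightarrow> h u k)" by simp
    have "(\<integral>k. norm (h u k) \<partial>lborel) = exp a * (\<integral>k. exp (- (1 / (4 * \<xi>)) * k\<^sup>2) \<partial>lborel) * (1 / (1 + u\<^sup>2))" for u
      unfolding nh by simp
    then show "integrable lborel (\<lambda>u. \<integral>k. norm (case (u, k) of (u, k) \<Rightarrow> h u k) \<partial>lborel)"
      using integrable_mult_right[OF integrable_inverse_one_plus_square] by simp
  qed
  have "integral\<^sup>L (lborel \<Otimes>\<^sub>M lborel) (limit_kernel \<beta> \<xi> (\<xi> * \<delta>\<^sup>2)) = (\<integral>u. \<integral>v. limit_kernel \<beta> \<xi> (\<xi> * \<delta>\<^sup>2) (u, v) \<partial>lborel \<partial>lborel)"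
    by (rule lborel_pair.integral_fst'[symmetric, OF integrable_limit_kernel]) (use assms in auto)
  also have "\<dots> = of_real (exp \<beta> / (2 * \<xi>)) * (\<integral>u. \<integral>k. h u k \<partial>lborel \<partial>lborel)"
    unfolding inner integral_mult_right_zero ..
  also have "(\<integral>u. \<integral>k. h u k \<partial>lborel \<partial>lborel) = (\<integral>k. \<integral>u. h u k \<partial>lborel \<partial>lborel)"
    by (rule lborel_pair.Fubini_integral[symmetric, OF inth])
  also have "\<dots> = (\<integral>k. (2 * of_real pi) * (cis (k * \<delta>) * of_real (max (a - k\<^sup>2 / (4 * \<xi>)) 0)) \<partial>lborel)"
    by (intro Bochner_Integration.integral_cong refl, unfold h_def integral_mult_right_zero laplace_inversion_square)
      (simp only: mult_ac)
  also have "\<dots> = 2 * of_real pi * (\<integral>k. cis (k * \<delta>) * of_real (max (a - k\<^sup>2 / (4 * \<xi>)) 0) \<partial>lborel)"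
    by (rule integral_mult_right_zero)
  finally show ?thesis unfolding a_def using assms by simp
qed

lemma integral_parabola_cis:
  assumes "K > 0"
  shows "(\<integral>k. indicator {-K..K} k *\<^sub>R (of_real (K\<^sup>2 - k\<^sup>2) * cis (k * \<delta>)) \<partial>lborel) =
    complex_of_real (if \<delta> = 0 then 4 * K ^ 3 / 3 else 4 * sin (K * \<delta>) / \<delta> ^ 3 - 4 * K * cos (K * \<delta>) / \<delta>\<^sup>2)"
proof (cases "\<delta> = 0")
  case True
  have "(\<integral>k. indicator {-K..K} k *\<^sub>R (of_real (K\<^sup>2 - k\<^sup>2) * cis (k * \<delta>)) \<partial>lborel)
     = complex_of_real (K\<^sup>2 * K - K ^ 3 / 3) - complex_of_real (K\<^sup>2 * (- K) - (- K) ^ 3 / 3)"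
  proof (rule integral_FTC_Icc)
    fix x
    have "((\<lambda>k. K\<^sup>2 * k - k ^ 3 / 3) has_real_derivative (K\<^sup>2 - x\<^sup>2)) (at x within {-K..K})"
      by (auto intro!: derivative_eq_intros)
    then have "((\<lambda>k. complex_of_real (K\<^sup>2 * k - k ^ 3 / 3)) has_vector_derivative of_real (K\<^sup>2 - x\<^sup>2)) (at x within {-K..K})"
      by (intro has_vector_derivative_of_real) (simp add: has_real_derivative_iff_has_vector_derivative)
    then show "((\<lambda>k. complex_of_real (K\<^sup>2 * k - k ^ 3 / 3)) has_vector_derivative of_real (K\<^sup>2 - x\<^sup>2) * cis (x * \<delta>)) (at x within {-K..K})"
      using True by simp
  qed (use assms in \<open>auto intro!: continuous_intros\<close>)
  also have "\<dots> = complex_of_real (4 * K ^ 3 / 3)"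
    unfolding of_real_diff[symmetric] by (rule arg_cong[where f = of_real]) (simp add: power2_eq_square power3_eq_cube)
  finally show ?thesis using True by simp
next
  case False
  define s where "s = \<i> * complex_of_real \<delta>"
  have s0: "s \<noteq> 0" using False by (simp add: s_def)
  \<comment> \<open>Repeated integration by parts against exp (s k). At k = K and k = -K the
    quadratic term vanishes; the linear term then collects the cosine and the constant term the
    sine.\<close>
  let ?P = "\<lambda>k. of_real (K\<^sup>2 - k\<^sup>2) / s + 2 * of_real k / s\<^sup>2 - 2 / s ^ 3 :: complex"
  let ?F = "\<lambda>k. ?P k * exp (s * of_real k)"
  have c: "cis (k * \<delta>) = exp (s * of_real k)" for k
    unfolding cis_conv_exp s_def by (simp add: mult_ac)
  have "(\<integral>k. indicator {-K..K} k *\<^sub>R (of_real (K\<^sup>2 - k\<^sup>2) * cis (k * \<delta>)) \<partial>lborel) = ?F K - ?F (- K)"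
  proof (rule integral_FTC_Icc)
    fix x
    have "((\<lambda>z. ((of_real (K\<^sup>2) - z\<^sup>2) / s + 2 * z / s\<^sup>2 - 2 / s ^ 3) * exp (s * z)) has_field_derivative
       ((- (2 * of_real x) / s + 2 / s\<^sup>2) * exp (s * of_real x) + ((of_real (K\<^sup>2) - (of_real x)\<^sup>2) / s + 2 * of_real x / s\<^sup>2 - 2 / s ^ 3) * (s * exp (s * of_real x)))) (at (of_real x))"
      using s0 by (auto intro!: derivative_eq_intros simp: power2_eq_square)
    also have "(- (2 * of_real x) / s + 2 / s\<^sup>2) * exp (s * of_real x) + ((of_real (K\<^sup>2) - (of_real x)\<^sup>2) / s + 2 * of_real x / s\<^sup>2 - 2 / s ^ 3) * (s * exp (s * of_real x))
       = of_real (K\<^sup>2 - x\<^sup>2) * exp (s * of_real x)"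
      using s0 by (simp add: field_simps power2_eq_square power3_eq_cube)
    finally have "((\<lambda>k. ((of_real (K\<^sup>2) - (of_real k)\<^sup>2) / s + 2 * of_real k / s\<^sup>2 - 2 / s ^ 3) * exp (s * of_real k)) has_vector_derivative
        of_real (K\<^sup>2 - x\<^sup>2) * exp (s * of_real x)) (at x within {-K..K})"
      by (rule has_vector_derivative_real_field)
    then show "(?F has_vector_derivative of_real (K\<^sup>2 - x\<^sup>2) * cis (x * \<delta>)) (at x within {-K..K})"
      unfolding c by simp
  qed (use assms in \<open>auto intro!: continuous_intros\<close>)
  also have "\<dots> = 2 * of_real K / s\<^sup>2 * (exp (s * of_real K) + exp (s * of_real (- K))) - 2 / s ^ 3 * (exp (s * of_real K) - exp (s * of_real (- K)))"
  proof -
    have "?P K = 2 * of_real K / s\<^sup>2 - 2 / s ^ 3" "?P (- K) = - (2 * of_real K / s\<^sup>2) - 2 / s ^ 3" by simp_all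
    moreover have "(x - y) * e - (- x - y) * f = x * (e + f) - y * (e - f)" for x y e f :: complex
      by (simp add: algebra_simps)
    ultimately show ?thesis by (simp only:)
  qed
  also have "exp (s * of_real K) + exp (s * of_real (- K)) = of_real (2 * cos (K * \<delta>))"
    unfolding c[symmetric] by (simp add: complex_eq_iff)
  also have "exp (s * of_real K) - exp (s * of_real (- K)) = 2 * \<i> * of_real (sin (K * \<delta>))"
    unfolding c[symmetric] by (simp add: complex_eq_iff)
  also have "2 * of_real K / s\<^sup>2 * of_real (2 * cos (K * \<delta>)) - 2 / s ^ 3 * (2 * \<i> * of_real (sin (K * \<delta>)))
    = complex_of_real (4 * sin (K * \<delta>) / \<delta> ^ 3 - 4 * K * cos (K * \<delta>) / \<delta>\<^sup>2)"
    unfolding s_def using False by (simp add: power2_eq_square power3_eq_cube field_simps)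
  finally show ?thesis using False by simp
qed

text \<open>The truncated function is (K^2 - k^2) / (4 \<xi>), which is nonnegative exactly on
  [-K, K].\<close>

lemma integral_limit_kernel_value:
  assumes "0 < \<xi>" "\<xi> < 4"
  defines "K \<equiv> sqrt (\<xi> * (4 - \<xi>))"
  shows "integral\<^sup>L (lborel \<Otimes>\<^sub>M lborel) (limit_kernel \<beta> \<xi> (\<xi> * \<delta>\<^sup>2)) =
    complex_of_real (exp \<beta> * pi / (4 * \<xi>\<^sup>2) * (if \<delta> = 0 then 4 * K ^ 3 / 3 else 4 * sin (K * \<delta>) / \<delta> ^ 3 - 4 * K * cos (K * \<delta>) / \<delta>\<^sup>2))"
proof -
  have K: "K > 0" "K\<^sup>2 = \<xi> * (4 - \<xi>)" using assms by (auto simp: K_def)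
  have m: "cis (k * \<delta>) * of_real (max (1 - \<xi> / 4 - k\<^sup>2 / (4 * \<xi>)) 0)
     = 1 / of_real (4 * \<xi>) * (indicator {-K..K} k *\<^sub>R (of_real (K\<^sup>2 - k\<^sup>2) * cis (k * \<delta>)))" for k
  proof -
    have e: "1 - \<xi> / 4 - k\<^sup>2 / (4 * \<xi>) = (K\<^sup>2 - k\<^sup>2) / (4 * \<xi>)"
      using assms(1) unfolding K(2) by (simp add: field_simps power2_eq_square)
    have "k\<^sup>2 \<le> K\<^sup>2 \<longleftrightarrow> k \<in> {-K..K}"
      using K(1) by (auto simp: abs_le_square_iff[symmetric])
    then have "max (1 - \<xi> / 4 - k\<^sup>2 / (4 * \<xi>)) 0 = indicator {-K..K} k * ((K\<^sup>2 - k\<^sup>2) / (4 * \<xi>))"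
      unfolding e using assms(1) by (auto simp: max_def zero_le_divide_iff indicator_def field_simps)
    then show ?thesis by (simp add: scaleR_conv_of_real)
  qed
  show ?thesis
    unfolding integral_limit_kernel[OF assms(1)] m integral_mult_right_zero integral_parabola_cis[OF K(1)]
    using assms(1) by (simp add: power2_eq_square)
qed

subsection \<open>The limit of the correlation function\<close>

lemma det_shift_eq_fdet:
  "det_shift m (sample_cov n m \<omega>) (complex_of_real \<mu>) = complex_of_real (fdet m (shift (gram n id \<omega>) \<mu>))"
proof -
  have "map_mat complex_of_real (sample_cov n m \<omega>) - complex_of_real \<mu> \<cdot>\<^sub>m 1\<^sub>m m
     = map_mat complex_of_real (Matrix.mat m m (\<lambda>(i, j). shift (gram n id \<omega>) \<mu> i j))"
    by (rule Matrix.eq_matI)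
      (auto simp: sample_cov_def data_matrix_def shift_def gram_def scalar_prod_def lessThan_atLeast0)
  then show ?thesis
    unfolding det_shift_def fdet_def by (simp add: of_real_hom.hom_det)
qed

lemma (in fourth_moment_law) corr_fun_eq_corr_poly:
  "corr_fun Q n m (complex_of_real \<mu>) (complex_of_real \<nu>) = complex_of_real (corr_poly (b - 3) n m (\<mu> + \<nu>) (\<mu> * \<nu>))"
proof -
  have "corr_fun Q n m (complex_of_real \<mu>) (complex_of_real \<nu>) = complex_of_real (corr {..<m} n m id \<mu> \<nu>)"
    unfolding corr_fun_def corr_def det_shift_eq_fdet entry_space_def of_real_mult[symmetric]
    by (rule integral_complex_of_real)
  then show ?thesis by (simp add: corr_eq_corr_poly)
qed

theorem theorem4p2:
  fixes Q :: "real measure" and b \<xi> \<mu> \<nu> :: real and \<alpha> :: nat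
  assumes "real_distribution Q"
    and "integrable Q (\<lambda>x. x ^ 4)"
    and "prob_space.expectation Q (\<lambda>x. x) = 0"
    and "prob_space.variance Q (\<lambda>x. x) = 1"
    and "b = prob_space.expectation Q (\<lambda>x. x ^ 4)"
    and "\<xi> \<in> {0<..<4}"
  shows "(\<lambda>N. complex_of_real
            (inverse (real N) * inverse \<xi> * inverse (mp_density \<xi> ^ 3)
              * Z_factor \<alpha> N \<xi> (\<mu> / mp_density \<xi>) (\<nu> / mp_density \<xi>))
          * (corr_fun Q N (N - \<alpha>)
               (complex_of_real (real N * \<xi> + \<mu> / mp_density \<xi>))
               (complex_of_real (real N * \<xi> + \<nu> / mp_density \<xi>))
             / (fact N * fact (N - \<alpha>))))
         \<longlonglongrightarrow> complex_of_real (exp (b - 3) * diff_sine_kernel \<mu> \<nu>)"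
proof -
  interpret real_distribution Q by (rule assms(1))
  interpret fourth_moment_law Q b
    by unfold_locales (use assms in \<open>simp_all\<close>)
  have \<xi>: "0 < \<xi>" "\<xi> < 4" using assms(6) by auto
  define g where "g = mp_density \<xi>"
  define K where "K = sqrt (\<xi> * (4 - \<xi>))"
  \<comment> \<open>The edge of the parabola is the Marchenko-Pastur density up to the factor 2 pi
    \<xi>; this is where the density enters the limit.\<close>
  have K: "K = 2 * pi * \<xi> * g" using \<xi> by (simp add: g_def mp_density_def K_def)
  have g0: "g > 0" using \<xi> by (simp add: g_def mp_density_def)
  define \<mu>' \<nu>' where "\<mu>' = \<mu> / g" and "\<nu>' = \<nu> / g"
  \<comment> \<open>Chosen such that the limit of n d has the form \<xi> \<delta>^2 and K \<delta> =
    pi (\<mu> - \<nu>).\<close>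
  define \<delta> where "\<delta> = (\<mu> - \<nu>) / (2 * \<xi> * g)"
  define x y where "x n = real n * \<xi> + \<mu>'" and "y n = real n * \<xi> + \<nu>'" for n
  define q where "q n = sqrt (x n * y n)" for n
  define d where "d n = x n + y n - 2 * q n" for n
  define M where "M n = 2 * (n - \<alpha>) + \<alpha> + 3" for n
  have ev: "\<forall>\<^sub>F n in sequentially. n > 0 \<and> n \<ge> \<alpha> \<and> x n > 0 \<and> y n > 0"
  proof -
    have "filterlim x at_top sequentially" "filterlim y at_top sequentially"
      unfolding x_def y_def using \<xi> by real_asymp+
    then have "\<forall>\<^sub>F n in sequentially. x n > 0" "\<forall>\<^sub>F n in sequentially. y n > 0"
      by (auto simp: filterlim_at_top_dense)
    then show ?thesis
      using eventually_gt_at_top[of 0] eventually_ge_at_top[of \<alpha>] by eventually_elim auto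
  qed
  have limq: "(\<lambda>n. q n / real n) \<longlonglongrightarrow> \<xi>"
  proof -
    have "(\<lambda>n. sqrt ((\<xi> + \<mu>' / real n) * (\<xi> + \<nu>' / real n))) \<longlonglongrightarrow> sqrt ((\<xi> + 0) * (\<xi> + 0))"
      by (intro tendsto_intros real_tendsto_divide_at_top[OF tendsto_const] filterlim_real_sequentially)
    then have "(\<lambda>n. sqrt ((\<xi> + \<mu>' / real n) * (\<xi> + \<nu>' / real n))) \<longlonglongrightarrow> \<xi>"
      using \<xi> by simp
    then show ?thesis
    proof (rule Lim_transform_eventually)
      show "\<forall>\<^sub>F n in sequentially. sqrt ((\<xi> + \<mu>' / real n) * (\<xi> + \<nu>' / real n)) = q n / real n"
        using eventually_gt_at_top[of 0]
      proof eventually_elim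
        case (elim n)
        then have "(\<xi> + \<mu>' / real n) * (\<xi> + \<nu>' / real n) = x n * y n / (real n)\<^sup>2"
          by (simp add: x_def y_def field_simps power2_eq_square)
        then show ?case by (simp add: q_def real_sqrt_divide)
      qed
    qed
  qed
  have limd: "(\<lambda>n. real n * d n) \<longlonglongrightarrow> \<xi> * \<delta>\<^sup>2"
  proof -
    \<comment> \<open>The difference of arithmetic and geometric mean is rationalized: d (x + y + 2
      q) = (x - y)^2, where x - y does not depend on n and the other factor grows like 4 n
      \<xi>.\<close>
    have "(\<lambda>n. (\<mu>' - \<nu>')\<^sup>2 / (\<xi> + \<mu>' / real n + (\<xi> + \<nu>' / real n) + 2 * (q n / real n))) \<longlonglongrightarrow> (\<mu>' - \<nu>')\<^sup>2 / (\<xi> + 0 + (\<xi> + 0) + 2 * \<xi>)"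
      using \<xi> by (intro tendsto_intros limq real_tendsto_divide_at_top[OF tendsto_const] filterlim_real_sequentially) auto
    also have "(\<mu>' - \<nu>')\<^sup>2 / (\<xi> + 0 + (\<xi> + 0) + 2 * \<xi>) = \<xi> * \<delta>\<^sup>2"
      using \<xi> g0 by (simp add: \<mu>'_def \<nu>'_def \<delta>_def diff_divide_distrib[symmetric] power_divide power2_eq_square)
    finally show ?thesis
    proof (rule Lim_transform_eventually)
      show "\<forall>\<^sub>F n in sequentially. (\<mu>' - \<nu>')\<^sup>2 / (\<xi> + \<mu>' / real n + (\<xi> + \<nu>' / real n) + 2 * (q n / real n)) = real n * d n"
        using ev
      proof eventually_elim
        case (elim n)
        have q2: "(q n)\<^sup>2 = x n * y n" and qp: "q n > 0" using elim by (simp_all add: q_def)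
        have "\<xi> + \<mu>' / real n + (\<xi> + \<nu>' / real n) + 2 * (q n / real n) = (x n + y n + 2 * q n) / real n"
          using elim by (simp add: x_def y_def field_simps)
        moreover have "(\<mu>' - \<nu>')\<^sup>2 = d n * (x n + y n + 2 * q n)"
        proof -
          have "d n * (x n + y n + 2 * q n) = (x n + y n)\<^sup>2 - 4 * (q n)\<^sup>2"
            by (simp add: d_def power2_eq_square algebra_simps)
          also have "\<dots> = (x n - y n)\<^sup>2" unfolding q2 by (simp add: power2_eq_square algebra_simps)
          finally show ?thesis by (simp add: x_def y_def)
        qed
        moreover have "x n + y n + 2 * q n > 0" using elim qp by simp
        ultimately show ?case using elim by simp
      qed
    qed
  qed
  have limM: "(\<lambda>n. real (M n) / (2 * real n)) \<longlonglongrightarrow> 1"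
  proof -
    have "(\<lambda>n. (2 * real n + (3 - real \<alpha>)) / (2 * real n)) \<longlonglongrightarrow> 1" by real_asymp
    then show ?thesis
      by (rule Lim_transform_eventually)
        (use ev in \<open>auto elim!: eventually_mono simp: M_def of_nat_diff algebra_simps\<close>)
  qed
  have d0: "\<forall>\<^sub>F n in sequentially. d n \<ge> 0"
    using ev
  proof eventually_elim
    case (elim n)
    then show ?case using arith_geo_mean_sqrt[of "x n" "y n"] by (simp add: d_def q_def)
  qed
  let ?I = "\<lambda>n. 1 / of_nat n * (\<integral>\<theta>. indicator {-pi..pi} \<theta> *\<^sub>R (\<integral>\<phi>. indicator {-pi..pi} \<phi> *\<^sub>R
       corr_kernel (b - 3) \<alpha> (M n) (d n) (q n) (Complex (1 / (2 * real n)) (- \<theta> / 2)) \<phi> \<partial>lborel) \<partial>lborel)"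
  \<comment> \<open>The normalization of the statement without 1 / N, which has gone into the
    integral, and 1 / (2 pi) for each of the two angles.\<close>
  let ?c = "complex_of_real (inverse \<xi> * inverse (g ^ 3)) * (1 / (4 * of_real pi ^ 2))"
  have "(\<lambda>n. ?c * ?I n) \<longlonglongrightarrow> ?c * integral\<^sup>L (lborel \<Otimes>\<^sub>M lborel) (limit_kernel (b - 3) \<xi> (\<xi> * \<delta>\<^sup>2))"
    by (intro tendsto_mult tendsto_const corr_kernel_integral_limit[OF \<xi>(1) limq limd limM d0])
  also have "?c * integral\<^sup>L (lborel \<Otimes>\<^sub>M lborel) (limit_kernel (b - 3) \<xi> (\<xi> * \<delta>\<^sup>2)) = complex_of_real (exp (b - 3) * diff_sine_kernel \<mu> \<nu>)"
  proof -
    define W where "W = (if \<delta> = 0 then 4 * K ^ 3 / 3 else 4 * sin (K * \<delta>) / \<delta> ^ 3 - 4 * K * cos (K * \<delta>) / \<delta>\<^sup>2)"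
    \<comment> \<open>The powers \<xi>^3 and g^3 cancel the normalization together with the factor
      \<xi>^-2 of the limit integral; for \<mu> = \<nu> the value is the continuous extension on
      both sides.\<close>
    have W: "W = 16 * pi * \<xi> ^ 3 * g ^ 3 * diff_sine_kernel \<mu> \<nu>"
    proof (cases "\<mu> = \<nu>")
      case True
      then have "\<delta> = 0" by (simp add: \<delta>_def)
      then show ?thesis using True unfolding W_def K
        by (simp add: diff_sine_kernel_def power_mult_distrib power2_eq_square power3_eq_cube)
    next
      case False
      then have "\<delta> \<noteq> 0" using \<xi> g0 by (simp add: \<delta>_def)
      moreover have "K * \<delta> = pi * (\<mu> - \<nu>)" unfolding K \<delta>_def using \<xi> g0 by simp
      ultimately have "W = 4 * sin (pi * (\<mu> - \<nu>)) / \<delta> ^ 3 - 4 * K * cos (pi * (\<mu> - \<nu>)) / \<delta>\<^sup>2"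
        unfolding W_def by simp
      also have "\<dots> = 32 * \<xi> ^ 3 * g ^ 3 * sin (pi * (\<mu> - \<nu>)) / (\<mu> - \<nu>) ^ 3 - 32 * pi * \<xi> ^ 3 * g ^ 3 * cos (pi * (\<mu> - \<nu>)) / (\<mu> - \<nu>)\<^sup>2"
        unfolding \<delta>_def K by (simp add: power_divide power_mult_distrib power2_eq_square power3_eq_cube mult_ac)
      also have "\<dots> = 16 * pi * \<xi> ^ 3 * g ^ 3 * diff_sine_kernel \<mu> \<nu>"
        using False by (simp add: diff_sine_kernel_def right_diff_distrib)
      finally show ?thesis .
    qed
    have "?c * integral\<^sup>L (lborel \<Otimes>\<^sub>M lborel) (limit_kernel (b - 3) \<xi> (\<xi> * \<delta>\<^sup>2))
      = complex_of_real (inverse \<xi> * inverse (g ^ 3) * (1 / (4 * pi\<^sup>2)) * (exp (b - 3) * pi / (4 * \<xi>\<^sup>2) * W))"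
      unfolding integral_limit_kernel_value[OF \<xi>] K_def[symmetric] W_def[symmetric] by simp
    also have "\<dots> = complex_of_real (exp (b - 3) * diff_sine_kernel \<mu> \<nu>)"
    proof -
      have "inverse t * inverse (h ^ 3) * (1 / (4 * p\<^sup>2)) * (e * p / (4 * t\<^sup>2) * (16 * p * t ^ 3 * h ^ 3 * s)) = e * s"
        if "t > 0" "h > 0" "p > 0" for t h p e s :: real
        using that by (simp add: field_simps power2_eq_square power3_eq_cube)
      from this[OF \<xi>(1) g0 pi_gt_zero, of "exp (b - 3)" "diff_sine_kernel \<mu> \<nu>"] show ?thesis
        unfolding W by (rule arg_cong[where f = complex_of_real])
    qed
    finally show ?thesis .
  qed
  finally show ?thesis
  proof (rule Lim_transform_eventually)
    show "\<forall>\<^sub>F N in sequentially. ?c * ?I N = complex_of_real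
            (inverse (real N) * inverse \<xi> * inverse (mp_density \<xi> ^ 3)
              * Z_factor \<alpha> N \<xi> (\<mu> / mp_density \<xi>) (\<nu> / mp_density \<xi>))
          * (corr_fun Q N (N - \<alpha>)
               (complex_of_real (real N * \<xi> + \<mu> / mp_density \<xi>))
               (complex_of_real (real N * \<xi> + \<nu> / mp_density \<xi>))
             / (fact N * fact (N - \<alpha>)))"
      using ev
    proof eventually_elim
      case (elim n)
      define m where "m = n - \<alpha>"
      have m: "m + \<alpha> = n" using elim by (simp add: m_def)
      have qp: "q n > 0" and q2: "(q n)\<^sup>2 = x n * y n" using elim by (simp_all add: q_def)
      have xy: "x n + y n = d n + 2 * q n" by (simp add: d_def)
      have Z: "Z_factor \<alpha> n \<xi> \<mu>' \<nu>' = q n ^ \<alpha> * exp (- (d n + 2 * q n) / 2)"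
      proof -
        have "(real n)\<^sup>2 * \<xi>\<^sup>2 + real n * \<xi> * (\<mu>' + \<nu>') + \<mu>' * \<nu>' = (q n)\<^sup>2"
          unfolding q2 by (simp add: x_def y_def power2_eq_square algebra_simps)
        \<comment> \<open>The base of the real power is x y = q^2, positive for large n, so half of
          \<alpha> becomes the natural exponent \<alpha> of q.\<close>
        moreover have "((q n)\<^sup>2) powr (real \<alpha> / 2) = q n ^ \<alpha>"
        proof -
          have "(q n)\<^sup>2 = q n powr 2" using qp by simp
          then have "((q n)\<^sup>2) powr (real \<alpha> / 2) = q n powr (2 * (real \<alpha> / 2))" by (simp only: powr_powr)
          then show ?thesis using qp by (simp add: powr_realpow)
        qed
        moreover have "- real n * \<xi> - (\<mu>' + \<nu>') / 2 = - (d n + 2 * q n) / 2"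
          unfolding xy[symmetric] by (simp add: x_def y_def field_simps)
        ultimately show ?thesis unfolding Z_factor_def by (simp only:)
      qed
      have F: "corr_fun Q n m (complex_of_real (x n)) (complex_of_real (y n)) / (fact n * fact m)
        = complex_of_real (corr_poly (b - 3) (m + \<alpha>) m (d n + 2 * q n) ((q n)\<^sup>2) / (fact (m + \<alpha>) * fact m))"
        unfolding corr_fun_eq_corr_poly xy q2[symmetric] m by simp
      have "complex_of_real (inverse (real n) * inverse \<xi> * inverse (g ^ 3) * Z_factor \<alpha> n \<xi> \<mu>' \<nu>')
          * (corr_fun Q n m (complex_of_real (x n)) (complex_of_real (y n)) / (fact n * fact m))
        = complex_of_real (inverse (real n) * inverse \<xi> * inverse (g ^ 3)) *
           of_real (q n ^ \<alpha> * exp (- (d n + 2 * q n) / 2) * (corr_poly (b - 3) (m + \<alpha>) m (d n + 2 * q n) ((q n)\<^sup>2) / (fact (m + \<alpha>) * fact m)))"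
        unfolding F Z of_real_mult by (simp only: mult.assoc)
      also have "\<dots> = ?c * ?I n"
      proof -
        have M: "2 * m + \<alpha> + 3 = M n" by (simp add: M_def m_def)
        have "of_real (inverse (real n) * i * h) * (s * X) = of_real (i * h) * s * (1 / of_nat n * X)"
          for i h :: real and s X :: complex
          by (simp add: divide_inverse mult_ac)
        then show ?thesis unfolding corr_poly_integral[OF conjunct1[OF elim] qp] M .
      qed
      finally show ?case unfolding m_def x_def y_def \<mu>'_def \<nu>'_def g_def by simp
    qed
  qed
qed

end
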